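(* Let $f:X\to Y$ be a morphism of cubical sets and let $\mathcal{A}$ be an AB4-category. Then for any functor $F:(\Box/X)^{op}\to\mathcal{A}$ there are natural isomorphisms $H_n(X,F)\xrightarrow{\cong}H_n(Y,f_*F)$, for all $n\ge0$.
   Context: **AB4-category.** An Abelian category with all small coproducts in which coproducts are exact (Grothendieck's axioms AB3, AB4). **Cube category.** $\Box$ has objects $\mathbb{I}^n=\{0,1\}^n$, $n\ge 0$ (with the product order); its morphisms are all compositions of the maps $\delta_i^{k,\varepsilon}:\mathbb{I}^{k-1}\to\mathbb{I}^k$, $\delta_i^{k,\varepsilon}(x_1,\dots,x_{k-1})=(x_1,\dots,x_{i-1},\varepsilon,x_i,\dots,x_{k-1})$ and $\sigma_i^k:\mathbb{I}^k\to\mathbb{I}^{k-1}$, $\sigma^k_i(x_1,\dots,x_k)=(x_1,\dots,x_{i-1},x_{i+1},\dots,x_k)$ ($k\ge1$, $1\le i\le k$, $\varepsilon\in\{0,1\}$) (and identities). A cubical set is a functor $X:\Box^{op}\to\mathrm{Set}$, $X_n=X(\mathbb{I}^n)$; morphisms are natural transformations. **Category $\Box/X$.** Objects: elements $x\in\coprod_n X_n$. For $y\in X_m$, $x\in X_n$, morphisms $y\to x$ are the $\alpha\in\Box(\mathbb{I}^m,\mathbb{I}^n)$ with $X(\alpha)(x)=y$. So $F:(\Box/X)^{op}\to\mathcal{A}$ gives morphisms $F(\alpha):F(x)\to F(X(\alpha)x)$. A morphism $f:X\to Y$ induces $\Box/f:\Box/X\to\Box/Y$, $x\mapsto f(x)$,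 $\alpha\mapsto\alpha$. **Homology $H_n(X,F)$.** Put $C_n(X,F)=\bigoplus_{x\in X_n}F(x)$ with injections $in_x$. Define $d_i^{n,\varepsilon}:C_n(X,F)\to C_{n-1}(X,F)$ by $d_i^{n,\varepsilon}\circ in_x=in_{X(\delta_i^{n,\varepsilon})x}\circ F(\delta_i^{n,\varepsilon})$, and $s_i^n:C_{n-1}(X,F)\to C_n(X,F)$ by $s_i^n\circ in_x=in_{X(\sigma_i^n)x}\circ F(\sigma_i^n)$. Let $C^{N}_n(X,F)=\mathrm{Coker}\big((s_1^n,\dots,s_n^n):C_{n-1}(X,F)^{\oplus n}\to C_n(X,F)\big)$, with differentials induced by $\sum_{i=1}^n(-1)^i(d_i^{n,0}-d_i^{n,1})$. Then $H_n(X,F)$ is the $n$-th homology object of $C^N_*(X,F)$. **Direct image.** $f_*F:(\Box/Y)^{op}\to\mathcal{A}$ is the left Kan extension of $F$ along $(\Box/f)^{op}$; explicitly, for $y\in Y_n$, $f_*F(y)=\bigoplus_{x\in f_n^{-1}(y)}F(x)$, and for a morphism $\beta:y\to z$ of $\Box/Y$ the morphism $(f_*F)(\beta):f_*F(z)\to f_*F(y)$ restricts on the summand $F(x)$, $f(x)=z$, to $F(\beta):F(x)\to F(X(\beta)x)$ followed by the inclusion of the summand $F(X(\beta)x)$. *)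

theory Defs
  imports "HOL-Algebra.FiniteProduct" "HOL-Library.FuncSet"
begin

section \<open>Categories\<close>

record ('o, 'a) category_data =
  Ob :: "'o set"
  Arr :: "'a set"
  Dom :: "'a \<Rightarrow> 'o"
  Cod :: "'a \<Rightarrow> 'o"
  Ide :: "'o \<Rightarrow> 'a"
  Comp :: "'a \<Rightarrow> 'a \<Rightarrow> 'a"  (infixl "\<cdot>\<index>" 70)

definition Hom :: "('o, 'a, 'z) category_data_scheme \<Rightarrow> 'o \<Rightarrow> 'o \<Rightarrow> 'a set" where
  "Hom C A B = {f \<in> Arr C. Dom C f = A \<and> Cod C f = B}"

locale category =
  fixes C :: "('o, 'a, 'z) category_data_scheme" (structure)
  assumes Dom_in_Ob: "f \<in> Arr C \<Longrightarrow> Dom C f \<in> Ob C"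
    and Cod_in_Ob: "f \<in> Arr C \<Longrightarrow> Cod C f \<in> Ob C"
    and Ide_in_Hom: "A \<in> Ob C \<Longrightarrow> Ide C A \<in> Hom C A A"
    and Comp_in_Hom: "\<lbrakk>f \<in> Hom C A B; g \<in> Hom C B D\<rbrakk> \<Longrightarrow> g \<cdot> f \<in> Hom C A D"
    and Comp_Ide: "f \<in> Hom C A B \<Longrightarrow> f \<cdot> Ide C A = f"
    and Ide_Comp: "f \<in> Hom C A B \<Longrightarrow> Ide C B \<cdot> f = f"
    and Comp_assoc: "\<lbrakk>f \<in> Hom C A B; g \<in> Hom C B D; h \<in> Hom C D E\<rbrakk>
           \<Longrightarrow> h \<cdot> (g \<cdot> f) = (h \<cdot> g) \<cdot> f"

definition opposite :: "('o, 'a) category_data \<Rightarrow> ('o, 'a) category_data" where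
  "opposite C = \<lparr>Ob = Ob C, Arr = Arr C, Dom = Cod C, Cod = Dom C, Ide = Ide C,
                 Comp = (\<lambda>g f. Comp C f g)\<rparr>"

definition is_iso :: "('o, 'a, 'z) category_data_scheme \<Rightarrow> 'a \<Rightarrow> bool" where
  "is_iso C f \<longleftrightarrow> f \<in> Arr C \<and>
     (\<exists>g \<in> Hom C (Cod C f) (Dom C f).
        g \<cdot>\<^bsub>C\<^esub> f = Ide C (Dom C f) \<and> f \<cdot>\<^bsub>C\<^esub> g = Ide C (Cod C f))"

definition is_mono :: "('o, 'a, 'z) category_data_scheme \<Rightarrow> 'a \<Rightarrow> bool" where
  "is_mono C f \<longleftrightarrow> f \<in> Arr C \<and>
     (\<forall>A \<in> Ob C. \<forall>u \<in> Hom C A (Dom C f). \<forall>v \<in> Hom C A (Dom C f).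
        f \<cdot>\<^bsub>C\<^esub> u = f \<cdot>\<^bsub>C\<^esub> v \<longrightarrow> u = v)"

definition is_epi :: "('o, 'a, 'z) category_data_scheme \<Rightarrow> 'a \<Rightarrow> bool" where
  "is_epi C f \<longleftrightarrow> f \<in> Arr C \<and>
     (\<forall>A \<in> Ob C. \<forall>u \<in> Hom C (Cod C f) A. \<forall>v \<in> Hom C (Cod C f) A.
        u \<cdot>\<^bsub>C\<^esub> f = v \<cdot>\<^bsub>C\<^esub> f \<longrightarrow> u = v)"

record ('o1, 'a1, 'o2, 'a2) functor_data =
  obmap :: "'o1 \<Rightarrow> 'o2"
  arrmap :: "'a1 \<Rightarrow> 'a2"

locale is_functor = source: category C + target: category D
  for C :: "('o1, 'a1, 'z1) category_data_scheme"
    and D :: "('o2, 'a2, 'z2) category_data_scheme" +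
  fixes F :: "('o1, 'a1, 'o2, 'a2) functor_data"
  assumes obmap_in_Ob: "A \<in> Ob C \<Longrightarrow> obmap F A \<in> Ob D"
    and arrmap_in_Hom: "f \<in> Hom C A B \<Longrightarrow> arrmap F f \<in> Hom D (obmap F A) (obmap F B)"
    and arrmap_Ide: "A \<in> Ob C \<Longrightarrow> arrmap F (Ide C A) = Ide D (obmap F A)"
    and arrmap_Comp: "\<lbrakk>f \<in> Hom C A B; g \<in> Hom C B E\<rbrakk>
           \<Longrightarrow> arrmap F (g \<cdot>\<^bsub>C\<^esub> f) = arrmap F g \<cdot>\<^bsub>D\<^esub> arrmap F f"

locale nat_trans = source_functor: is_functor C D F + target_functor: is_functor C D G
  for C :: "('o1, 'a1, 'z1) category_data_scheme"
    and D :: "('o2, 'a2, 'z2) category_data_scheme"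
    and F G :: "('o1, 'a1, 'o2, 'a2) functor_data" +
  fixes \<eta> :: "'o1 \<Rightarrow> 'a2"
  assumes component: "A \<in> Ob C \<Longrightarrow> \<eta> A \<in> Hom D (obmap F A) (obmap G A)"
    and naturality: "f \<in> Hom C A B \<Longrightarrow> \<eta> B \<cdot>\<^bsub>D\<^esub> arrmap F f = arrmap G f \<cdot>\<^bsub>D\<^esub> \<eta> A"

section \<open>Coproducts\<close>

definition is_coproduct ::
  "('o, 'a, 'z) category_data_scheme \<Rightarrow> 'i set \<Rightarrow> ('i \<Rightarrow> 'o) \<Rightarrow> 'o \<Rightarrow> ('i \<Rightarrow> 'a) \<Rightarrow> bool" where
  "is_coproduct C I A c \<iota> \<longleftrightarrow> c \<in> Ob C \<and> (\<forall>i\<in>I. \<iota> i \<in> Hom C (A i) c) \<and>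
     (\<forall>B \<in> Ob C. \<forall>g. (\<forall>i\<in>I. g i \<in> Hom C (A i) B) \<longrightarrow>
        (\<exists>!h. h \<in> Hom C c B \<and> (\<forall>i\<in>I. h \<cdot>\<^bsub>C\<^esub> \<iota> i = g i)))"

definition coprod ::
  "('o, 'a, 'z) category_data_scheme \<Rightarrow> 'i set \<Rightarrow> ('i \<Rightarrow> 'o) \<Rightarrow> 'o \<times> ('i \<Rightarrow> 'a)" where
  "coprod C I A = (SOME p. is_coproduct C I A (fst p) (snd p))"

abbreviation coprod_ob ::
  "('o, 'a, 'z) category_data_scheme \<Rightarrow> 'i set \<Rightarrow> ('i \<Rightarrow> 'o) \<Rightarrow> 'o" where
  "coprod_ob C I A \<equiv> fst (coprod C I A)"

abbreviation coprod_in ::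
  "('o, 'a, 'z) category_data_scheme \<Rightarrow> 'i set \<Rightarrow> ('i \<Rightarrow> 'o) \<Rightarrow> 'i \<Rightarrow> 'a" where
  "coprod_in C I A \<equiv> snd (coprod C I A)"

definition copair ::
  "('o, 'a, 'z) category_data_scheme \<Rightarrow> 'i set \<Rightarrow> ('i \<Rightarrow> 'o) \<Rightarrow> 'o \<Rightarrow> ('i \<Rightarrow> 'a) \<Rightarrow> 'a" where
  "copair C I A B g =
     (THE h. h \<in> Hom C (coprod_ob C I A) B \<and> (\<forall>i\<in>I. h \<cdot>\<^bsub>C\<^esub> coprod_in C I A i = g i))"

definition coprod_map ::
  "('o, 'a, 'z) category_data_scheme \<Rightarrow> 'i set \<Rightarrow> ('i \<Rightarrow> 'o) \<Rightarrow> ('i \<Rightarrow> 'o) \<Rightarrow> ('i \<Rightarrow> 'a) \<Rightarrow> 'a" where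
  "coprod_map C I A B g = copair C I A (coprod_ob C I B) (\<lambda>i. coprod_in C I B i \<cdot>\<^bsub>C\<^esub> g i)"

section \<open>Abelian categories and the axiom AB4\<close>

record ('o, 'a) preadditive_data = "('o, 'a) category_data" +
  Add :: "'a \<Rightarrow> 'a \<Rightarrow> 'a"
  Zero :: "'o \<Rightarrow> 'o \<Rightarrow> 'a"

definition hom_group ::
  "('o, 'a, 'z) preadditive_data_scheme \<Rightarrow> 'o \<Rightarrow> 'o \<Rightarrow> 'a monoid" where
  "hom_group C A B = \<lparr>carrier = Hom C A B, monoid.mult = Add C, one = Zero C A B\<rparr>"

locale preadditive_category = category C
  for C :: "('o, 'a, 'z) preadditive_data_scheme" (structure) +
  assumes comm_group_hom: "\<lbrakk>A \<in> Ob C; B \<in> Ob C\<rbrakk> \<Longrightarrow> comm_group (hom_group C A B)"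
    and Comp_Add: "\<lbrakk>f \<in> Hom C A B; f' \<in> Hom C A B; g \<in> Hom C B D\<rbrakk>
           \<Longrightarrow> g \<cdot> Add C f f' = Add C (g \<cdot> f) (g \<cdot> f')"
    and Add_Comp: "\<lbrakk>f \<in> Hom C A B; g \<in> Hom C B D; g' \<in> Hom C B D\<rbrakk>
           \<Longrightarrow> Add C g g' \<cdot> f = Add C (g \<cdot> f) (g' \<cdot> f)"

definition is_zero_object :: "('o, 'a, 'z) category_data_scheme \<Rightarrow> 'o \<Rightarrow> bool" where
  "is_zero_object C Z \<longleftrightarrow> Z \<in> Ob C \<and>
     (\<forall>A \<in> Ob C. (\<exists>!f. f \<in> Hom C A Z) \<and> (\<exists>!f. f \<in> Hom C Z A))"

definition zero_object :: "('o, 'a, 'z) category_data_scheme \<Rightarrow> 'o" where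
  "zero_object C = (SOME Z. is_zero_object C Z)"

definition is_biproduct ::
  "('o, 'a, 'z) preadditive_data_scheme \<Rightarrow> 'o \<Rightarrow> 'o \<Rightarrow> 'o \<Rightarrow> 'a \<Rightarrow> 'a \<Rightarrow> 'a \<Rightarrow> 'a \<Rightarrow> bool" where
  "is_biproduct C A B P i\<^sub>1 i\<^sub>2 p\<^sub>1 p\<^sub>2 \<longleftrightarrow>
     i\<^sub>1 \<in> Hom C A P \<and> i\<^sub>2 \<in> Hom C B P \<and> p\<^sub>1 \<in> Hom C P A \<and> p\<^sub>2 \<in> Hom C P B \<and>
     p\<^sub>1 \<cdot>\<^bsub>C\<^esub> i\<^sub>1 = Ide C A \<and> p\<^sub>2 \<cdot>\<^bsub>C\<^esub> i\<^sub>2 = Ide C B \<and>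
     p\<^sub>2 \<cdot>\<^bsub>C\<^esub> i\<^sub>1 = Zero C A B \<and> p\<^sub>1 \<cdot>\<^bsub>C\<^esub> i\<^sub>2 = Zero C B A \<and>
     Add C (i\<^sub>1 \<cdot>\<^bsub>C\<^esub> p\<^sub>1) (i\<^sub>2 \<cdot>\<^bsub>C\<^esub> p\<^sub>2) = Ide C P"

definition is_kernel :: "('o, 'a, 'z) preadditive_data_scheme \<Rightarrow> 'a \<Rightarrow> 'a \<Rightarrow> bool" where
  "is_kernel C f k \<longleftrightarrow> f \<in> Arr C \<and> k \<in> Arr C \<and> Cod C k = Dom C f \<and>
     f \<cdot>\<^bsub>C\<^esub> k = Zero C (Dom C k) (Cod C f) \<and>
     (\<forall>A \<in> Ob C. \<forall>h \<in> Hom C A (Dom C f). f \<cdot>\<^bsub>C\<^esub> h = Zero C A (Cod C f) \<longrightarrow>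
        (\<exists>!u. u \<in> Hom C A (Dom C k) \<and> k \<cdot>\<^bsub>C\<^esub> u = h))"

definition is_cokernel :: "('o, 'a, 'z) preadditive_data_scheme \<Rightarrow> 'a \<Rightarrow> 'a \<Rightarrow> bool" where
  "is_cokernel C f q \<longleftrightarrow> f \<in> Arr C \<and> q \<in> Arr C \<and> Dom C q = Cod C f \<and>
     q \<cdot>\<^bsub>C\<^esub> f = Zero C (Dom C f) (Cod C q) \<and>
     (\<forall>A \<in> Ob C. \<forall>h \<in> Hom C (Cod C f) A. h \<cdot>\<^bsub>C\<^esub> f = Zero C (Dom C f) A \<longrightarrow>
        (\<exists>!u. u \<in> Hom C (Cod C q) A \<and> u \<cdot>\<^bsub>C\<^esub> q = h))"

definition ker :: "('o, 'a, 'z) preadditive_data_scheme \<Rightarrow> 'a \<Rightarrow> 'a" where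
  "ker C f = (SOME k. is_kernel C f k)"

definition coker :: "('o, 'a, 'z) preadditive_data_scheme \<Rightarrow> 'a \<Rightarrow> 'a" where
  "coker C f = (SOME q. is_cokernel C f q)"

definition lift_mono :: "('o, 'a, 'z) category_data_scheme \<Rightarrow> 'a \<Rightarrow> 'a \<Rightarrow> 'a" where
  "lift_mono C k h = (THE u. u \<in> Hom C (Dom C h) (Dom C k) \<and> k \<cdot>\<^bsub>C\<^esub> u = h)"

definition descend_epi :: "('o, 'a, 'z) category_data_scheme \<Rightarrow> 'a \<Rightarrow> 'a \<Rightarrow> 'a" where
  "descend_epi C q h = (THE u. u \<in> Hom C (Cod C q) (Cod C h) \<and> u \<cdot>\<^bsub>C\<^esub> q = h)"

locale abelian_category = preadditive_category C
  for C :: "('o, 'a, 'z) preadditive_data_scheme" (structure) +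
  assumes zero_object_exists: "\<exists>Z. is_zero_object C Z"
    and biproduct_exists:
      "\<lbrakk>A \<in> Ob C; B \<in> Ob C\<rbrakk> \<Longrightarrow> \<exists>P i\<^sub>1 i\<^sub>2 p\<^sub>1 p\<^sub>2. is_biproduct C A B P i\<^sub>1 i\<^sub>2 p\<^sub>1 p\<^sub>2"
    and kernel_exists: "f \<in> Arr C \<Longrightarrow> \<exists>k. is_kernel C f k"
    and cokernel_exists: "f \<in> Arr C \<Longrightarrow> \<exists>q. is_cokernel C f q"
    and mono_is_kernel: "is_mono C f \<Longrightarrow> \<exists>g. is_kernel C g f"
    and epi_is_cokernel: "is_epi C f \<Longrightarrow> \<exists>g. is_cokernel C g f"

definition short_exact :: "('o, 'a, 'z) preadditive_data_scheme \<Rightarrow> 'a \<Rightarrow> 'a \<Rightarrow> bool" where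
  "short_exact C f g \<longleftrightarrow> is_kernel C g f \<and> is_cokernel C f g"

text \<open>
  ``Small'' is relative to a type \<open>'u\<close>: the small sets are the sets of elements of \<open>'u\<close>,
  and the coproducts required are those indexed by such sets. The category \<open>small_sets\<close>
  below uses the same \<open>'u\<close>; since \<open>'u\<close> is a type variable, any (set-sized) family of
  small sets is covered by choosing \<open>'u\<close> large enough.
\<close>

definition AB4_category :: "'u itself \<Rightarrow> ('o, 'a, 'z) preadditive_data_scheme \<Rightarrow> bool" where
  "AB4_category small C \<longleftrightarrow> abelian_category C \<and>
     (\<forall>(I :: 'u set) A. (\<forall>i\<in>I. A i \<in> Ob C) \<longrightarrow> (\<exists>c \<iota>. is_coproduct C I A c \<iota>)) \<and>
     (\<forall>(I :: 'u set) A B D f g.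
        (\<forall>i\<in>I. f i \<in> Hom C (A i) (B i) \<and> g i \<in> Hom C (B i) (D i) \<and> short_exact C (f i) (g i)) \<longrightarrow>
        short_exact C (coprod_map C I A B f) (coprod_map C I B D g))"

section \<open>Homology of chain complexes in nonnegative degrees\<close>

text \<open>\<open>bdry K n\<close> is the differential \<open>chain_ob K (n + 1) \<rightarrow> chain_ob K n\<close>.\<close>

record ('o, 'a) chain_complex =
  chain_ob :: "nat \<Rightarrow> 'o"
  bdry :: "nat \<Rightarrow> 'a"

definition bdry_from ::
  "('o, 'a, 'z) preadditive_data_scheme \<Rightarrow> ('o, 'a) chain_complex \<Rightarrow> nat \<Rightarrow> 'a" where
  "bdry_from C K n = (case n of 0 \<Rightarrow> Zero C (chain_ob K 0) (zero_object C) | Suc m \<Rightarrow> bdry K m)"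

definition cycles ::
  "('o, 'a, 'z) preadditive_data_scheme \<Rightarrow> ('o, 'a) chain_complex \<Rightarrow> nat \<Rightarrow> 'a" where
  "cycles C K n = ker C (bdry_from C K n)"

definition homology_proj ::
  "('o, 'a, 'z) preadditive_data_scheme \<Rightarrow> ('o, 'a) chain_complex \<Rightarrow> nat \<Rightarrow> 'a" where
  "homology_proj C K n = coker C (lift_mono C (cycles C K n) (bdry K n))"

definition homology ::
  "('o, 'a, 'z) preadditive_data_scheme \<Rightarrow> ('o, 'a) chain_complex \<Rightarrow> nat \<Rightarrow> 'o" where
  "homology C K n = Cod C (homology_proj C K n)"

definition homology_map ::
  "('o, 'a, 'z) preadditive_data_scheme \<Rightarrow> ('o, 'a) chain_complex \<Rightarrow> ('o, 'a) chain_complex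
    \<Rightarrow> (nat \<Rightarrow> 'a) \<Rightarrow> nat \<Rightarrow> 'a" where
  "homology_map C K L \<phi> n =
     descend_epi C (homology_proj C K n)
       (homology_proj C L n \<cdot>\<^bsub>C\<^esub> lift_mono C (cycles C L n) (\<phi> n \<cdot>\<^bsub>C\<^esub> cycles C K n))"

section \<open>Cubical sets\<close>

text \<open>\<open>False\<close> and \<open>True\<close> stand for 0 and 1.\<close>

definition cube :: "nat \<Rightarrow> bool list set" where
  "cube n = {xs. length xs = n}"

text \<open>
  Arrows of the cube category and of the category of small sets are triples
  (source, function, target), the function being extensional on the source.
\<close>

definition fun_of :: "'s \<times> 'f \<times> 't \<Rightarrow> 'f" where
  "fun_of a = fst (snd a)"

type_synonym box_arrow = "nat \<times> (bool list \<Rightarrow> bool list) \<times> nat"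

definition face :: "nat \<Rightarrow> nat \<Rightarrow> bool \<Rightarrow> box_arrow" where
  "face k i \<epsilon> = (k - 1, \<lambda>xs \<in> cube (k - 1). take (i - 1) xs @ \<epsilon> # drop (i - 1) xs, k)"

definition degen :: "nat \<Rightarrow> nat \<Rightarrow> box_arrow" where
  "degen k i = (k, \<lambda>xs \<in> cube k. take (i - 1) xs @ drop i xs, k - 1)"

inductive_set box_arrows :: "box_arrow set" where
  box_ide: "(n, \<lambda>xs \<in> cube n. xs, n) \<in> box_arrows"
| box_face: "\<lbrakk>1 \<le> i; i \<le> k\<rbrakk> \<Longrightarrow> face k i \<epsilon> \<in> box_arrows"
| box_degen: "\<lbrakk>1 \<le> i; i \<le> k\<rbrakk> \<Longrightarrow> degen k i \<in> box_arrows"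
| box_comp: "\<lbrakk>(l, \<alpha>, m) \<in> box_arrows; (m, \<beta>, n) \<in> box_arrows\<rbrakk>
             \<Longrightarrow> (l, compose (cube l) \<beta> \<alpha>, n) \<in> box_arrows"

definition box :: "(nat, box_arrow) category_data" where
  "box = \<lparr>Ob = UNIV, Arr = box_arrows, Dom = fst, Cod = (\<lambda>a. snd (snd a)),
          Ide = (\<lambda>n. (n, \<lambda>xs \<in> cube n. xs, n)),
          Comp = (\<lambda>b a. (fst a, compose (cube (fst a)) (fun_of b) (fun_of a), snd (snd b)))\<rparr>"

type_synonym 'u set_arrow = "'u set \<times> ('u \<Rightarrow> 'u) \<times> 'u set"

definition small_sets :: "('u set, 'u set_arrow) category_data" where
  "small_sets = \<lparr>Ob = UNIV, Arr = {(S, g, T). g \<in> S \<rightarrow>\<^sub>E T}, Dom = fst, Cod = (\<lambda>a. snd (snd a)),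
          Ide = (\<lambda>S. (S, \<lambda>x \<in> S. x, S)),
          Comp = (\<lambda>b a. (fst a, compose (fst a) (fun_of b) (fun_of a), snd (snd b)))\<rparr>"

type_synonym 'u cubical = "(nat, box_arrow, 'u set, 'u set_arrow) functor_data"

definition cubical_set :: "'u cubical \<Rightarrow> bool" where
  "cubical_set X \<longleftrightarrow> is_functor (opposite box) small_sets X"

definition cubical_map :: "'u cubical \<Rightarrow> 'u cubical \<Rightarrow> (nat \<Rightarrow> 'u set_arrow) \<Rightarrow> bool" where
  "cubical_map X Y f \<longleftrightarrow> nat_trans (opposite box) small_sets X Y f"

abbreviation cells :: "'u cubical \<Rightarrow> nat \<Rightarrow> 'u set" where
  "cells X n \<equiv> obmap X n"

definition act :: "'u cubical \<Rightarrow> box_arrow \<Rightarrow> 'u \<Rightarrow> 'u" where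
  "act X \<alpha> = fun_of (arrmap X \<alpha>)"

text \<open>
  The category of elements of \<open>X\<close>. The arrow \<open>(\<alpha>, x)\<close>, for \<open>\<alpha>\<close> from \<open>m\<close> to \<open>n\<close> in the cube
  category and \<open>x\<close> an \<open>n\<close>-cell, is \<open>\<alpha>\<close> viewed as an arrow \<open>(m, act X \<alpha> x) \<rightarrow> (n, x)\<close>.
\<close>

definition elements :: "'u cubical \<Rightarrow> (nat \<times> 'u, box_arrow \<times> 'u) category_data" where
  "elements X = \<lparr>Ob = {(n, x). x \<in> cells X n},
          Arr = {(\<alpha>, x). \<alpha> \<in> Arr box \<and> x \<in> cells X (Cod box \<alpha>)},
          Dom = (\<lambda>(\<alpha>, x). (Dom box \<alpha>, act X \<alpha> x)),
          Cod = (\<lambda>(\<alpha>, x). (Cod box \<alpha>, x)),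
          Ide = (\<lambda>(n, x). (Ide box n, x)),
          Comp = (\<lambda>(\<beta>, y) (\<alpha>, x). (\<beta> \<cdot>\<^bsub>box\<^esub> \<alpha>, y))\<rparr>"

type_synonym ('u, 'o, 'a) coeff = "(nat \<times> 'u, box_arrow \<times> 'u, 'o, 'a) functor_data"

section \<open>Homology of cubical sets with coefficients\<close>

definition chains ::
  "('o, 'a, 'z) preadditive_data_scheme \<Rightarrow> 'u cubical \<Rightarrow> ('u, 'o, 'a) coeff \<Rightarrow> nat \<Rightarrow> 'o" where
  "chains A X F n = coprod_ob A (cells X n) (\<lambda>x. obmap F (n, x))"

abbreviation chains_in ::
  "('o, 'a, 'z) preadditive_data_scheme \<Rightarrow> 'u cubical \<Rightarrow> ('u, 'o, 'a) coeff
    \<Rightarrow> nat \<Rightarrow> 'u \<Rightarrow> 'a" where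
  "chains_in A X F n \<equiv> coprod_in A (cells X n) (\<lambda>x. obmap F (n, x))"

definition face_op ::
  "('o, 'a, 'z) preadditive_data_scheme \<Rightarrow> 'u cubical \<Rightarrow> ('u, 'o, 'a) coeff
    \<Rightarrow> nat \<Rightarrow> nat \<Rightarrow> bool \<Rightarrow> 'a" where
  "face_op A X F n i \<epsilon> =
     copair A (cells X n) (\<lambda>x. obmap F (n, x)) (chains A X F (n - 1))
       (\<lambda>x. chains_in A X F (n - 1) (act X (face n i \<epsilon>) x) \<cdot>\<^bsub>A\<^esub> arrmap F (face n i \<epsilon>, x))"

definition degen_op ::
  "('o, 'a, 'z) preadditive_data_scheme \<Rightarrow> 'u cubical \<Rightarrow> ('u, 'o, 'a) coeff
    \<Rightarrow> nat \<Rightarrow> nat \<Rightarrow> 'a" where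
  "degen_op A X F n i =
     copair A (cells X (n - 1)) (\<lambda>x. obmap F (n - 1, x)) (chains A X F n)
       (\<lambda>x. chains_in A X F n (act X (degen n i) x) \<cdot>\<^bsub>A\<^esub> arrmap F (degen n i, x))"

text \<open>The groups \<open>hom_group\<close> are written multiplicatively, as in \<open>HOL-Algebra\<close>.\<close>

definition chain_diff ::
  "('o, 'a, 'z) preadditive_data_scheme \<Rightarrow> 'u cubical \<Rightarrow> ('u, 'o, 'a) coeff \<Rightarrow> nat \<Rightarrow> 'a" where
  "chain_diff A X F n =
     (let G = hom_group A (chains A X F n) (chains A X F (n - 1))
      in \<Otimes>\<^bsub>G\<^esub>i\<in>{1..n}. (face_op A X F n i False \<otimes>\<^bsub>G\<^esub> inv\<^bsub>G\<^esub> face_op A X F n i True)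
                          [^]\<^bsub>G\<^esub> ((- 1) ^ i :: int))"

definition degen_sum ::
  "('o, 'a, 'z) preadditive_data_scheme \<Rightarrow> 'u cubical \<Rightarrow> ('u, 'o, 'a) coeff \<Rightarrow> nat \<Rightarrow> 'a" where
  "degen_sum A X F n =
     copair A {1..n} (\<lambda>_. chains A X F (n - 1)) (chains A X F n) (degen_op A X F n)"

definition normal_proj ::
  "('o, 'a, 'z) preadditive_data_scheme \<Rightarrow> 'u cubical \<Rightarrow> ('u, 'o, 'a) coeff \<Rightarrow> nat \<Rightarrow> 'a" where
  "normal_proj A X F n = coker A (degen_sum A X F n)"

definition normal_chains ::
  "('o, 'a, 'z) preadditive_data_scheme \<Rightarrow> 'u cubical \<Rightarrow> ('u, 'o, 'a) coeff
    \<Rightarrow> ('o, 'a) chain_complex" where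
  "normal_chains A X F =
     \<lparr>chain_ob = (\<lambda>n. Cod A (normal_proj A X F n)),
      bdry = (\<lambda>n. descend_epi A (normal_proj A X F (Suc n))
                    (normal_proj A X F n \<cdot>\<^bsub>A\<^esub> chain_diff A X F (Suc n)))\<rparr>"

definition cubical_homology ::
  "('o, 'a, 'z) preadditive_data_scheme \<Rightarrow> nat \<Rightarrow> 'u cubical \<Rightarrow> ('u, 'o, 'a) coeff \<Rightarrow> 'o" where
  "cubical_homology A n X F = homology A (normal_chains A X F) n"

definition normal_chains_map ::
  "('o, 'a, 'z) preadditive_data_scheme \<Rightarrow> 'u cubical \<Rightarrow> ('u, 'o, 'a) coeff
    \<Rightarrow> ('u, 'o, 'a) coeff \<Rightarrow> (nat \<times> 'u \<Rightarrow> 'a) \<Rightarrow> nat \<Rightarrow> 'a" where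
  "normal_chains_map A X F G \<eta> n =
     descend_epi A (normal_proj A X F n)
       (normal_proj A X G n \<cdot>\<^bsub>A\<^esub>
        coprod_map A (cells X n) (\<lambda>x. obmap F (n, x)) (\<lambda>x. obmap G (n, x)) (\<lambda>x. \<eta> (n, x)))"

definition cubical_homology_map ::
  "('o, 'a, 'z) preadditive_data_scheme \<Rightarrow> nat \<Rightarrow> 'u cubical \<Rightarrow> ('u, 'o, 'a) coeff
    \<Rightarrow> ('u, 'o, 'a) coeff \<Rightarrow> (nat \<times> 'u \<Rightarrow> 'a) \<Rightarrow> 'a" where
  "cubical_homology_map A n X F G \<eta> =
     homology_map A (normal_chains A X F) (normal_chains A X G) (normal_chains_map A X F G \<eta>) n"

section \<open>Direct images\<close>

definition fibre :: "'u cubical \<Rightarrow> (nat \<Rightarrow> 'u set_arrow) \<Rightarrow> nat \<Rightarrow> 'u \<Rightarrow> 'u set" where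
  "fibre X f n y = {x \<in> cells X n. fun_of (f n) x = y}"

text \<open>The explicit coproduct formula for the left Kan extension along the functor induced by \<open>f\<close>.\<close>

definition direct_image ::
  "('o, 'a, 'z) preadditive_data_scheme \<Rightarrow> 'u cubical \<Rightarrow> 'u cubical \<Rightarrow> (nat \<Rightarrow> 'u set_arrow)
    \<Rightarrow> ('u, 'o, 'a) coeff \<Rightarrow> ('u, 'o, 'a) coeff" where
  "direct_image A X Y f F =
     (let fib = (\<lambda>(n, y). fibre X f n y);
          val = (\<lambda>(n, y) x. obmap F (n, x))
      in \<lparr>obmap = (\<lambda>p. coprod_ob A (fib p) (val p)),
          arrmap = (\<lambda>b. let s = Dom (elements Y) b; t = Cod (elements Y) b; \<beta> = fst b
             in copair A (fib t) (val t) (coprod_ob A (fib s) (val s))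
                  (\<lambda>x. coprod_in A (fib s) (val s) (act X \<beta> x) \<cdot>\<^bsub>A\<^esub> arrmap F (\<beta>, x)))\<rparr>)"

definition direct_image_map ::
  "('o, 'a, 'z) preadditive_data_scheme \<Rightarrow> 'u cubical \<Rightarrow> (nat \<Rightarrow> 'u set_arrow)
    \<Rightarrow> ('u, 'o, 'a) coeff \<Rightarrow> ('u, 'o, 'a) coeff
    \<Rightarrow> (nat \<times> 'u \<Rightarrow> 'a) \<Rightarrow> nat \<times> 'u \<Rightarrow> 'a" where
  "direct_image_map A X f F G \<eta> =
     (\<lambda>(n, y). coprod_map A (fibre X f n y) (\<lambda>x. obmap F (n, x)) (\<lambda>x. obmap G (n, x))
                 (\<lambda>x. \<eta> (n, x)))"

end

theory Submission
  imports Defs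
begin

text \<open>
  The chains \<open>C\<^sub>*(X, F)\<close> form a cubical object of the abelian category: the cube arrow \<open>\<alpha>\<close> acts by
  \<open>in\<^sub>x \<mapsto> in \<circ> F(\<alpha>)\<close>, the second injection being the one of \<open>X(\<alpha>)x\<close>. Faces and degeneracies are
  special cases, so the normalized complex, hence homology, is a functor of this cubical object.
  Since the \<open>n\<close>-cells of \<open>X\<close> are the disjoint union of the fibres of \<open>f\<close> over the \<open>n\<close>-cells of \<open>Y\<close>,
  regrouping the summands identifies \<open>C\<^sub>*(X, F)\<close> with \<open>C\<^sub>*(Y, f\<^sub>*F)\<close> as cubical objects, naturally in
  \<open>F\<close>.
\<close>

section \<open>Categories with a zero, kernels and cokernels\<close>

text \<open>\<open>coprod_ob\<close>, \<open>ker\<close> and \<open>coker\<close> are arbitrary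
  choices, so regrouping a coproduct over cells into a coproduct of coproducts over fibres yields an
  isomorphism and not an equality; and \<open>descend_epi\<close> and \<open>lift_mono\<close> are
  definite descriptions, meaningful only once the factorization is known to exist. Hence the
  homology functor has to be built in full. That the differential squares to zero and passes to the
  quotient by degeneracies rests on identities between faces and degeneracies, derived from the
  explicit list functions. For the square, the differences D_i of opposite faces satisfy D_i D_j =
  D_(j-1) D_i for i < j, so the simplicial cancellation applies to them. The maps between chains
  that matter have one shape, \<open>reindex_map\<close>: summand i goes to summand r(i) by an arrow
  g(i). They compose by composing the r and the g, and every naturality square between them is
  closed by reducing both composites to the same \<open>reindex_map\<close>. Only the inverse of the
  comparison has another shape; its naturality is inherited from the comparison.\<close>

context category
begin

lemma HomD: "f \<in> Hom C A B \<Longrightarrow> f \<in> Arr C \<and> Dom C f = A \<and> Cod C f = B"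
  by (simp add: Hom_def)

lemma Arr_in_Hom: "f \<in> Arr C \<Longrightarrow> f \<in> Hom C (Dom C f) (Cod C f)"
  by (simp add: Hom_def)

lemma Hom_Ob: "f \<in> Hom C A B \<Longrightarrow> A \<in> Ob C \<and> B \<in> Ob C"
  using Dom_in_Ob Cod_in_Ob by (auto simp: Hom_def)

lemma is_isoI:
  "\<lbrakk>f \<in> Hom C A B; g \<in> Hom C B A; g \<cdot> f = Ide C A; f \<cdot> g = Ide C B\<rbrakk> \<Longrightarrow> is_iso C f"
  by (auto simp: is_iso_def Hom_def)

end

context preadditive_category
begin

lemma hom_group_simps [simp]:
  "carrier (hom_group C A B) = Hom C A B"
  "\<one>\<^bsub>hom_group C A B\<^esub> = Zero C A B"
  by (simp_all add: hom_group_def)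

lemma hom_group_mult: "x \<otimes>\<^bsub>hom_group C A B\<^esub> y = Add C x y"
  by (simp add: hom_group_def)

lemma group_hom_group: "\<lbrakk>A \<in> Ob C; B \<in> Ob C\<rbrakk> \<Longrightarrow> group (hom_group C A B)"
  using comm_group_hom comm_group.axioms(2) by blast

lemma Zero_in_Hom: "\<lbrakk>A \<in> Ob C; B \<in> Ob C\<rbrakk> \<Longrightarrow> Zero C A B \<in> Hom C A B"
  using monoid.one_closed[OF group.is_monoid[OF group_hom_group]] by simp

lemma Add_in_Hom: "\<lbrakk>f \<in> Hom C A B; g \<in> Hom C A B\<rbrakk> \<Longrightarrow> Add C f g \<in> Hom C A B"
  using monoid.m_closed[OF group.is_monoid[OF group_hom_group], of A B f g] Hom_Ob[of f A B] by (simp add: hom_group_mult)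

lemma Add_Zero: "f \<in> Hom C A B \<Longrightarrow> Add C f (Zero C A B) = f"
  using monoid.r_one[OF group.is_monoid[OF group_hom_group], of A B f] Hom_Ob[of f A B] by (simp add: hom_group_mult)

lemma Zero_Add: "f \<in> Hom C A B \<Longrightarrow> Add C (Zero C A B) f = f"
  using monoid.l_one[OF group.is_monoid[OF group_hom_group], of A B f] Hom_Ob[of f A B] by (simp add: hom_group_mult)

text \<open>Bilinearity of composition in the form in which \<open>HOL-Algebra\<close> can use it:
  as homomorphisms of hom groups, composition maps preserve units, inverses, integer powers and
  finite products.\<close>

lemma Comp_left_hom:
  "g \<in> Hom C B D \<Longrightarrow> (\<lambda>f. g \<cdot> f) \<in> hom (hom_group C A B) (hom_group C A D)"
  by (auto simp: hom_def hom_group_mult Comp_Add Comp_in_Hom)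

lemma Comp_right_hom:
  "f \<in> Hom C A B \<Longrightarrow> (\<lambda>g. g \<cdot> f) \<in> hom (hom_group C B D) (hom_group C A D)"
  by (auto simp: hom_def hom_group_mult Add_Comp Comp_in_Hom)

lemma Comp_Zero: "\<lbrakk>g \<in> Hom C B D; A \<in> Ob C\<rbrakk> \<Longrightarrow> g \<cdot> Zero C A B = Zero C A D"
  using hom_one[OF Comp_left_hom[of g B D A] group_hom_group group_hom_group] Hom_Ob
  by simp

lemma Zero_Comp: "\<lbrakk>f \<in> Hom C A B; D \<in> Ob C\<rbrakk> \<Longrightarrow> Zero C B D \<cdot> f = Zero C A D"
  using hom_one[OF Comp_right_hom[of f A B D] group_hom_group group_hom_group] Hom_Ob
  by simp

lemma is_kernelD:
  assumes "is_kernel C f k"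
  shows "f \<in> Arr C" "k \<in> Hom C (Dom C k) (Dom C f)" "f \<cdot> k = Zero C (Dom C k) (Cod C f)"
  using assms by (auto simp: is_kernel_def Hom_def)

lemma is_cokernelD:
  assumes "is_cokernel C f q"
  shows "f \<in> Arr C" "q \<in> Hom C (Cod C f) (Cod C q)" "q \<cdot> f = Zero C (Dom C f) (Cod C q)"
  using assms by (auto simp: is_cokernel_def Hom_def)

text \<open>The universal property of the kernel supplies the unique solution that the definite
  description in \<open>lift_mono\<close> asks for.\<close>

lemma lift_mono_kernel:
  assumes "is_kernel C f k" "h \<in> Hom C A (Dom C f)" "f \<cdot> h = Zero C A (Cod C f)"
  shows lift_mono_in_Hom: "lift_mono C k h \<in> Hom C A (Dom C k)"
    and Comp_lift_mono: "k \<cdot> lift_mono C k h = h"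
proof -
  have "\<exists>!u. u \<in> Hom C A (Dom C k) \<and> k \<cdot> u = h"
    using assms Hom_Ob[of h] by (auto simp: is_kernel_def)
  moreover have "Dom C h = A" using assms(2) by (simp add: Hom_def)
  ultimately show "lift_mono C k h \<in> Hom C A (Dom C k)" "k \<cdot> lift_mono C k h = h"
    unfolding lift_mono_def using theI'[of "\<lambda>u. u \<in> Hom C A (Dom C k) \<and> k \<cdot> u = h"] by auto
qed

text \<open>Kernels are monic. \<open>is_kernel\<close> grants uniqueness only for factorizations of
  arrows killed by \<open>f\<close>, and \<open>k \<cdot> u\<close> is such an arrow because
  \<open>f \<cdot> k\<close> is zero.\<close>

lemma kernel_cancel:
  assumes "is_kernel C f k" "u \<in> Hom C A (Dom C k)" "v \<in> Hom C A (Dom C k)" "k \<cdot> u = k \<cdot> v"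
  shows "u = v"
proof -
  note k = is_kernelD[OF assms(1)]
  have "f \<cdot> (k \<cdot> u) = Zero C (Dom C k) (Cod C f) \<cdot> u"
    using k assms(2) by (metis Comp_assoc Arr_in_Hom)
  hence "f \<cdot> (k \<cdot> u) = Zero C A (Cod C f)"
    using Zero_Comp[OF assms(2)] k(1) Cod_in_Ob by auto
  moreover have "k \<cdot> u \<in> Hom C A (Dom C f)" using k(2) assms(2) Comp_in_Hom by blast
  ultimately have "\<exists>!w. w \<in> Hom C A (Dom C k) \<and> k \<cdot> w = k \<cdot> u"
    using assms(1) Hom_Ob[OF assms(2)] by (auto simp: is_kernel_def)
  thus ?thesis using assms by metis
qed

lemma descend_epi_cokernel:
  assumes "is_cokernel C f q" "h \<in> Hom C (Cod C f) A" "h \<cdot> f = Zero C (Dom C f) A"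
  shows descend_epi_in_Hom: "descend_epi C q h \<in> Hom C (Cod C q) A"
    and descend_epi_Comp: "descend_epi C q h \<cdot> q = h"
proof -
  have "\<exists>!u. u \<in> Hom C (Cod C q) A \<and> u \<cdot> q = h"
    using assms Hom_Ob[of h] by (auto simp: is_cokernel_def)
  moreover have "Cod C h = A" using assms(2) by (simp add: Hom_def)
  ultimately show "descend_epi C q h \<in> Hom C (Cod C q) A" "descend_epi C q h \<cdot> q = h"
    unfolding descend_epi_def using theI'[of "\<lambda>u. u \<in> Hom C (Cod C q) A \<and> u \<cdot> q = h"] by auto
qed

lemma cokernel_cancel:
  assumes "is_cokernel C f q" "u \<in> Hom C (Cod C q) A" "v \<in> Hom C (Cod C q) A" "u \<cdot> q = v \<cdot> q"
  shows "u = v"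
proof -
  note q = is_cokernelD[OF assms(1)]
  have "(u \<cdot> q) \<cdot> f = u \<cdot> Zero C (Dom C f) (Cod C q)"
    using q assms(2) by (metis Comp_assoc Arr_in_Hom)
  hence "(u \<cdot> q) \<cdot> f = Zero C (Dom C f) A"
    using Comp_Zero[OF assms(2)] q(1) Dom_in_Ob by auto
  moreover have "u \<cdot> q \<in> Hom C (Cod C f) A" using q(2) assms(2) Comp_in_Hom by blast
  ultimately have "\<exists>!w. w \<in> Hom C (Cod C q) A \<and> w \<cdot> q = u \<cdot> q"
    using assms(1) Hom_Ob[OF assms(2)] by (auto simp: is_cokernel_def)
  thus ?thesis using assms by metis
qed

end

context abelian_category
begin

lemma is_kernel_ker: "f \<in> Arr C \<Longrightarrow> is_kernel C f (ker C f)"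
  unfolding ker_def by (rule someI_ex) (rule kernel_exists)

lemma is_cokernel_coker: "f \<in> Arr C \<Longrightarrow> is_cokernel C f (coker C f)"
  unfolding coker_def by (rule someI_ex) (rule cokernel_exists)

lemma is_zero_object_zero_object: "is_zero_object C (zero_object C)"
  unfolding zero_object_def by (rule someI_ex) (rule zero_object_exists)

lemma zero_object_in_Ob: "zero_object C \<in> Ob C"
  using is_zero_object_zero_object by (simp add: is_zero_object_def)

end

section \<open>Functoriality of homology\<close>

text \<open>The record \<open>chain_complex\<close> holds data without axioms; these are the axioms.
  The arrow out of degree 0 is not among the data, it is supplied by
  \<open>bdry_from\<close>.\<close>

definition is_complex :: "('o, 'a, 'z) preadditive_data_scheme \<Rightarrow> ('o, 'a) chain_complex \<Rightarrow> bool" where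
  "is_complex C K \<longleftrightarrow>
     (\<forall>n. bdry K n \<in> Hom C (chain_ob K (Suc n)) (chain_ob K n)) \<and>
     (\<forall>n. bdry K n \<cdot>\<^bsub>C\<^esub> bdry K (Suc n) = Zero C (chain_ob K (Suc (Suc n))) (chain_ob K n))"

definition is_chain_map ::
  "('o, 'a, 'z) preadditive_data_scheme \<Rightarrow> ('o, 'a) chain_complex \<Rightarrow> ('o, 'a) chain_complex
    \<Rightarrow> (nat \<Rightarrow> 'a) \<Rightarrow> bool" where
  "is_chain_map C K L \<phi> \<longleftrightarrow>
     (\<forall>n. \<phi> n \<in> Hom C (chain_ob K n) (chain_ob L n)) \<and>
     (\<forall>n. \<phi> n \<cdot>\<^bsub>C\<^esub> bdry K n = bdry L n \<cdot>\<^bsub>C\<^esub> \<phi> (Suc n))"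

context abelian_category
begin

lemma is_complexD:
  assumes "is_complex C K"
  shows "bdry K n \<in> Hom C (chain_ob K (Suc n)) (chain_ob K n)"
    and "bdry K n \<cdot> bdry K (Suc n) = Zero C (chain_ob K (Suc (Suc n))) (chain_ob K n)"
  using assms by (simp_all add: is_complex_def)

lemma is_chain_mapD:
  assumes "is_chain_map C K L \<phi>"
  shows "\<phi> n \<in> Hom C (chain_ob K n) (chain_ob L n)"
    and "\<phi> n \<cdot> bdry K n = bdry L n \<cdot> \<phi> (Suc n)"
  using assms by (simp_all add: is_chain_map_def)

lemma is_chain_map_Comp:
  assumes "is_chain_map C K L \<phi>" "is_chain_map C L M \<psi>"
    and "is_complex C K" "is_complex C L" "is_complex C M"
  shows "is_chain_map C K M (\<lambda>n. \<psi> n \<cdot> \<phi> n)"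
  unfolding is_chain_map_def
proof (intro conjI allI)
  fix n
  note \<phi> = is_chain_mapD[OF assms(1)] and \<psi> = is_chain_mapD[OF assms(2)]
  note d = is_complexD(1)[OF assms(3)] is_complexD(1)[OF assms(4)] is_complexD(1)[OF assms(5)]
  show "\<psi> n \<cdot> \<phi> n \<in> Hom C (chain_ob K n) (chain_ob M n)"
    using Comp_in_Hom[OF \<phi>(1) \<psi>(1)] .
  have "(\<psi> n \<cdot> \<phi> n) \<cdot> bdry K n = (\<psi> n \<cdot> bdry L n) \<cdot> \<phi> (Suc n)"
    using Comp_assoc[OF d(1) \<phi>(1) \<psi>(1)] Comp_assoc[OF \<phi>(1) d(2) \<psi>(1)] \<phi>(2) by simp
  thus "(\<psi> n \<cdot> \<phi> n) \<cdot> bdry K n = bdry M n \<cdot> (\<psi> (Suc n) \<cdot> \<phi> (Suc n))"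
    using Comp_assoc[OF \<phi>(1) \<psi>(1) d(3)] \<psi>(2) by simp
qed

lemma is_chain_map_Ide:
  assumes "is_complex C K"
  shows "is_chain_map C K K (\<lambda>n. Ide C (chain_ob K n))"
proof -
  have K: "bdry K n \<in> Hom C (chain_ob K (Suc n)) (chain_ob K n)" for n
    using assms by (simp add: is_complex_def)
  show ?thesis
    using Ide_in_Hom Hom_Ob[OF K] Ide_Comp[OF K] Comp_Ide[OF K] by (simp add: is_chain_map_def)
qed

text \<open>The target of \<open>bdry_from C K n\<close> is the zero object in degree 0 and
  \<open>chain_ob K m\<close> in degree \<open>Suc m\<close>. Writing it as \<open>Cod\<close> gives
  one statement for both cases.\<close>

lemma bdry_from_complex:
  assumes "is_complex C K"
  shows bdry_from_in_Hom: "bdry_from C K n \<in> Hom C (chain_ob K n) (Cod C (bdry_from C K n))"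
    and bdry_from_bdry:
      "bdry_from C K n \<cdot> bdry K n = Zero C (chain_ob K (Suc n)) (Cod C (bdry_from C K n))"
proof -
  have K: "bdry K m \<in> Hom C (chain_ob K (Suc m)) (chain_ob K m)" for m
    using assms by (simp add: is_complex_def)
  have Z: "Zero C (chain_ob K 0) (zero_object C) \<in> Hom C (chain_ob K 0) (zero_object C)"
    using Zero_in_Hom zero_object_in_Ob Hom_Ob[OF K] by blast
  have *: "bdry_from C K n \<in> Hom C (chain_ob K n) (Cod C (bdry_from C K n)) \<and>
    bdry_from C K n \<cdot> bdry K n = Zero C (chain_ob K (Suc n)) (Cod C (bdry_from C K n))"
  proof (cases n)
    case 0
    thus ?thesis
      using Z Zero_Comp[OF K[of 0] zero_object_in_Ob] by (simp add: bdry_from_def Hom_def)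
  next
    case (Suc m)
    thus ?thesis using assms K[of m] by (simp add: bdry_from_def Hom_def is_complex_def)
  qed
  show "bdry_from C K n \<in> Hom C (chain_ob K n) (Cod C (bdry_from C K n))" using * by blast
  show "bdry_from C K n \<cdot> bdry K n = Zero C (chain_ob K (Suc n)) (Cod C (bdry_from C K n))"
    using * by blast
qed

text \<open>A chain map has no component on the zero object that serves as target in degree 0, so
  that degree is treated apart: there every arrow is a cycle. In higher degrees the square with
  \<open>bdry\<close> carries the zero across.\<close>

lemma bdry_from_chain_map:
  assumes "is_complex C K" "is_complex C L" "is_chain_map C K L \<phi>"
    and "h \<in> Hom C A (chain_ob K n)" "bdry_from C K n \<cdot> h = Zero C A (Cod C (bdry_from C K n))"
  shows "bdry_from C L n \<cdot> (\<phi> n \<cdot> h) = Zero C A (Cod C (bdry_from C L n))"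
proof (cases n)
  case 0
  have \<phi>: "\<phi> 0 \<cdot> h \<in> Hom C A (chain_ob L 0)"
    using assms(3,4) 0 Comp_in_Hom by (auto simp: is_chain_map_def)
  show ?thesis
    using 0 Zero_Comp[OF \<phi> zero_object_in_Ob] Zero_in_Hom[of "chain_ob L 0" "zero_object C"]
      zero_object_in_Ob Hom_Ob[OF \<phi>] by (simp add: bdry_from_def Hom_def)
next
  case (Suc m)
  note K = is_complexD(1)[OF assms(1)] and L = is_complexD(1)[OF assms(2)]
  note \<phi> = is_chain_mapD[OF assms(3)]
  have h: "h \<in> Hom C A (chain_ob K (Suc m))" using assms(4) Suc by simp
  have "bdry L m \<cdot> (\<phi> (Suc m) \<cdot> h) = (\<phi> m \<cdot> bdry K m) \<cdot> h"
    using Comp_assoc[OF h \<phi>(1) L] \<phi>(2) by simp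
  also have "\<dots> = \<phi> m \<cdot> (bdry K m \<cdot> h)"
    using Comp_assoc[OF h K \<phi>(1)] by simp
  also have "bdry K m \<cdot> h = Zero C A (chain_ob K m)"
    using assms(5) Suc HomD[OF K] by (simp add: bdry_from_def)
  also have "\<phi> m \<cdot> \<dots> = Zero C A (chain_ob L m)"
    using Comp_Zero[OF \<phi>(1)] Hom_Ob[OF h] by simp
  finally show ?thesis using Suc HomD[OF L] by (simp add: bdry_from_def)
qed

section \<open>Cycles, boundaries and the homology projection\<close>

lemma is_kernel_cycles:
  "is_complex C K \<Longrightarrow> is_kernel C (bdry_from C K n) (cycles C K n)"
  unfolding cycles_def
  using HomD[OF bdry_from_in_Hom, of K n] by (intro is_kernel_ker) blast

lemma cycles_in_Hom:
  "is_complex C K \<Longrightarrow> cycles C K n \<in> Hom C (Dom C (cycles C K n)) (chain_ob K n)"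
  using is_kernelD(2)[OF is_kernel_cycles, of K n] HomD[OF bdry_from_in_Hom, of K n] by simp

text \<open>That consecutive differentials compose to zero is exactly the condition under which a
  boundary factors through the kernel of the next differential.\<close>

lemma boundary_lift:
  assumes "is_complex C K"
  shows boundary_lift_in_Hom:
      "lift_mono C (cycles C K n) (bdry K n) \<in> Hom C (chain_ob K (Suc n)) (Dom C (cycles C K n))"
    and cycles_Comp_boundary_lift:
      "cycles C K n \<cdot> lift_mono C (cycles C K n) (bdry K n) = bdry K n"
  using lift_mono_kernel[OF is_kernel_cycles[OF assms] _ bdry_from_bdry[OF assms, of n]]
    HomD[OF bdry_from_in_Hom[OF assms, of n]] assms
  by (auto simp: is_complex_def)

lemma is_cokernel_homology_proj:
  "is_complex C K \<Longrightarrow>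
    is_cokernel C (lift_mono C (cycles C K n) (bdry K n)) (homology_proj C K n)"
  unfolding homology_proj_def
  using HomD[OF boundary_lift_in_Hom, of K n] by (intro is_cokernel_coker) blast

lemma homology_proj_in_Hom:
  "is_complex C K \<Longrightarrow> homology_proj C K n \<in> Hom C (Dom C (cycles C K n)) (homology C K n)"
  using is_cokernelD(2)[OF is_cokernel_homology_proj, of K n]
    HomD[OF boundary_lift_in_Hom, of K n] by (simp add: homology_def)

section \<open>Maps induced on cycles and on homology\<close>

lemma cycles_map:
  assumes "is_complex C K" "is_complex C L" "is_chain_map C K L \<phi>"
  shows cycles_map_in_Hom: "lift_mono C (cycles C L n) (\<phi> n \<cdot> cycles C K n)
      \<in> Hom C (Dom C (cycles C K n)) (Dom C (cycles C L n))"
    and cycles_Comp_cycles_map: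
      "cycles C L n \<cdot> lift_mono C (cycles C L n) (\<phi> n \<cdot> cycles C K n) = \<phi> n \<cdot> cycles C K n"
proof -
  have c: "cycles C K n \<in> Hom C (Dom C (cycles C K n)) (chain_ob K n)"
    using assms(1) by (rule cycles_in_Hom)
  have "\<phi> n \<cdot> cycles C K n \<in> Hom C (Dom C (cycles C K n)) (chain_ob L n)"
    using c assms(3) Comp_in_Hom by (auto simp: is_chain_map_def)
  moreover have "bdry_from C L n \<cdot> (\<phi> n \<cdot> cycles C K n)
      = Zero C (Dom C (cycles C K n)) (Cod C (bdry_from C L n))"
    using bdry_from_chain_map[OF assms c] is_kernelD(3)[OF is_kernel_cycles[OF assms(1)]] by blast
  ultimately show "lift_mono C (cycles C L n) (\<phi> n \<cdot> cycles C K n)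
      \<in> Hom C (Dom C (cycles C K n)) (Dom C (cycles C L n))"
    "cycles C L n \<cdot> lift_mono C (cycles C L n) (\<phi> n \<cdot> cycles C K n) = \<phi> n \<cdot> cycles C K n"
    using lift_mono_kernel[OF is_kernel_cycles[OF assms(2)]]
      HomD[OF bdry_from_in_Hom[OF assms(2), of n]] by auto
qed

text \<open>The inclusion of the cycles of \<open>L\<close> is monic, and composed with it both
  sides become the chain map equation for \<open>\<phi>\<close> in degree n.\<close>

lemma cycles_map_Comp_boundary_lift:
  assumes "is_complex C K" "is_complex C L" "is_chain_map C K L \<phi>"
  shows "lift_mono C (cycles C L n) (\<phi> n \<cdot> cycles C K n) \<cdot> lift_mono C (cycles C K n) (bdry K n)
    = lift_mono C (cycles C L n) (bdry L n) \<cdot> \<phi> (Suc n)" (is "?z \<cdot> ?bK = ?bL \<cdot> _")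
proof (rule kernel_cancel[OF is_kernel_cycles[OF assms(2)]])
  note z = cycles_map_in_Hom[OF assms, of n]
  note b = boundary_lift_in_Hom[OF assms(1), of n] boundary_lift_in_Hom[OF assms(2), of n]
  have \<phi>: "\<phi> m \<in> Hom C (chain_ob K m) (chain_ob L m)" for m
    using assms(3) by (simp add: is_chain_map_def)
  show "?z \<cdot> ?bK \<in> Hom C (chain_ob K (Suc n)) (Dom C (cycles C L n))"
    using z b Comp_in_Hom by blast
  show "?bL \<cdot> \<phi> (Suc n) \<in> Hom C (chain_ob K (Suc n)) (Dom C (cycles C L n))"
    using \<phi> b Comp_in_Hom by blast
  have "cycles C L n \<cdot> (?z \<cdot> ?bK) = (\<phi> n \<cdot> cycles C K n) \<cdot> ?bK"
    using Comp_assoc[OF b(1) z cycles_in_Hom[OF assms(2)]] cycles_Comp_cycles_map[OF assms] by simp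
  also have "\<dots> = \<phi> n \<cdot> bdry K n"
    using Comp_assoc[OF b(1) cycles_in_Hom[OF assms(1)] \<phi>] cycles_Comp_boundary_lift[OF assms(1)]
    by simp
  also have "\<dots> = bdry L n \<cdot> \<phi> (Suc n)"
    using assms(3) by (simp add: is_chain_map_def)
  also have "\<dots> = cycles C L n \<cdot> (?bL \<cdot> \<phi> (Suc n))"
    using Comp_assoc[OF \<phi> b(2) cycles_in_Hom[OF assms(2)]] cycles_Comp_boundary_lift[OF assms(2)]
    by simp
  finally show "cycles C L n \<cdot> (?z \<cdot> ?bK) = cycles C L n \<cdot> (?bL \<cdot> \<phi> (Suc n))" .
qed

text \<open>On boundaries the map of cycles equals the boundary map of \<open>L\<close> after
  \<open>\<phi> (Suc n)\<close>, which the projection of \<open>L\<close> kills; the composite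
  therefore factors through the cokernel that defines the homology of \<open>K\<close>.\<close>

lemma homology_map_descends:
  assumes "is_complex C K" "is_complex C L" "is_chain_map C K L \<phi>"
  shows homology_map_in_Hom: "homology_map C K L \<phi> n \<in> Hom C (homology C K n) (homology C L n)"
    and homology_map_Comp_proj: "homology_map C K L \<phi> n \<cdot> homology_proj C K n
      = homology_proj C L n \<cdot> lift_mono C (cycles C L n) (\<phi> n \<cdot> cycles C K n)"
proof -
  let ?z = "lift_mono C (cycles C L n) (\<phi> n \<cdot> cycles C K n)"
  let ?bK = "lift_mono C (cycles C K n) (bdry K n)"
  let ?bL = "lift_mono C (cycles C L n) (bdry L n)"
  note z = cycles_map_in_Hom[OF assms, of n]
  note b = boundary_lift_in_Hom[OF assms(1), of n] boundary_lift_in_Hom[OF assms(2), of n]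
  note p = homology_proj_in_Hom[OF assms(2), of n]
  have \<phi>: "\<phi> (Suc n) \<in> Hom C (chain_ob K (Suc n)) (chain_ob L (Suc n))"
    using assms(3) by (simp add: is_chain_map_def)
  have "(homology_proj C L n \<cdot> ?z) \<cdot> ?bK = homology_proj C L n \<cdot> (?bL \<cdot> \<phi> (Suc n))"
    using Comp_assoc[OF b(1) z p] cycles_map_Comp_boundary_lift[OF assms] by simp
  also have "\<dots> = Zero C (chain_ob L (Suc n)) (homology C L n) \<cdot> \<phi> (Suc n)"
    using Comp_assoc[OF \<phi> b(2) p] is_cokernelD(3)[OF is_cokernel_homology_proj[OF assms(2), of n]]
      HomD[OF b(2)] by (simp add: homology_def)
  also have "\<dots> = Zero C (Dom C ?bK) (homology C L n)"
    using Zero_Comp[OF \<phi>] Hom_Ob[OF p] HomD[OF b(1)] by simp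
  finally have eq: "(homology_proj C L n \<cdot> ?z) \<cdot> ?bK = Zero C (Dom C ?bK) (homology C L n)" .
  have "homology_proj C L n \<cdot> ?z \<in> Hom C (Cod C ?bK) (homology C L n)"
    using HomD[OF b(1)] Comp_in_Hom[OF z p] by simp
  from descend_epi_cokernel[OF is_cokernel_homology_proj[OF assms(1)] this eq]
  show "homology_map C K L \<phi> n \<in> Hom C (homology C K n) (homology C L n)"
    "homology_map C K L \<phi> n \<cdot> homology_proj C K n = homology_proj C L n \<cdot> ?z"
    by (auto simp: homology_map_def homology_def)
qed

text \<open>Two cancellations: the homology projection is epic, which reduces the claim to maps of
  cycles, and the inclusion of cycles is monic, which reduces it to associativity.\<close>

lemma homology_map_Comp:
  assumes "is_complex C K" "is_complex C L" "is_complex C M"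
    and "is_chain_map C K L \<phi>" "is_chain_map C L M \<psi>"
  shows "homology_map C L M \<psi> n \<cdot> homology_map C K L \<phi> n = homology_map C K M (\<lambda>n. \<psi> n \<cdot> \<phi> n) n"
proof (rule cokernel_cancel[OF is_cokernel_homology_proj[OF assms(1)]])
  let ?zKL = "lift_mono C (cycles C L n) (\<phi> n \<cdot> cycles C K n)"
  let ?zLM = "lift_mono C (cycles C M n) (\<psi> n \<cdot> cycles C L n)"
  let ?zKM = "lift_mono C (cycles C M n) ((\<psi> n \<cdot> \<phi> n) \<cdot> cycles C K n)"
  note c = is_chain_map_Comp[OF assms(4,5,1-3)]
  note H = homology_map_in_Hom[OF assms(1,2,4), of n] homology_map_in_Hom[OF assms(2,3,5), of n]
    homology_map_in_Hom[OF assms(1,3) c, of n]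
  note z = cycles_map_in_Hom[OF assms(1,2,4), of n] cycles_map_in_Hom[OF assms(2,3,5), of n]
    cycles_map_in_Hom[OF assms(1,3) c, of n]
  note y = cycles_in_Hom[OF assms(1), of n] cycles_in_Hom[OF assms(2), of n] cycles_in_Hom[OF assms(3), of n]
  note p = homology_proj_in_Hom[OF assms(1), of n] homology_proj_in_Hom[OF assms(2), of n]
    homology_proj_in_Hom[OF assms(3), of n]
  have f: "\<phi> n \<in> Hom C (chain_ob K n) (chain_ob L n)" "\<psi> n \<in> Hom C (chain_ob L n) (chain_ob M n)"
    using assms(4,5) by (simp_all add: is_chain_map_def)
  have zz: "?zLM \<cdot> ?zKL = ?zKM"
  proof (rule kernel_cancel[OF is_kernel_cycles[OF assms(3)] Comp_in_Hom[OF z(1,2)] z(3)])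
    have "cycles C M n \<cdot> (?zLM \<cdot> ?zKL) = \<psi> n \<cdot> (\<phi> n \<cdot> cycles C K n)"
      using Comp_assoc[OF z(1,2) y(3)] Comp_assoc[OF z(1) y(2) f(2)]
        cycles_Comp_cycles_map[OF assms(2,3,5)] cycles_Comp_cycles_map[OF assms(1,2,4)] by simp
    thus "cycles C M n \<cdot> (?zLM \<cdot> ?zKL) = cycles C M n \<cdot> ?zKM"
      using cycles_Comp_cycles_map[OF assms(1,3) c] Comp_assoc[OF y(1) f] by simp
  qed
  show "homology_map C L M \<psi> n \<cdot> homology_map C K L \<phi> n
      \<in> Hom C (Cod C (homology_proj C K n)) (homology C M n)"
    using Comp_in_Hom[OF H(1,2)] by (simp add: homology_def)
  show "homology_map C K M (\<lambda>n. \<psi> n \<cdot> \<phi> n) n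
      \<in> Hom C (Cod C (homology_proj C K n)) (homology C M n)"
    using H(3) by (simp add: homology_def)
  have "(homology_map C L M \<psi> n \<cdot> homology_map C K L \<phi> n) \<cdot> homology_proj C K n
      = homology_map C L M \<psi> n \<cdot> (homology_proj C L n \<cdot> ?zKL)"
    using Comp_assoc[OF p(1) H(1,2)] homology_map_Comp_proj[OF assms(1,2,4)] by simp
  also have "\<dots> = homology_proj C M n \<cdot> (?zLM \<cdot> ?zKL)"
    using Comp_assoc[OF z(1) p(2) H(2)] Comp_assoc[OF z(1,2) p(3)]
      homology_map_Comp_proj[OF assms(2,3,5)] by simp
  finally show "(homology_map C L M \<psi> n \<cdot> homology_map C K L \<phi> n) \<cdot> homology_proj C K n
      = homology_map C K M (\<lambda>n. \<psi> n \<cdot> \<phi> n) n \<cdot> homology_proj C K n"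
    using homology_map_Comp_proj[OF assms(1,3) c] zz by simp
qed

lemma homology_map_Ide:
  assumes "is_complex C K"
  shows "homology_map C K K (\<lambda>n. Ide C (chain_ob K n)) n = Ide C (homology C K n)"
proof (rule cokernel_cancel[OF is_cokernel_homology_proj[OF assms]])
  let ?\<phi> = "\<lambda>n. Ide C (chain_ob K n)"
  let ?z = "lift_mono C (cycles C K n) (Ide C (chain_ob K n) \<cdot> cycles C K n)"
  note i = is_chain_map_Ide[OF assms]
  note p = homology_proj_in_Hom[OF assms, of n]
  note y = cycles_in_Hom[OF assms, of n]
  show "homology_map C K K ?\<phi> n \<in> Hom C (Cod C (homology_proj C K n)) (homology C K n)"
    using homology_map_in_Hom[OF assms assms i, of n] by (simp add: homology_def)
  show "Ide C (homology C K n) \<in> Hom C (Cod C (homology_proj C K n)) (homology C K n)"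
    using Ide_in_Hom Hom_Ob[OF p] by (simp add: homology_def)
  have z: "?z = Ide C (Dom C (cycles C K n))"
  proof (rule kernel_cancel[OF is_kernel_cycles[OF assms] cycles_map_in_Hom[OF assms assms i, of n]])
    show "Ide C (Dom C (cycles C K n)) \<in> Hom C (Dom C (cycles C K n)) (Dom C (cycles C K n))"
      using Ide_in_Hom Hom_Ob[OF y] by simp
    show "cycles C K n \<cdot> ?z = cycles C K n \<cdot> Ide C (Dom C (cycles C K n))"
      using cycles_Comp_cycles_map[OF assms assms i, of n] Ide_Comp[OF y] Comp_Ide[OF y] by simp
  qed
  show "homology_map C K K ?\<phi> n \<cdot> homology_proj C K n = Ide C (homology C K n) \<cdot> homology_proj C K n"
    using homology_map_Comp_proj[OF assms assms i, of n] z Ide_Comp[OF p] Comp_Ide[OF p] by simp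
qed

text \<open>The identities are demanded in all degrees because \<open>homology_map_Comp\<close>
  produces the family of composites under a binder, where it is rewritten to the family of
  identities.\<close>

lemma is_iso_homology_map:
  assumes "is_complex C K" "is_complex C L" "is_chain_map C K L \<phi>" "is_chain_map C L K \<psi>"
    and "\<And>n. \<psi> n \<cdot> \<phi> n = Ide C (chain_ob K n)" "\<And>n. \<phi> n \<cdot> \<psi> n = Ide C (chain_ob L n)"
  shows "is_iso C (homology_map C K L \<phi> n)"
proof (rule is_isoI)
  show "homology_map C K L \<phi> n \<in> Hom C (homology C K n) (homology C L n)"
    "homology_map C L K \<psi> n \<in> Hom C (homology C L n) (homology C K n)"
    using homology_map_in_Hom assms by auto
  show "homology_map C L K \<psi> n \<cdot> homology_map C K L \<phi> n = Ide C (homology C K n)"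
    "homology_map C K L \<phi> n \<cdot> homology_map C L K \<psi> n = Ide C (homology C L n)"
    using homology_map_Comp[OF assms(1,2,1,3,4)] homology_map_Comp[OF assms(2,1,2,4,3)]
      homology_map_Ide assms by simp_all
qed

end

section \<open>Coproducts\<close>

abbreviation has_coproduct ::
  "('o, 'a, 'z) category_data_scheme \<Rightarrow> 'i set \<Rightarrow> ('i \<Rightarrow> 'o) \<Rightarrow> bool" where
  "has_coproduct C I B \<equiv> \<exists>c \<iota>. is_coproduct C I B c \<iota>"

text \<open>With \<open>r\<close> the identity this is \<open>coprod_map\<close>; with
  \<open>r\<close> the action of a cube arrow it is the induced map on chains or, on fibres, the
  arrow of the direct image; with \<open>r\<close> the map of cells it is the comparison.\<close>

definition reindex_map ::
  "('o, 'a, 'z) category_data_scheme \<Rightarrow> 'i set \<Rightarrow> ('i \<Rightarrow> 'o) \<Rightarrow> 'j set \<Rightarrow> ('j \<Rightarrow> 'o)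
    \<Rightarrow> ('i \<Rightarrow> 'j) \<Rightarrow> ('i \<Rightarrow> 'a) \<Rightarrow> 'a" where
  "reindex_map C I B J D r g =
     copair C I B (coprod_ob C J D) (\<lambda>i. coprod_in C J D (r i) \<cdot>\<^bsub>C\<^esub> g i)"

context category
begin

lemma is_coproduct_coprod:
  assumes "has_coproduct C I B"
  shows "is_coproduct C I B (coprod_ob C I B) (coprod_in C I B)"
proof -
  from assms obtain c \<iota> where "is_coproduct C I B (fst (c, \<iota>)) (snd (c, \<iota>))" by auto
  thus ?thesis
    unfolding coprod_def by (rule someI[of "\<lambda>p. is_coproduct C I B (fst p) (snd p)"])
qed

lemma coprod_ob_in_Ob: "has_coproduct C I B \<Longrightarrow> coprod_ob C I B \<in> Ob C"
  using is_coproduct_coprod[of I B] unfolding is_coproduct_def by blast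

lemma coprod_in_in_Hom:
  "\<lbrakk>has_coproduct C I B; i \<in> I\<rbrakk> \<Longrightarrow> coprod_in C I B i \<in> Hom C (B i) (coprod_ob C I B)"
  using is_coproduct_coprod[of I B] unfolding is_coproduct_def by auto

lemma copair_coprod:
  assumes "has_coproduct C I B" "D \<in> Ob C" "\<And>i. i \<in> I \<Longrightarrow> g i \<in> Hom C (B i) D"
  shows copair_in_Hom: "copair C I B D g \<in> Hom C (coprod_ob C I B) D"
    and copair_Comp_coprod_in: "\<And>i. i \<in> I \<Longrightarrow> copair C I B D g \<cdot> coprod_in C I B i = g i"
proof -
  have "\<exists>!h. h \<in> Hom C (coprod_ob C I B) D \<and> (\<forall>i\<in>I. h \<cdot> coprod_in C I B i = g i)"
    using is_coproduct_coprod[OF assms(1)] assms(2,3) by (auto simp: is_coproduct_def)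
  from theI'[OF this] show "copair C I B D g \<in> Hom C (coprod_ob C I B) D"
    "\<And>i. i \<in> I \<Longrightarrow> copair C I B D g \<cdot> coprod_in C I B i = g i"
    unfolding copair_def by auto
qed

text \<open>The injections are jointly epic, by the uniqueness half of the universal property for
  the family \<open>u \<cdot> coprod_in C I B i\<close>.\<close>

lemma coprod_cancel:
  assumes "has_coproduct C I B" "u \<in> Hom C (coprod_ob C I B) D" "v \<in> Hom C (coprod_ob C I B) D"
    and "\<And>i. i \<in> I \<Longrightarrow> u \<cdot> coprod_in C I B i = v \<cdot> coprod_in C I B i"
  shows "u = v"
proof -
  have "u \<cdot> coprod_in C I B i \<in> Hom C (B i) D" if "i \<in> I" for i
    using Comp_in_Hom[OF coprod_in_in_Hom[OF assms(1) that] assms(2)] .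
  hence "\<exists>!h. h \<in> Hom C (coprod_ob C I B) D \<and>
      (\<forall>i\<in>I. h \<cdot> coprod_in C I B i = u \<cdot> coprod_in C I B i)"
    using is_coproduct_coprod[OF assms(1)] Hom_Ob[OF assms(2)] unfolding is_coproduct_def by auto
  thus ?thesis using assms(2-4) by metis
qed

lemma reindex_map_in:
  assumes "has_coproduct C I B" "has_coproduct C J D"
    and "\<And>i. i \<in> I \<Longrightarrow> r i \<in> J" "\<And>i. i \<in> I \<Longrightarrow> g i \<in> Hom C (B i) (D (r i))"
  shows reindex_map_in_Hom: "reindex_map C I B J D r g \<in> Hom C (coprod_ob C I B) (coprod_ob C J D)"
    and reindex_map_Comp_in: "\<And>i. i \<in> I \<Longrightarrow>
      reindex_map C I B J D r g \<cdot> coprod_in C I B i = coprod_in C J D (r i) \<cdot> g i"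
proof -
  have "coprod_in C J D (r i) \<cdot> g i \<in> Hom C (B i) (coprod_ob C J D)" if "i \<in> I" for i
    using Comp_in_Hom[OF assms(4)[OF that] coprod_in_in_Hom[OF assms(2) assms(3)[OF that]]] .
  from copair_coprod[OF assms(1) coprod_ob_in_Ob[OF assms(2)] this]
  show "reindex_map C I B J D r g \<in> Hom C (coprod_ob C I B) (coprod_ob C J D)"
    "\<And>i. i \<in> I \<Longrightarrow> reindex_map C I B J D r g \<cdot> coprod_in C I B i = coprod_in C J D (r i) \<cdot> g i"
    unfolding reindex_map_def by auto
qed

text \<open>The composite data \<open>t\<close> and \<open>k\<close> are separate variables, tied to
  the factors by equations on \<open>I\<close> only. Functoriality or naturality of the coefficients
  can so enter as a pointwise equation, and two different composites can be brought to one common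
  right-hand side.\<close>

lemma reindex_map_Comp:
  assumes "has_coproduct C I B" "has_coproduct C J D" "has_coproduct C K E"
    and "\<And>i. i \<in> I \<Longrightarrow> r i \<in> J" "\<And>i. i \<in> I \<Longrightarrow> g i \<in> Hom C (B i) (D (r i))"
    and "\<And>j. j \<in> J \<Longrightarrow> s j \<in> K" "\<And>j. j \<in> J \<Longrightarrow> h j \<in> Hom C (D j) (E (s j))"
    and "\<And>i. i \<in> I \<Longrightarrow> t i = s (r i)" "\<And>i. i \<in> I \<Longrightarrow> k i = h (r i) \<cdot> g i"
  shows "reindex_map C J D K E s h \<cdot> reindex_map C I B J D r g = reindex_map C I B K E t k"
proof (rule coprod_cancel[OF assms(1)])
  have R: "reindex_map C I B J D r g \<in> Hom C (coprod_ob C I B) (coprod_ob C J D)"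
      "reindex_map C I B J D r g \<cdot> coprod_in C I B i = coprod_in C J D (r i) \<cdot> g i"
      "reindex_map C J D K E s h \<in> Hom C (coprod_ob C J D) (coprod_ob C K E)"
      "reindex_map C J D K E s h \<cdot> coprod_in C J D (r i) = coprod_in C K E (s (r i)) \<cdot> h (r i)"
      if "i \<in> I" for i
    using that assms by (simp_all add: reindex_map_in)
  have R': "reindex_map C I B J D r g \<in> Hom C (coprod_ob C I B) (coprod_ob C J D)"
      "reindex_map C J D K E s h \<in> Hom C (coprod_ob C J D) (coprod_ob C K E)"
    using assms by (simp_all add: reindex_map_in)
  have k: "k i \<in> Hom C (B i) (E (t i))" "t i \<in> K" if "i \<in> I" for i
    using Comp_in_Hom[OF assms(5)[OF that] assms(7)[OF assms(4)[OF that]]] assms(4,6,8,9) that by auto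
  have T: "reindex_map C I B K E t k \<in> Hom C (coprod_ob C I B) (coprod_ob C K E)"
    by (rule reindex_map_in_Hom) (use assms(1,3) k in auto)
  show "reindex_map C J D K E s h \<cdot> reindex_map C I B J D r g
      \<in> Hom C (coprod_ob C I B) (coprod_ob C K E)"
    using Comp_in_Hom[OF R'] .
  show "reindex_map C I B K E t k \<in> Hom C (coprod_ob C I B) (coprod_ob C K E)"
    using T by blast
  fix i assume i: "i \<in> I"
  note c = coprod_in_in_Hom[OF assms(1) i] coprod_in_in_Hom[OF assms(2) assms(4)[OF i]]
    coprod_in_in_Hom[OF assms(3) assms(6)[OF assms(4)[OF i]]]
  have "(reindex_map C J D K E s h \<cdot> reindex_map C I B J D r g) \<cdot> coprod_in C I B i
      = reindex_map C J D K E s h \<cdot> (coprod_in C J D (r i) \<cdot> g i)"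
    using Comp_assoc[OF c(1) R'] R(2)[OF i] by simp
  also have "\<dots> = (coprod_in C K E (s (r i)) \<cdot> h (r i)) \<cdot> g i"
    using Comp_assoc[OF assms(5)[OF i] c(2) R'(2)] R(4)[OF i] by simp
  also have "\<dots> = coprod_in C K E (t i) \<cdot> k i"
    using Comp_assoc[OF assms(5)[OF i] assms(7)[OF assms(4)[OF i]] c(3)] assms(4,8,9)[OF i] by simp
  also have "\<dots> = reindex_map C I B K E t k \<cdot> coprod_in C I B i"
    by (rule reindex_map_Comp_in[symmetric]) (use assms(1,3) k i in auto)
  finally show "(reindex_map C J D K E s h \<cdot> reindex_map C I B J D r g) \<cdot> coprod_in C I B i
      = reindex_map C I B K E t k \<cdot> coprod_in C I B i" .
qed

lemma reindex_map_Ide: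
  assumes "has_coproduct C I B" "\<And>i. i \<in> I \<Longrightarrow> r i = i" "\<And>i. i \<in> I \<Longrightarrow> g i = Ide C (B i)"
  shows "reindex_map C I B I B r g = Ide C (coprod_ob C I B)"
proof (rule coprod_cancel[OF assms(1)])
  note c = coprod_in_in_Hom[OF assms(1)]
  have g: "g i \<in> Hom C (B i) (B (r i))" "r i \<in> I" if "i \<in> I" for i
    using assms(2,3) that c[OF that] Ide_in_Hom Hom_Ob by auto
  show "reindex_map C I B I B r g \<in> Hom C (coprod_ob C I B) (coprod_ob C I B)"
    by (rule reindex_map_in_Hom) (use assms(1) g in auto)
  show "Ide C (coprod_ob C I B) \<in> Hom C (coprod_ob C I B) (coprod_ob C I B)"
    using coprod_ob_in_Ob[OF assms(1)] Ide_in_Hom by blast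
  fix i assume i: "i \<in> I"
  have "reindex_map C I B I B r g \<cdot> coprod_in C I B i = coprod_in C I B (r i) \<cdot> g i"
    by (rule reindex_map_Comp_in) (use assms(1) g i in auto)
  thus "reindex_map C I B I B r g \<cdot> coprod_in C I B i = Ide C (coprod_ob C I B) \<cdot> coprod_in C I B i"
    using assms(2,3)[OF i] Comp_Ide[OF c[OF i]] Ide_Comp[OF c[OF i]] by simp
qed

lemma coprod_map_eq_reindex_map:
  "coprod_map C I B D g = reindex_map C I B I D (\<lambda>i. i) g"
  by (simp add: coprod_map_def reindex_map_def)

end

section \<open>Finite coproducts from biproducts\<close>

context preadditive_category
begin

lemma is_coproduct_insert:
  assumes "is_coproduct C I B c \<iota>" "j \<notin> I" "is_biproduct C (B j) c P i\<^sub>1 i\<^sub>2 p\<^sub>1 p\<^sub>2"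
  shows "is_coproduct C (insert j I) B P (\<lambda>i. if i = j then i\<^sub>1 else i\<^sub>2 \<cdot> \<iota> i)"
proof -
  note P = assms(3)[unfolded is_biproduct_def]
  have i1: "i\<^sub>1 \<in> Hom C (B j) P" and i2: "i\<^sub>2 \<in> Hom C c P"
    and p1: "p\<^sub>1 \<in> Hom C P (B j)" and p2: "p\<^sub>2 \<in> Hom C P c" using P by auto
  have \<iota>: "\<iota> i \<in> Hom C (B i) c" if "i \<in> I" for i
    using assms(1) that by (simp add: is_coproduct_def)
  have ex: "\<exists>!h. h \<in> Hom C P D \<and> (\<forall>i\<in>insert j I. h \<cdot> (if i = j then i\<^sub>1 else i\<^sub>2 \<cdot> \<iota> i) = g i)"
    if D: "D \<in> Ob C" and g: "\<forall>i\<in>insert j I. g i \<in> Hom C (B i) D" for D g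
  proof -
    have gj: "g j \<in> Hom C (B j) D" using g by blast
    have ex1: "\<exists>!h. h \<in> Hom C c D \<and> (\<forall>i\<in>I. h \<cdot> \<iota> i = g i)"
      using assms(1) D g by (auto simp: is_coproduct_def)
    then obtain v where v: "v \<in> Hom C c D" "\<And>i. i \<in> I \<Longrightarrow> v \<cdot> \<iota> i = g i" by blast
    \<comment> \<open>The only candidate: each projection followed by the arrow prescribed on its
      summand, the old summands being already united in \<open>v\<close>.\<close>
    let ?h = "Add C (g j \<cdot> p\<^sub>1) (v \<cdot> p\<^sub>2)"
    have gp: "g j \<cdot> p\<^sub>1 \<in> Hom C P D" and vp: "v \<cdot> p\<^sub>2 \<in> Hom C P D"
      using Comp_in_Hom[OF p1 gj] Comp_in_Hom[OF p2 v(1)] .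
    have h: "?h \<in> Hom C P D" using Add_in_Hom[OF gp vp] .
    have "?h \<cdot> i\<^sub>1 = Add C (g j \<cdot> (p\<^sub>1 \<cdot> i\<^sub>1)) (v \<cdot> (p\<^sub>2 \<cdot> i\<^sub>1))"
      using Add_Comp[OF i1 gp vp] Comp_assoc[OF i1 p1 gj] Comp_assoc[OF i1 p2 v(1)] by simp
    also have "\<dots> = g j"
      using P Comp_Ide[OF gj] Comp_Zero[OF v(1)] Add_Zero[OF gj] Hom_Ob[OF gj] by simp
    finally have h1: "?h \<cdot> i\<^sub>1 = g j" .
    have "?h \<cdot> i\<^sub>2 = Add C (g j \<cdot> (p\<^sub>1 \<cdot> i\<^sub>2)) (v \<cdot> (p\<^sub>2 \<cdot> i\<^sub>2))"
      using Add_Comp[OF i2 gp vp] Comp_assoc[OF i2 p1 gj] Comp_assoc[OF i2 p2 v(1)] by simp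
    also have "\<dots> = v"
      using P Comp_Ide[OF v(1)] Comp_Zero[OF gj] Zero_Add[OF v(1)] Hom_Ob[OF v(1)] by simp
    finally have h2: "?h \<cdot> i\<^sub>2 = v" .
    have "?h \<cdot> (if i = j then i\<^sub>1 else i\<^sub>2 \<cdot> \<iota> i) = g i" if "i \<in> insert j I" for i
      using h1 h2 v(2) that Comp_assoc[OF \<iota> i2 h] by auto
    moreover have "h' = ?h"
      if h': "h' \<in> Hom C P D" "\<forall>i\<in>insert j I. h' \<cdot> (if i = j then i\<^sub>1 else i\<^sub>2 \<cdot> \<iota> i) = g i" for h'
    proof -
      have "(h' \<cdot> i\<^sub>2) \<cdot> \<iota> i = g i" if "i \<in> I" for i
        using bspec[OF h'(2), of i] that assms(2) Comp_assoc[OF \<iota>[OF that] i2 h'(1)]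
        by (auto split: if_splits)
      hence h2': "h' \<cdot> i\<^sub>2 = v" using ex1 v Comp_in_Hom[OF i2 h'(1)] by blast
      have h1': "h' \<cdot> i\<^sub>1 = g j" using h'(2) by auto
      \<comment> \<open>Uniqueness rests on the decomposition of the identity of \<open>P\<close>:
        an arrow out of \<open>P\<close> is determined by its composites with
        \<open>i\<^sub>1\<close> and \<open>i\<^sub>2\<close>.\<close>
      have "h' = h' \<cdot> Add C (i\<^sub>1 \<cdot> p\<^sub>1) (i\<^sub>2 \<cdot> p\<^sub>2)" using P Comp_Ide[OF h'(1)] by simp
      also have "\<dots> = Add C ((h' \<cdot> i\<^sub>1) \<cdot> p\<^sub>1) ((h' \<cdot> i\<^sub>2) \<cdot> p\<^sub>2)"
        using Comp_Add[OF Comp_in_Hom[OF p1 i1] Comp_in_Hom[OF p2 i2] h'(1)]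
          Comp_assoc[OF p1 i1 h'(1)] Comp_assoc[OF p2 i2 h'(1)] by simp
      finally show ?thesis using h1' h2' by simp
    qed
    ultimately show ?thesis using h by blast
  qed
  have "P \<in> Ob C" using Hom_Ob[OF i1] by blast
  moreover have "(if i = j then i\<^sub>1 else i\<^sub>2 \<cdot> \<iota> i) \<in> Hom C (B i) P" if "i \<in> insert j I" for i
    using that i1 Comp_in_Hom[OF \<iota> i2] by auto
  ultimately show ?thesis
    unfolding is_coproduct_def by (intro conjI ballI allI impI) (assumption | rule ex)+
qed

end

text \<open>The source of \<open>degen_sum\<close> is a coproduct over the set {1..n} of natural
  numbers, whereas small coproducts are indexed by sets of another type. Biproducts supply the
  finite ones over every index type.\<close>

lemma (in abelian_category) has_coproduct_finite:
  "\<lbrakk>finite I; \<And>i. i \<in> I \<Longrightarrow> B i \<in> Ob C\<rbrakk> \<Longrightarrow> has_coproduct C I B"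
proof (induction I rule: finite_induct)
  case empty
  \<comment> \<open>The empty coproduct is the zero object; there are no injections, so
    \<open>undefined\<close> may stand for their family.\<close>
  have "is_coproduct C {} B (zero_object C) undefined"
    using is_zero_object_zero_object by (simp add: is_coproduct_def is_zero_object_def)
  thus ?case by blast
next
  case (insert j I)
  then obtain c \<iota> where c: "is_coproduct C I B c \<iota>" by blast
  hence "c \<in> Ob C" by (simp add: is_coproduct_def)
  then obtain P i\<^sub>1 i\<^sub>2 p\<^sub>1 p\<^sub>2 where "is_biproduct C (B j) c P i\<^sub>1 i\<^sub>2 p\<^sub>1 p\<^sub>2"
    using biproduct_exists insert.prems by (meson insertI1)
  thus ?case using is_coproduct_insert[OF c insert.hyps(2)] by blast
qed

section \<open>The cubical identities\<close>

text \<open>Cut \<open>xs\<close> into blocks \<open>us\<close>, \<open>vs\<close>,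
  \<open>ws\<close>, the first two of lengths i and j - i: both sides are
  \<open>us @ a # vs @ b # ws\<close>. Positions count from 0, and inserting \<open>a\<close> moves
  the later position from j to \<open>Suc j\<close>.\<close>

lemma insert_insert_list:
  assumes "i \<le> j" "j \<le> length xs"
  shows "take (Suc j) (take i xs @ a # drop i xs) @ b # drop (Suc j) (take i xs @ a # drop i xs)
    = take i (take j xs @ b # drop j xs) @ a # drop i (take j xs @ b # drop j xs)"
proof -
  obtain us vs ws where "xs = us @ vs @ ws" "length us = i" "length vs = j - i"
    using assms by (intro that[of "take i xs" "take (j - i) (drop i xs)" "drop j xs"])
      (simp_all flip: append_assoc take_add)
  moreover from this have "j = length us + length vs" using assms by simp
  ultimately show ?thesis by simp
qed

text \<open>With \<open>xs = us @ vs @ w # ws\<close> both sides are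
  \<open>us @ a # vs @ ws\<close>: the deleted entry \<open>w\<close> sits at j before the insertion
  of \<open>a\<close> and at \<open>Suc j\<close> after it.\<close>

lemma delete_insert_list_less:
  assumes "i \<le> j" "j < length xs"
  shows "take (Suc j) (take i xs @ a # drop i xs) @ drop (Suc (Suc j)) (take i xs @ a # drop i xs)
    = take i (take j xs @ drop (Suc j) xs) @ a # drop i (take j xs @ drop (Suc j) xs)"
proof -
  obtain us vs w ws where "xs = us @ vs @ w # ws" "length us = i" "length vs = j - i"
    using assms by (intro that[of "take i xs" "take (j - i) (drop i xs)" "xs ! j" "drop (Suc j) xs"])
      (simp_all flip: append_assoc take_add add: Cons_nth_drop_Suc)
  moreover from this have "j = length us + length vs" using assms by simp
  ultimately show ?thesis by simp
qed

text \<open>With \<open>xs = us @ v # vs @ ws\<close> both sides are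
  \<open>us @ vs @ a # ws\<close>; here deleting \<open>v\<close> moves the place of
  \<open>a\<close> from \<open>Suc i\<close> to i.\<close>

lemma delete_insert_list_greater:
  assumes "j \<le> i" "i < length xs"
  shows "take j (take (Suc i) xs @ a # drop (Suc i) xs) @ drop (Suc j) (take (Suc i) xs @ a # drop (Suc i) xs)
    = take i (take j xs @ drop (Suc j) xs) @ a # drop i (take j xs @ drop (Suc j) xs)"
proof -
  have "xs = take j xs @ xs ! j # take (i - j) (drop (Suc j) xs) @ drop (i - j) (drop (Suc j) xs)"
    using assms id_take_nth_drop[of j xs] by (simp only: append_take_drop_id)
  then obtain us v vs ws where "xs = us @ v # vs @ ws" "length us = j" "length vs = i - j"
    using assms by (elim that) simp_all
  moreover from this have "i = length us + length vs" using assms by simp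
  ultimately show ?thesis by simp
qed

lemma box_simps:
  "Ob box = UNIV" "Arr box = box_arrows" "Dom box = fst" "Cod box a = snd (snd a)"
  "Ide box n = (n, \<lambda>xs \<in> cube n. xs, n)"
  "b \<cdot>\<^bsub>box\<^esub> a = (fst a, compose (cube (fst a)) (fun_of b) (fun_of a), snd (snd b))"
  by (simp_all add: box_def)

lemma opposite_simps [simp]:
  "Ob (opposite C) = Ob C" "Arr (opposite C) = Arr C" "Dom (opposite C) = Cod C"
  "Cod (opposite C) = Dom C" "Ide (opposite C) = Ide C" "g \<cdot>\<^bsub>opposite C\<^esub> f = f \<cdot>\<^bsub>C\<^esub> g"
  by (simp_all add: opposite_def)

lemma Hom_opposite [simp]: "Hom (opposite C) A B = Hom C B A"
  by (auto simp: Hom_def)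

lemma face_in_Hom: "\<lbrakk>1 \<le> i; i \<le> n\<rbrakk> \<Longrightarrow> face n i \<epsilon> \<in> Hom box (n - 1) n"
  using box_face[of i n \<epsilon>] by (simp add: Hom_def box_simps face_def)

lemma degen_in_Hom: "\<lbrakk>1 \<le> i; i \<le> n\<rbrakk> \<Longrightarrow> degen n i \<in> Hom box n (n - 1)"
  using box_degen[of i n] by (simp add: Hom_def box_simps degen_def)

text \<open>Arrows of the cube category are extensional, so two composites agree once they agree on
  the source cube. The intermediate sets \<open>B\<close> and \<open>B'\<close> are independent:
  moving a degeneracy past a face changes the dimension of the cube in between.\<close>

lemma compose_restrict_cong:
  assumes "\<And>x. x \<in> A \<Longrightarrow> g x \<in> B" "\<And>x. x \<in> A \<Longrightarrow> g' x \<in> B'"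
    and "\<And>x. x \<in> A \<Longrightarrow> f (g x) = f' (g' x)"
  shows "compose A (restrict f B) (restrict g A) = compose A (restrict f' B') (restrict g' A)"
  using assms by (auto simp: compose_def restrict_def fun_eq_iff)

lemma face_face:
  assumes "1 \<le> i" "i < j" "j \<le> Suc n"
  shows "face (Suc n) j \<epsilon>' \<cdot>\<^bsub>box\<^esub> face n i \<epsilon> = face (Suc n) i \<epsilon> \<cdot>\<^bsub>box\<^esub> face n (j - 1) \<epsilon>'"
proof -
  obtain i' where i: "i = Suc i'" using assms by (cases i) auto
  \<comment> \<open>Faces count positions from 1 and the list lemmas from 0. As j is at least 2,
    \<open>j'\<close> is the zero-based position that belongs to j - 1.\<close>
  obtain j' where j: "j = Suc (Suc j')" using assms i by (cases j; cases "j - 1") auto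
  obtain n' where n: "n = Suc n'" using assms i by (cases n) auto
  show ?thesis unfolding face_def box_simps fun_of_def fst_conv snd_conv prod.inject diff_Suc_1
    using assms by (intro conjI refl compose_restrict_cong)
      (auto simp: cube_def i j n insert_insert_list simp del: take_append drop_append)
qed

lemma degen_face_less:
  assumes "1 \<le> i" "i < j" "j \<le> Suc n"
  shows "degen (Suc n) j \<cdot>\<^bsub>box\<^esub> face (Suc n) i \<epsilon> = face n i \<epsilon> \<cdot>\<^bsub>box\<^esub> degen n (j - 1)"
proof -
  obtain i' where i: "i = Suc i'" using assms by (cases i) auto
  obtain j' where j: "j = Suc (Suc j')" using assms i by (cases j; cases "j - 1") auto
  obtain n' where n: "n = Suc n'" using assms i by (cases n) auto
  show ?thesis unfolding face_def degen_def box_simps fun_of_def fst_conv snd_conv prod.inject diff_Suc_1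
    using assms by (intro conjI refl compose_restrict_cong)
      (auto simp: cube_def i j n delete_insert_list_less simp del: take_append drop_append)
qed

lemma degen_face_greater:
  assumes "1 \<le> j" "j < i" "i \<le> Suc n"
  shows "degen (Suc n) j \<cdot>\<^bsub>box\<^esub> face (Suc n) i \<epsilon> = face n (i - 1) \<epsilon> \<cdot>\<^bsub>box\<^esub> degen n j"
proof -
  obtain j' where j: "j = Suc j'" using assms by (cases j) auto
  obtain i' where i: "i = Suc (Suc i')" using assms j by (cases i; cases "i - 1") auto
  obtain n' where n: "n = Suc n'" using assms i by (cases n) auto
  show ?thesis unfolding face_def degen_def box_simps fun_of_def fst_conv snd_conv prod.inject diff_Suc_1
    using assms by (intro conjI refl compose_restrict_cong)
      (auto simp: cube_def i j n delete_insert_list_greater simp del: take_append drop_append)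
qed

lemma degen_face_same:
  assumes "1 \<le> i" "i \<le> Suc n"
  shows "degen (Suc n) i \<cdot>\<^bsub>box\<^esub> face (Suc n) i \<epsilon> = Ide box n"
proof -
  obtain i' where i: "i = Suc i'" using assms by (cases i) auto
  show ?thesis unfolding face_def degen_def box_simps fun_of_def fst_conv snd_conv prod.inject diff_Suc_1
    using assms by (auto simp: cube_def i compose_def restrict_def fun_eq_iff)
qed

section \<open>Sums in commutative groups\<close>

lemma hom_inv:
  assumes "h \<in> hom G H" "group G" "group H" "x \<in> carrier G"
  shows "h (inv\<^bsub>G\<^esub> x) = inv\<^bsub>H\<^esub> h x"
proof -
  interpret group_hom G H h using assms by (simp add: group_hom_def group_hom_axioms_def)
  show ?thesis using assms(4) by simp
qed

text \<open>The unit is a separate hypothesis because membership in \<open>hom\<close> speaks of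
  products only; for monoids the unit does not follow. It is also the value of
  \<open>finprod\<close> on an infinite set.\<close>

lemma hom_finprod:
  assumes "comm_monoid G" "comm_monoid H" "h \<in> hom G H" "h \<one>\<^bsub>G\<^esub> = \<one>\<^bsub>H\<^esub>"
    and "\<And>i. i \<in> S \<Longrightarrow> f i \<in> carrier G"
  shows "h (finprod G f S) = finprod H (\<lambda>i. h (f i)) S"
  using assms(5)
proof (induction S rule: infinite_finite_induct)
  case (infinite S)
  thus ?case using assms(1,2,4) by (simp add: comm_monoid.finprod_infinite)
next
  case empty
  thus ?case using assms(1,2,4) by (simp add: comm_monoid.finprod_empty)
next
  case (insert a S)
  interpret G: comm_monoid G by fact
  interpret H: comm_monoid H by fact
  have f: "f \<in> S \<rightarrow> carrier G" "f a \<in> carrier G" using insert.prems by auto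
  have hf: "(\<lambda>i. h (f i)) \<in> S \<rightarrow> carrier H" "h (f a) \<in> carrier H"
    using f assms(3) by (auto simp: hom_def Pi_iff)
  show ?case
    using insert f hf hom_mult[OF assms(3) f(2) G.finprod_closed[OF f(1)]] by simp
qed

context comm_group
begin

text \<open>Symmetry of a mixed second difference; it lets two directions of a cube be
  exchanged.\<close>

lemma difference_of_differences_swap:
  assumes "w \<in> carrier G" "x \<in> carrier G" "y \<in> carrier G" "z \<in> carrier G"
  shows "(w \<otimes> inv x) \<otimes> inv (y \<otimes> inv z) = (w \<otimes> inv y) \<otimes> inv (x \<otimes> inv z)"
  using assms by (simp add: inv_mult m_ac)

(* The map (i, j) -> (j - 1, i) is a bijection from the index pairs with i < j onto those with j <= i. *)
lemma finprod_simplicial_cancel: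
  assumes T: "\<And>i j. \<lbrakk>1 \<le> i; i \<le> n; 1 \<le> j; j \<le> Suc n\<rbrakk> \<Longrightarrow> T i j \<in> carrier G"
    and swap: "\<And>i j. \<lbrakk>1 \<le> i; i < j; j \<le> Suc n\<rbrakk> \<Longrightarrow> T (j - 1) i = inv (T i j)"
  shows "(\<Otimes>i\<in>{1..n}. \<Otimes>j\<in>{1..Suc n}. T i j) = \<one>"
proof -
  let ?T = "\<lambda>(i, j). T i j"
  \<comment> \<open>The rectangle of index pairs splits into the pairs above the diagonal and the
    rest; both parts have the same size because j runs one step further than i.\<close>
  define P where "P = {(i, j). 1 \<le> i \<and> i < j \<and> j \<le> Suc n}"
  define Q where "Q = {(i, j). 1 \<le> j \<and> j \<le> i \<and> i \<le> n}"
  let ?s = "\<lambda>(i, j). (j - 1, i)"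
  have fin: "finite P" "finite Q"
    by (rule finite_subset[of _ "{..Suc n} \<times> {..Suc n}"]; auto simp: P_def Q_def)+
  have TP: "?T \<in> P \<rightarrow> carrier G" and TQ: "?T \<in> Q \<rightarrow> carrier G"
    using T by (auto simp: P_def Q_def)
  have sP: "?s ` P = Q"
  proof (intro equalityI subsetI)
    fix p assume "p \<in> Q"
    \<comment> \<open>The inverse of the shift sends (i, j) in \<open>Q\<close> to (j,
      \<open>Suc i\<close>); the successor turns the weak inequality of \<open>Q\<close> into the
      strict one of \<open>P\<close>.\<close>
    thus "p \<in> ?s ` P" by (intro image_eqI[of _ _ "(snd p, Suc (fst p))"]) (auto simp: P_def Q_def)
  qed (auto simp: P_def Q_def)
  have inj: "inj_on ?s P" by (auto simp: inj_on_def P_def)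
  have "(\<Otimes>i\<in>{1..n}. \<Otimes>j\<in>{1..Suc n}. T i j)
      = (\<Otimes>i\<in>{1..n}. \<Otimes>p\<in>Pair i ` {1..Suc n}. ?T p)"
    using T by (intro finprod_cong' refl)
      (auto simp: finprod_reindex inj_on_def Pi_iff simp del: One_nat_def intro!: finprod_closed)
  also have "\<dots> = (\<Otimes>p\<in>(\<Union>i\<in>{1..n}. Pair i ` {1..Suc n}). ?T p)"
    using T by (intro finprod_UN_disjoint[symmetric]) (auto simp: pairwise_def disjnt_def)
  also have "(\<Union>i\<in>{1..n}. Pair i ` {1..Suc n}) = P \<union> Q"
    by (auto simp: P_def Q_def image_iff)
  also have "(\<Otimes>p\<in>P \<union> Q. ?T p) = (\<Otimes>p\<in>P. ?T p) \<otimes> (\<Otimes>p\<in>Q. ?T p)"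
    using fin TP TQ by (intro finprod_Un_disjoint) (auto simp: P_def Q_def)
  also have "(\<Otimes>p\<in>Q. ?T p) = (\<Otimes>p\<in>P. ?T (?s p))"
    using finprod_reindex[OF _ inj, of ?T] TQ sP by simp
  \<comment> \<open>Here \<open>swap\<close> enters: reindexed over \<open>P\<close>, each factor
    from \<open>Q\<close> is the inverse of the factor of \<open>P\<close> at the same pair.\<close>
  also have "\<dots> = (\<Otimes>p\<in>P. inv (?T p))"
    using TP by (intro finprod_cong') (auto simp: P_def swap[simplified] T)
  also have "(\<Otimes>p\<in>P. ?T p) \<otimes> (\<Otimes>p\<in>P. inv (?T p)) = (\<Otimes>p\<in>P. ?T p \<otimes> inv (?T p))"
    using TP by (intro finprod_multf[symmetric]) (auto simp: Pi_iff)
  also have "\<dots> = \<one>"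
    using TP by (intro finprod_one_eqI) (auto simp: Pi_iff)
  finally show ?thesis .
qed

end

section \<open>The normalized complex of a cubical object\<close>

text \<open>In additive notation d_i^0 - d_i^1. It is named without its sign because it behaves like
  a simplicial face operator with a single index.\<close>

definition face_difference ::
  "('o, 'a, 'z) preadditive_data_scheme \<Rightarrow> (nat, box_arrow, 'o, 'a) functor_data
    \<Rightarrow> nat \<Rightarrow> nat \<Rightarrow> 'a" where
  "face_difference C P n i =
     (let G = hom_group C (obmap P n) (obmap P (n - 1))
      in arrmap P (face n i False) \<otimes>\<^bsub>G\<^esub> inv\<^bsub>G\<^esub> arrmap P (face n i True))"

text \<open>From here on the definitions behind the normalized complex are repeated for an arbitrary
  cubical object \<open>P\<close>, so that functoriality can be stated for natural transformations
  of cubical objects.\<close>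

definition cube_diff ::
  "('o, 'a, 'z) preadditive_data_scheme \<Rightarrow> (nat, box_arrow, 'o, 'a) functor_data \<Rightarrow> nat \<Rightarrow> 'a" where
  "cube_diff C P n =
     (let G = hom_group C (obmap P n) (obmap P (n - 1))
      in \<Otimes>\<^bsub>G\<^esub>i\<in>{1..n}. face_difference C P n i [^]\<^bsub>G\<^esub> ((- 1) ^ i :: int))"

definition cube_degen_sum ::
  "('o, 'a, 'z) preadditive_data_scheme \<Rightarrow> (nat, box_arrow, 'o, 'a) functor_data \<Rightarrow> nat \<Rightarrow> 'a" where
  "cube_degen_sum C P n =
     copair C {1..n} (\<lambda>_. obmap P (n - 1)) (obmap P n) (\<lambda>i. arrmap P (degen n i))"

definition cube_proj ::
  "('o, 'a, 'z) preadditive_data_scheme \<Rightarrow> (nat, box_arrow, 'o, 'a) functor_data \<Rightarrow> nat \<Rightarrow> 'a" where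
  "cube_proj C P n = coker C (cube_degen_sum C P n)"

definition normalized ::
  "('o, 'a, 'z) preadditive_data_scheme \<Rightarrow> (nat, box_arrow, 'o, 'a) functor_data
    \<Rightarrow> ('o, 'a) chain_complex" where
  "normalized C P =
     \<lparr>chain_ob = (\<lambda>n. Cod C (cube_proj C P n)),
      bdry = (\<lambda>n. descend_epi C (cube_proj C P (Suc n)) (cube_proj C P n \<cdot>\<^bsub>C\<^esub> cube_diff C P (Suc n)))\<rparr>"

definition normalized_map ::
  "('o, 'a, 'z) preadditive_data_scheme \<Rightarrow> (nat, box_arrow, 'o, 'a) functor_data
    \<Rightarrow> (nat, box_arrow, 'o, 'a) functor_data \<Rightarrow> (nat \<Rightarrow> 'a) \<Rightarrow> nat \<Rightarrow> 'a" where
  "normalized_map C P Q m n = descend_epi C (cube_proj C P n) (cube_proj C Q n \<cdot>\<^bsub>C\<^esub> m n)"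

lemma cubical_objectD:
  assumes "is_functor (opposite box) C P"
  shows "obmap P n \<in> Ob C"
    and "\<alpha> \<in> Hom box k n \<Longrightarrow> arrmap P \<alpha> \<in> Hom C (obmap P n) (obmap P k)"
    and "arrmap P (Ide box n) = Ide C (obmap P n)"
    and "\<lbrakk>\<alpha> \<in> Hom box k l; \<beta> \<in> Hom box l n\<rbrakk>
      \<Longrightarrow> arrmap P (\<beta> \<cdot>\<^bsub>box\<^esub> \<alpha>) = arrmap P \<alpha> \<cdot>\<^bsub>C\<^esub> arrmap P \<beta>"
proof -
  interpret is_functor "opposite box" C P by fact
  show "obmap P n \<in> Ob C" "arrmap P (Ide box n) = Ide C (obmap P n)"
    using obmap_in_Ob[of n] arrmap_Ide[of n] by (simp_all add: box_simps(1))
  show "\<alpha> \<in> Hom box k n \<Longrightarrow> arrmap P \<alpha> \<in> Hom C (obmap P n) (obmap P k)"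
    using arrmap_in_Hom[of \<alpha> n k] by simp
  show "\<lbrakk>\<alpha> \<in> Hom box k l; \<beta> \<in> Hom box l n\<rbrakk>
      \<Longrightarrow> arrmap P (\<beta> \<cdot>\<^bsub>box\<^esub> \<alpha>) = arrmap P \<alpha> \<cdot>\<^bsub>C\<^esub> arrmap P \<beta>"
    using arrmap_Comp[of \<beta> n l \<alpha> k] by simp
qed

lemma cubical_nat_transD:
  assumes "nat_trans (opposite box) C P Q m"
  shows "is_functor (opposite box) C P" "is_functor (opposite box) C Q"
    and "m n \<in> Hom C (obmap P n) (obmap Q n)"
    and "\<alpha> \<in> Hom box k n \<Longrightarrow> m k \<cdot>\<^bsub>C\<^esub> arrmap P \<alpha> = arrmap Q \<alpha> \<cdot>\<^bsub>C\<^esub> m n"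
proof -
  interpret nat_trans "opposite box" C P Q m by fact
  show "is_functor (opposite box) C P" "is_functor (opposite box) C Q"
    by unfold_locales
  show "m n \<in> Hom C (obmap P n) (obmap Q n)"
    using component[of n] by (simp add: box_simps(1))
  show "\<alpha> \<in> Hom box k n \<Longrightarrow> m k \<cdot>\<^bsub>C\<^esub> arrmap P \<alpha> = arrmap Q \<alpha> \<cdot>\<^bsub>C\<^esub> m n"
    using naturality[of \<alpha> n k] by simp
qed

section \<open>The differential of a cubical object and its square\<close>

context preadditive_category
begin

lemma Comp_Comp_hom:
  assumes "g \<in> Hom C B D" "f \<in> Hom C A' A"
  shows "(\<lambda>x. (g \<cdot> x) \<cdot> f) \<in> hom (hom_group C A B) (hom_group C A' D)"
proof -
  have "(g \<cdot> Add C x y) \<cdot> f = Add C ((g \<cdot> x) \<cdot> f) ((g \<cdot> y) \<cdot> f)" if "x \<in> Hom C A B" "y \<in> Hom C A B" for x y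
    using Comp_Add[OF that assms(1)] Add_Comp[OF assms(2) Comp_in_Hom[OF that(1) assms(1)]
        Comp_in_Hom[OF that(2) assms(1)]] by simp
  moreover have "(g \<cdot> x) \<cdot> f \<in> Hom C A' D" if "x \<in> Hom C A B" for x
    using Comp_in_Hom[OF assms(2) Comp_in_Hom[OF that assms(1)]] .
  ultimately show ?thesis by (simp add: hom_def hom_group_mult)
qed

lemma hom_group_hom_finprod:
  assumes "h \<in> hom (hom_group C A B) (hom_group C A' B')"
    and "A \<in> Ob C" "B \<in> Ob C" "A' \<in> Ob C" "B' \<in> Ob C" "\<And>i. i \<in> S \<Longrightarrow> f i \<in> Hom C A B"
  shows "h (finprod (hom_group C A B) f S) = finprod (hom_group C A' B') (\<lambda>i. h (f i)) S"
  using assms comm_group_hom[THEN comm_group.axioms(1)] hom_one[OF assms(1)] group_hom_group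
  by (intro hom_finprod) auto

lemma arrmap_face_in_Hom:
  assumes "is_functor (opposite box) C P" "1 \<le> i" "i \<le> n"
  shows "arrmap P (face n i \<epsilon>) \<in> Hom C (obmap P n) (obmap P (n - 1))"
  using cubical_objectD(2)[OF assms(1)] face_in_Hom assms(2,3) by blast

lemma arrmap_degen_in_Hom:
  assumes "is_functor (opposite box) C P" "1 \<le> i" "i \<le> n"
  shows "arrmap P (degen n i) \<in> Hom C (obmap P (n - 1)) (obmap P n)"
  using cubical_objectD(2)[OF assms(1)] degen_in_Hom assms(2,3) by blast

lemma face_difference_in_Hom:
  assumes "is_functor (opposite box) C P" "1 \<le> i" "i \<le> n"
  shows "face_difference C P n i \<in> Hom C (obmap P n) (obmap P (n - 1))"
proof -
  interpret G: group "hom_group C (obmap P n) (obmap P (n - 1))"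
    using group_hom_group cubical_objectD(1)[OF assms(1)] by blast
  show ?thesis
    using G.m_closed[OF _ G.inv_closed] arrmap_face_in_Hom[OF assms]
    unfolding face_difference_def Let_def by simp
qed

lemma signed_face_difference_in_Hom:
  assumes "is_functor (opposite box) C P" "1 \<le> i" "i \<le> n"
  shows "face_difference C P n i [^]\<^bsub>hom_group C (obmap P n) (obmap P (n - 1))\<^esub> (k :: int)
    \<in> Hom C (obmap P n) (obmap P (n - 1))"
proof -
  interpret G: group "hom_group C (obmap P n) (obmap P (n - 1))"
    using group_hom_group cubical_objectD(1)[OF assms(1)] by blast
  show ?thesis using G.int_pow_closed face_difference_in_Hom[OF assms] by simp
qed

lemma cube_diff_in_Hom:
  assumes "is_functor (opposite box) C P"
  shows "cube_diff C P n \<in> Hom C (obmap P n) (obmap P (n - 1))"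
proof -
  interpret G: comm_group "hom_group C (obmap P n) (obmap P (n - 1))"
    using comm_group_hom cubical_objectD(1)[OF assms(1)] by blast
  show ?thesis
    using G.finprod_closed[of "\<lambda>i. face_difference C P n i [^]\<^bsub>hom_group C (obmap P n) (obmap P (n - 1))\<^esub> ((- 1) ^ i :: int)" "{1..n}"]
      signed_face_difference_in_Hom[OF assms] unfolding cube_diff_def Let_def by (simp add: Pi_iff)
qed

lemma hom_face_difference:
  assumes "is_functor (opposite box) C P" "1 \<le> i" "i \<le> n"
    and "h \<in> hom (hom_group C (obmap P n) (obmap P (n - 1))) H" "group H"
  shows "h (face_difference C P n i)
    = h (arrmap P (face n i False)) \<otimes>\<^bsub>H\<^esub> inv\<^bsub>H\<^esub> h (arrmap P (face n i True))"
proof -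
  interpret G: group "hom_group C (obmap P n) (obmap P (n - 1))"
    using group_hom_group cubical_objectD(1)[OF assms(1)] by blast
  note f = arrmap_face_in_Hom[OF assms(1-3)]
  show ?thesis
    unfolding face_difference_def Let_def
    using hom_mult[OF assms(4) _ G.inv_closed] hom_inv[OF assms(4) G.is_group assms(5)] f by simp
qed

text \<open>Composing the differential with fixed arrows, on either side or on both, is a
  homomorphism of hom groups, so the result is computed from the images of the individual faces.
  Naturality and the passage to the quotient both start from this expansion.\<close>

lemma hom_cube_diff:
  assumes "is_functor (opposite box) C P" "A \<in> Ob C" "D \<in> Ob C"
    and "h \<in> hom (hom_group C (obmap P n) (obmap P (n - 1))) (hom_group C A D)"
  shows "h (cube_diff C P n) = (\<Otimes>\<^bsub>hom_group C A D\<^esub>i\<in>{1..n}.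
    (h (arrmap P (face n i False)) \<otimes>\<^bsub>hom_group C A D\<^esub>
      inv\<^bsub>hom_group C A D\<^esub> h (arrmap P (face n i True))) [^]\<^bsub>hom_group C A D\<^esub> ((- 1) ^ i :: int))"
proof -
  let ?G = "hom_group C (obmap P n) (obmap P (n - 1))"
  interpret H: comm_group "hom_group C A D" using comm_group_hom assms by blast
  note ob = cubical_objectD(1)[OF assms(1)]
  have f: "h (arrmap P (face n i \<epsilon>)) \<in> carrier (hom_group C A D)" if "1 \<le> i" "i \<le> n" for i \<epsilon>
    using hom_in_carrier[OF assms(4)] arrmap_face_in_Hom[OF assms(1) that] by simp
  have "h (cube_diff C P n)
      = finprod (hom_group C A D) (\<lambda>i. h (face_difference C P n i [^]\<^bsub>?G\<^esub> ((- 1) ^ i :: int))) {1..n}"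
    unfolding cube_diff_def Let_def using assms ob signed_face_difference_in_Hom
    by (intro hom_group_hom_finprod) auto
  also have "\<dots> = (\<Otimes>\<^bsub>hom_group C A D\<^esub>i\<in>{1..n}.
    (h (arrmap P (face n i False)) \<otimes>\<^bsub>hom_group C A D\<^esub>
      inv\<^bsub>hom_group C A D\<^esub> h (arrmap P (face n i True))) [^]\<^bsub>hom_group C A D\<^esub> ((- 1) ^ i :: int))"
  proof (rule H.finprod_cong'[OF refl])
    show "(\<lambda>i. (h (arrmap P (face n i False)) \<otimes>\<^bsub>hom_group C A D\<^esub>
      inv\<^bsub>hom_group C A D\<^esub> h (arrmap P (face n i True))) [^]\<^bsub>hom_group C A D\<^esub> ((- 1) ^ i :: int))
      \<in> {1..n} \<rightarrow> carrier (hom_group C A D)"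
      using f by (intro funcsetI H.int_pow_closed H.m_closed H.inv_closed) auto
    fix i assume "i \<in> {1..n}"
    thus "h (face_difference C P n i [^]\<^bsub>?G\<^esub> ((- 1) ^ i :: int))
      = (h (arrmap P (face n i False)) \<otimes>\<^bsub>hom_group C A D\<^esub>
      inv\<^bsub>hom_group C A D\<^esub> h (arrmap P (face n i True))) [^]\<^bsub>hom_group C A D\<^esub> ((- 1) ^ i :: int)"
      using hom_int_pow[OF assms(4) _ group_hom_group H.is_group] face_difference_in_Hom[OF assms(1)]
        hom_face_difference[OF assms(1) _ _ assms(4) H.is_group] ob by simp
  qed
  finally show ?thesis .
qed

text \<open>Both composites lie in the group of arrows from \<open>obmap P n\<close> to
  \<open>obmap Q (n - 1)\<close> and expand to the same product, since \<open>m\<close> commutes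
  with each face. In degree 0 both products are empty.\<close>

lemma cube_diff_natural:
  assumes "nat_trans (opposite box) C P Q m"
  shows "m (n - 1) \<cdot> cube_diff C P n = cube_diff C Q n \<cdot> m n"
proof -
  note P = cubical_nat_transD(1)[OF assms] and Q = cubical_nat_transD(2)[OF assms]
  note m = cubical_nat_transD(3)[OF assms]
  note ob = cubical_objectD(1)[OF P] cubical_objectD(1)[OF Q]
  interpret H: comm_group "hom_group C (obmap P n) (obmap Q (n - 1))"
    using comm_group_hom ob by blast
  have f: "m (n - 1) \<cdot> arrmap P (face n i \<epsilon>) = arrmap Q (face n i \<epsilon>) \<cdot> m n"
      "arrmap Q (face n i \<epsilon>) \<cdot> m n \<in> carrier (hom_group C (obmap P n) (obmap Q (n - 1)))"
    if "i \<in> {1..n}" for i \<epsilon>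
    using that cubical_nat_transD(4)[OF assms face_in_Hom]
      Comp_in_Hom[OF m arrmap_face_in_Hom[OF Q]] by auto
  show ?thesis
    unfolding hom_cube_diff[OF P ob Comp_left_hom[OF m]] hom_cube_diff[OF Q ob Comp_right_hom[OF m]]
    using f by (intro H.finprod_cong' refl funcsetI H.int_pow_closed H.m_closed H.inv_closed) auto
qed

text \<open>The exchange law for two faces holds for all four choices of ends, so by bilinearity it
  passes to the differences.\<close>

lemma face_difference_swap:
  assumes "is_functor (opposite box) C P" "1 \<le> i" "i < j" "j \<le> Suc n"
  shows "face_difference C P n i \<cdot> face_difference C P (Suc n) j
    = face_difference C P n (j - 1) \<cdot> face_difference C P (Suc n) i"
proof -
  let ?H = "hom_group C (obmap P (Suc n)) (obmap P (n - 1))"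
  note ob = cubical_objectD(1)[OF assms(1)]
  interpret H: comm_group ?H using comm_group_hom ob by blast
  note fH = arrmap_face_in_Hom[OF assms(1)]
  have expand: "face_difference C P n k \<cdot> face_difference C P (Suc n) l
    = (arrmap P (face n k False) \<cdot> arrmap P (face (Suc n) l False) \<otimes>\<^bsub>?H\<^esub>
        inv\<^bsub>?H\<^esub> (arrmap P (face n k True) \<cdot> arrmap P (face (Suc n) l False))) \<otimes>\<^bsub>?H\<^esub>
      inv\<^bsub>?H\<^esub> (arrmap P (face n k False) \<cdot> arrmap P (face (Suc n) l True) \<otimes>\<^bsub>?H\<^esub>
        inv\<^bsub>?H\<^esub> (arrmap P (face n k True) \<cdot> arrmap P (face (Suc n) l True)))"
    if "1 \<le> k" "k \<le> n" "1 \<le> l" "l \<le> Suc n" for k l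
  proof -
    have l: "arrmap P (face (Suc n) l \<epsilon>) \<in> Hom C (obmap P (Suc n)) (obmap P n)" for \<epsilon>
      using fH[OF that(3,4)] by simp
    have 1: "face_difference C P n k \<cdot> face_difference C P (Suc n) l
      = face_difference C P n k \<cdot> arrmap P (face (Suc n) l False) \<otimes>\<^bsub>?H\<^esub>
        inv\<^bsub>?H\<^esub> (face_difference C P n k \<cdot> arrmap P (face (Suc n) l True))"
      by (rule hom_face_difference[where h="\<lambda>x. face_difference C P n k \<cdot> x", OF assms(1) that(3,4) _ H.is_group])
        (use Comp_left_hom[OF face_difference_in_Hom[OF assms(1) that(1,2)], of "obmap P (Suc n)"] in simp)
    have 2: "face_difference C P n k \<cdot> arrmap P (face (Suc n) l \<epsilon>)
      = arrmap P (face n k False) \<cdot> arrmap P (face (Suc n) l \<epsilon>) \<otimes>\<^bsub>?H\<^esub>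
        inv\<^bsub>?H\<^esub> (arrmap P (face n k True) \<cdot> arrmap P (face (Suc n) l \<epsilon>))" for \<epsilon>
      by (rule hom_face_difference[OF assms(1) that(1,2) Comp_right_hom[OF l] H.is_group])
    show ?thesis unfolding 1 2 ..
  qed
  have swap: "arrmap P (face n i \<epsilon>) \<cdot> arrmap P (face (Suc n) j \<delta>)
      = arrmap P (face n (j - 1) \<delta>) \<cdot> arrmap P (face (Suc n) i \<epsilon>)" for \<epsilon> \<delta>
  proof -
    have "arrmap P (face (Suc n) j \<delta> \<cdot>\<^bsub>box\<^esub> face n i \<epsilon>) = arrmap P (face (Suc n) i \<epsilon> \<cdot>\<^bsub>box\<^esub> face n (j - 1) \<delta>)"
      using face_face[OF assms(2-4)] by simp
    thus ?thesis
      using cubical_objectD(4)[OF assms(1) face_in_Hom face_in_Hom[of _ "Suc n", simplified diff_Suc_1]] assms(2-4)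
      by simp
  qed
  let ?a = "\<lambda>\<epsilon> \<delta>. arrmap P (face n i \<epsilon>) \<cdot> arrmap P (face (Suc n) j \<delta>)"
  have a: "?a \<epsilon> \<delta> \<in> carrier ?H" for \<epsilon> \<delta>
    using Comp_in_Hom[OF _ fH[of i n \<epsilon>], of _ "obmap P (Suc n)"] fH[of j "Suc n" \<delta>] assms(2-4) by simp
  have e: "1 \<le> i" "i \<le> n" "1 \<le> j" "j \<le> Suc n" "1 \<le> j - 1" "j - 1 \<le> n" "i \<le> Suc n"
    using assms(2-4) by auto
  \<comment> \<open>After \<open>swap\<close> the two sides have the same four terms with the middle
    two exchanged: the outer difference is taken in direction j on the left and in direction i on
    the right.\<close>
  show ?thesis
    unfolding expand[OF e(1-4)] expand[OF e(5,6,1,7)] swap[symmetric]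
    by (rule H.difference_of_differences_swap[OF a a a a])
qed

lemma cube_diff_cube_diff:
  assumes "is_functor (opposite box) C P"
  shows "cube_diff C P n \<cdot> cube_diff C P (Suc n) = Zero C (obmap P (Suc n)) (obmap P (n - 1))"
proof -
  let ?G = "hom_group C (obmap P n) (obmap P (n - 1))"
  let ?G' = "hom_group C (obmap P (Suc n)) (obmap P n)"
  let ?H = "hom_group C (obmap P (Suc n)) (obmap P (n - 1))"
  note ob = cubical_objectD(1)[OF assms(1)]
  interpret G: comm_group ?G using comm_group_hom ob by blast
  interpret G': comm_group ?G' using comm_group_hom ob by blast
  interpret H: comm_group ?H using comm_group_hom ob by blast
  let ?s = "\<lambda>i. face_difference C P n i [^]\<^bsub>?G\<^esub> ((- 1) ^ i :: int)"
  let ?s' = "\<lambda>j. face_difference C P (Suc n) j [^]\<^bsub>?G'\<^esub> ((- 1) ^ j :: int)"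
  have s: "?s i \<in> Hom C (obmap P n) (obmap P (n - 1))" if "1 \<le> i" "i \<le> n" for i
    using signed_face_difference_in_Hom[OF assms that] .
  have s': "?s' j \<in> Hom C (obmap P (Suc n)) (obmap P n)" if "1 \<le> j" "j \<le> Suc n" for j
    using signed_face_difference_in_Hom[OF assms that] by simp
  have fd: "face_difference C P n i \<in> Hom C (obmap P n) (obmap P (n - 1))" if "1 \<le> i" "i \<le> n" for i
    using face_difference_in_Hom[OF assms that] .
  have fd': "face_difference C P (Suc n) i \<in> Hom C (obmap P (Suc n)) (obmap P n)"
    if "1 \<le> i" "i \<le> Suc n" for i
    using face_difference_in_Hom[OF assms that] by simp
  have d': "cube_diff C P (Suc n) \<in> Hom C (obmap P (Suc n)) (obmap P n)"
    using cube_diff_in_Hom[OF assms, of "Suc n"] by simp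
  \<comment> \<open>Additivity in each factor pulls both signs out into one integer exponent, so
    that only the unsigned differences remain to be compared.\<close>
  have T: "?s i \<cdot> ?s' j = (face_difference C P n i \<cdot> face_difference C P (Suc n) j)
      [^]\<^bsub>?H\<^esub> ((- 1) ^ i * (- 1) ^ j :: int)"
    if "1 \<le> i" "i \<le> n" "1 \<le> j" "j \<le> Suc n" for i j
  proof -
    have "?s i \<cdot> ?s' j = (face_difference C P n i \<cdot> ?s' j) [^]\<^bsub>?H\<^esub> ((- 1) ^ i :: int)"
      using hom_int_pow[OF Comp_right_hom[OF s'[OF that(3,4)]] _ G.is_group H.is_group] fd that by simp
    also have "face_difference C P n i \<cdot> ?s' j
        = (face_difference C P n i \<cdot> face_difference C P (Suc n) j) [^]\<^bsub>?H\<^esub> ((- 1) ^ j :: int)"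
      using hom_int_pow[OF Comp_left_hom[OF fd[OF that(1,2)]] _ G'.is_group H.is_group] fd' that by simp
    finally show ?thesis
      using H.int_pow_pow Comp_in_Hom[OF fd'[OF that(3,4)] fd[OF that(1,2)]]
      by (simp add: mult.commute)
  qed
  have "cube_diff C P n \<cdot> cube_diff C P (Suc n)
      = (\<Otimes>\<^bsub>?H\<^esub>i\<in>{1..n}. ?s i \<cdot> cube_diff C P (Suc n))"
    using hom_group_hom_finprod[OF Comp_right_hom[OF d'] ob ob ob ob, of "{1..n}" ?s] s
    by (simp add: cube_diff_def[of C P n] Let_def)
  also have "\<dots> = (\<Otimes>\<^bsub>?H\<^esub>i\<in>{1..n}. \<Otimes>\<^bsub>?H\<^esub>j\<in>{1..Suc n}. ?s i \<cdot> ?s' j)"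
  proof (rule H.finprod_cong'[OF refl])
    show "(\<lambda>i. \<Otimes>\<^bsub>?H\<^esub>j\<in>{1..Suc n}. ?s i \<cdot> ?s' j) \<in> {1..n} \<rightarrow> carrier ?H"
      using Comp_in_Hom[OF s' s] by (intro funcsetI H.finprod_closed) auto
    fix i assume "i \<in> {1..n}"
    hence i: "1 \<le> i" "i \<le> n" by auto
    show "?s i \<cdot> cube_diff C P (Suc n) = (\<Otimes>\<^bsub>?H\<^esub>j\<in>{1..Suc n}. ?s i \<cdot> ?s' j)"
      using hom_group_hom_finprod[OF Comp_left_hom[OF s[OF i]] ob ob ob ob, of "{1..Suc n}" ?s'] s'
      by (simp add: cube_diff_def[of C P "Suc n"] Let_def)
  qed
  also have "\<dots> = \<one>\<^bsub>?H\<^esub>"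
  proof (rule H.finprod_simplicial_cancel)
    fix i j
    show "?s i \<cdot> ?s' j \<in> carrier ?H" if "1 \<le> i" "i \<le> n" "1 \<le> j" "j \<le> Suc n"
      using Comp_in_Hom[OF s'[OF that(3,4)] s[OF that(1,2)]] by simp
    assume ij: "1 \<le> i" "i < j" "j \<le> Suc n"
    then obtain j' where j: "j = Suc j'" by (cases j) auto
    \<comment> \<open>Passing from (i, j) to (j - 1, i) keeps the composite of differences and
      lowers the sum of the indices by one, so the exponent changes sign.\<close>
    have "?s (j - 1) \<cdot> ?s' i = (face_difference C P n i \<cdot> face_difference C P (Suc n) j)
        [^]\<^bsub>?H\<^esub> (- ((- 1) ^ i * (- 1) ^ j) :: int)"
      using T[of "j - 1" i] face_difference_swap[OF assms ij] ij j by (simp add: mult.commute)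
    also have "\<dots> = inv\<^bsub>?H\<^esub> (?s i \<cdot> ?s' j)"
      using T[of i j] ij H.int_pow_neg Comp_in_Hom[OF fd'[of j] fd[of i]] by simp
    finally show "?s (j - 1) \<cdot> ?s' i = inv\<^bsub>?H\<^esub> (?s i \<cdot> ?s' j)" .
  qed
  finally show ?thesis by simp
qed

end

section \<open>The quotient by degeneracies\<close>

context abelian_category
begin

lemma has_coproduct_degen:
  "is_functor (opposite box) C P \<Longrightarrow> has_coproduct C {1..n} (\<lambda>_. obmap P (n - 1))"
  using cubical_objectD(1) by (intro has_coproduct_finite) auto

lemma cube_degen_sum:
  assumes "is_functor (opposite box) C P"
  shows cube_degen_sum_in_Hom: "cube_degen_sum C P n
      \<in> Hom C (coprod_ob C {1..n} (\<lambda>_. obmap P (n - 1))) (obmap P n)"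
    and cube_degen_sum_Comp_in: "\<And>j. \<lbrakk>1 \<le> j; j \<le> n\<rbrakk>
      \<Longrightarrow> cube_degen_sum C P n \<cdot> coprod_in C {1..n} (\<lambda>_. obmap P (n - 1)) j = arrmap P (degen n j)"
  unfolding cube_degen_sum_def
  using copair_coprod[of "{1..n}" "\<lambda>_. obmap P (n - 1)" "obmap P n" "\<lambda>i. arrmap P (degen n i)"]
    has_coproduct_degen[OF assms] cubical_objectD(1)[OF assms] arrmap_degen_in_Hom[OF assms]
  by (simp_all del: One_nat_def)

lemma is_cokernel_cube_proj:
  "is_functor (opposite box) C P \<Longrightarrow> is_cokernel C (cube_degen_sum C P n) (cube_proj C P n)"
  unfolding cube_proj_def
  using HomD[OF cube_degen_sum_in_Hom, of P n] by (intro is_cokernel_coker) blast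

lemma cube_proj_in_Hom:
  "is_functor (opposite box) C P \<Longrightarrow>
    cube_proj C P n \<in> Hom C (obmap P n) (chain_ob (normalized C P) n)"
  using is_cokernelD(2)[OF is_cokernel_cube_proj, of P n] HomD[OF cube_degen_sum_in_Hom, of P n]
  by (simp add: normalized_def)

lemma cube_proj_Comp_degen:
  assumes "is_functor (opposite box) C P" "1 \<le> j" "j \<le> n"
  shows "cube_proj C P n \<cdot> arrmap P (degen n j)
    = Zero C (obmap P (n - 1)) (chain_ob (normalized C P) n)"
proof -
  let ?i = "coprod_in C {1..n} (\<lambda>_. obmap P (n - 1)) j"
  note S = cube_degen_sum_in_Hom[OF assms(1), of n] and q = cube_proj_in_Hom[OF assms(1), of n]
  have i: "?i \<in> Hom C (obmap P (n - 1)) (coprod_ob C {1..n} (\<lambda>_. obmap P (n - 1)))"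
    using coprod_in_in_Hom[OF has_coproduct_degen[OF assms(1)]] assms(2,3) by simp
  have "cube_proj C P n \<cdot> arrmap P (degen n j) = (cube_proj C P n \<cdot> cube_degen_sum C P n) \<cdot> ?i"
    using Comp_assoc[OF i S q] cube_degen_sum_Comp_in[OF assms] by simp
  also have "\<dots> = Zero C (coprod_ob C {1..n} (\<lambda>_. obmap P (n - 1))) (chain_ob (normalized C P) n) \<cdot> ?i"
    using is_cokernelD(3)[OF is_cokernel_cube_proj[OF assms(1), of n]] HomD[OF S]
    by (simp add: normalized_def)
  finally show ?thesis using Zero_Comp[OF i] Hom_Ob[OF q] by simp
qed

text \<open>Criterion for factoring through \<open>cube_proj\<close>: an arrow out of a coproduct
  vanishes once it vanishes on every summand, so each degeneracy is tested alone. The zero arrow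
  starts at \<open>Dom C (cube_degen_sum C P n)\<close> to match the shape of
  \<open>descend_epi_cokernel\<close>.\<close>

lemma Comp_cube_degen_sum_eq_Zero:
  assumes "is_functor (opposite box) C P" "u \<in> Hom C (obmap P n) D"
    and "\<And>j. \<lbrakk>1 \<le> j; j \<le> n\<rbrakk> \<Longrightarrow> u \<cdot> arrmap P (degen n j) = Zero C (obmap P (n - 1)) D"
  shows "u \<cdot> cube_degen_sum C P n = Zero C (Dom C (cube_degen_sum C P n)) D"
proof (rule coprod_cancel[OF has_coproduct_degen[OF assms(1), of n]])
  note S = cube_degen_sum_in_Hom[OF assms(1), of n]
  show "u \<cdot> cube_degen_sum C P n \<in> Hom C (coprod_ob C {1..n} (\<lambda>_. obmap P (n - 1))) D"
    using Comp_in_Hom[OF S assms(2)] .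
  show "Zero C (Dom C (cube_degen_sum C P n)) D \<in> Hom C (coprod_ob C {1..n} (\<lambda>_. obmap P (n - 1))) D"
    using Zero_in_Hom Hom_Ob[OF S] Hom_Ob[OF assms(2)] HomD[OF S] by simp
  fix j assume j: "j \<in> {1..n}"
  note i = coprod_in_in_Hom[OF has_coproduct_degen[OF assms(1)] j]
  show "(u \<cdot> cube_degen_sum C P n) \<cdot> coprod_in C {1..n} (\<lambda>_. obmap P (n - 1)) j
      = Zero C (Dom C (cube_degen_sum C P n)) D \<cdot> coprod_in C {1..n} (\<lambda>_. obmap P (n - 1)) j"
    using Comp_assoc[OF i S assms(2)] cube_degen_sum_Comp_in[OF assms(1)] assms(3) j
      Zero_Comp[OF i] Hom_Ob[OF assms(2)] HomD[OF S] by simp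
qed

text \<open>Every summand of the differential vanishes by itself on a degenerate chain, modulo
  degeneracies: a face in another direction is again degenerate, and in direction j both faces
  restore the original chain, so their difference is zero.\<close>

lemma cube_proj_cube_diff_degen:
  assumes "is_functor (opposite box) C P" "1 \<le> j" "j \<le> Suc n"
  shows "(cube_proj C P n \<cdot> cube_diff C P (Suc n)) \<cdot> arrmap P (degen (Suc n) j)
    = Zero C (obmap P n) (chain_ob (normalized C P) n)"
proof -
  let ?H = "hom_group C (obmap P n) (chain_ob (normalized C P) n)"
  let ?q = "cube_proj C P n" and ?s = "arrmap P (degen (Suc n) j)"
  let ?h = "\<lambda>x. (?q \<cdot> x) \<cdot> ?s"
  note ob = cubical_objectD(1)[OF assms(1)] and q = cube_proj_in_Hom[OF assms(1), of n]
  have s: "?s \<in> Hom C (obmap P n) (obmap P (Suc n))"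
    using arrmap_degen_in_Hom[OF assms] by simp
  have qob: "chain_ob (normalized C P) n \<in> Ob C" using Hom_Ob[OF q] by blast
  interpret H: comm_group ?H using comm_group_hom ob qob by blast
  have f: "arrmap P (face (Suc n) i \<epsilon>) \<in> Hom C (obmap P (Suc n)) (obmap P n)"
    if "1 \<le> i" "i \<le> Suc n" for i \<epsilon>
    using arrmap_face_in_Hom[OF assms(1) that] by simp
  have hom: "?h \<in> hom (hom_group C (obmap P (Suc n)) (obmap P n)) ?H"
    using Comp_Comp_hom[OF q s] .
  have deg: "?h (arrmap P (face (Suc n) i \<epsilon>)) = \<one>\<^bsub>?H\<^esub>"
    if i: "1 \<le> i" "i \<le> Suc n" "i \<noteq> j" for i \<epsilon>
  proof -
    \<comment> \<open>In both cases of the exchange law the larger of the two indices drops by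
      one.\<close>
    obtain i' j' where ij': "1 \<le> i'" "i' \<le> n" "1 \<le> j'" "j' \<le> n"
      and eq: "degen (Suc n) j \<cdot>\<^bsub>box\<^esub> face (Suc n) i \<epsilon> = face n i' \<epsilon> \<cdot>\<^bsub>box\<^esub> degen n j'"
    proof (cases "i < j")
      case True
      thus ?thesis using that[of i "j - 1"] degen_face_less[of i j n] i assms(3) by simp
    next
      case False
      hence "j < i" using i by simp
      thus ?thesis using that[of "i - 1" j] degen_face_greater[of j i n] i assms(2) by simp
    qed
    have b: "degen (Suc n) j \<in> Hom box (Suc n) n" "face (Suc n) i \<epsilon> \<in> Hom box n (Suc n)"
      using degen_in_Hom[OF assms(2,3)] face_in_Hom[OF i(1,2)] by simp_all
    note b' = degen_in_Hom[OF ij'(3,4)] face_in_Hom[OF ij'(1,2)]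
    note m = cubical_objectD(2)[OF assms(1) b'(1)] cubical_objectD(2)[OF assms(1) b'(2)]
    have "arrmap P (face (Suc n) i \<epsilon>) \<cdot> ?s = arrmap P (degen n j') \<cdot> arrmap P (face n i' \<epsilon>)"
      using cubical_objectD(4)[OF assms(1) b(2,1)] cubical_objectD(4)[OF assms(1) b'] eq by simp
    hence "?h (arrmap P (face (Suc n) i \<epsilon>)) = (?q \<cdot> arrmap P (degen n j')) \<cdot> arrmap P (face n i' \<epsilon>)"
      by (simp flip: Comp_assoc[OF s f[OF i(1,2)] q] Comp_assoc[OF m(2,1) q])
    thus ?thesis
      using cube_proj_Comp_degen[OF assms(1) ij'(3,4)] Zero_Comp[OF m(2) qob] by simp
  qed
  have c: "?h (arrmap P (face (Suc n) i \<epsilon>)) \<in> carrier ?H" if "1 \<le> i" "i \<le> Suc n" for i \<epsilon>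
    using hom_in_carrier[OF hom] f[OF that] by simp
  have same: "?h (arrmap P (face (Suc n) j \<epsilon>)) = ?q" for \<epsilon>
  proof -
    have b: "degen (Suc n) j \<in> Hom box (Suc n) n" "face (Suc n) j \<epsilon> \<in> Hom box n (Suc n)"
      using degen_in_Hom[OF assms(2,3)] face_in_Hom[OF assms(2,3)] by simp_all
    have "arrmap P (face (Suc n) j \<epsilon>) \<cdot> ?s = Ide C (obmap P n)"
      using cubical_objectD(4)[OF assms(1) b(2,1)] cubical_objectD(3)[OF assms(1)]
        degen_face_same[OF assms(2,3)] by simp
    thus ?thesis using Comp_assoc[OF s f[OF assms(2,3)] q, symmetric] Comp_Ide[OF q] by simp
  qed
  have "?h (cube_diff C P (Suc n)) = (\<Otimes>\<^bsub>?H\<^esub>i\<in>{1..Suc n}.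
      (?h (arrmap P (face (Suc n) i False)) \<otimes>\<^bsub>?H\<^esub> inv\<^bsub>?H\<^esub> ?h (arrmap P (face (Suc n) i True)))
        [^]\<^bsub>?H\<^esub> ((- 1) ^ i :: int))"
    by (rule hom_cube_diff[where h="?h", OF assms(1) ob qob]) (use hom in simp)
  also have "\<dots> = \<one>\<^bsub>?H\<^esub>"
  proof (rule H.finprod_one_eqI)
    fix i assume "i \<in> {1..Suc n}"
    hence i: "1 \<le> i" "i \<le> Suc n" by auto
    \<comment> \<open>The common value is zero for i other than j and \<open>?q\<close> for i = j;
      the equality of the two ends is what makes the summand the unit.\<close>
    have "?h (arrmap P (face (Suc n) i False)) = ?h (arrmap P (face (Suc n) i True))"
      using deg[OF i] same by (cases "i = j") simp_all
    thus "(?h (arrmap P (face (Suc n) i False)) \<otimes>\<^bsub>?H\<^esub> inv\<^bsub>?H\<^esub> ?h (arrmap P (face (Suc n) i True)))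
        [^]\<^bsub>?H\<^esub> ((- 1) ^ i :: int) = \<one>\<^bsub>?H\<^esub>"
      using H.r_inv[OF c[OF i]] H.int_pow_one by simp
  qed
  finally show ?thesis by simp
qed

lemma normalized_bdry:
  assumes "is_functor (opposite box) C P"
  shows normalized_bdry_in_Hom: "bdry (normalized C P) n
      \<in> Hom C (chain_ob (normalized C P) (Suc n)) (chain_ob (normalized C P) n)"
    and normalized_bdry_Comp_proj: "bdry (normalized C P) n \<cdot> cube_proj C P (Suc n)
      = cube_proj C P n \<cdot> cube_diff C P (Suc n)"
proof -
  note S = HomD[OF cube_degen_sum_in_Hom[OF assms, of "Suc n"]]
  have qd: "cube_proj C P n \<cdot> cube_diff C P (Suc n)
      \<in> Hom C (obmap P (Suc n)) (chain_ob (normalized C P) n)"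
    using Comp_in_Hom[OF cube_diff_in_Hom[OF assms, of "Suc n"]] cube_proj_in_Hom[OF assms, of n]
    by simp
  have "(cube_proj C P n \<cdot> cube_diff C P (Suc n)) \<cdot> cube_degen_sum C P (Suc n)
      = Zero C (Dom C (cube_degen_sum C P (Suc n))) (chain_ob (normalized C P) n)"
    using cube_proj_cube_diff_degen[OF assms] by (intro Comp_cube_degen_sum_eq_Zero[OF assms qd]) simp
  from descend_epi_cokernel[OF is_cokernel_cube_proj[OF assms, of "Suc n"] _ this]
  show "bdry (normalized C P) n
      \<in> Hom C (chain_ob (normalized C P) (Suc n)) (chain_ob (normalized C P) n)"
    "bdry (normalized C P) n \<cdot> cube_proj C P (Suc n) = cube_proj C P n \<cdot> cube_diff C P (Suc n)"
    using S qd by (simp_all add: normalized_def)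
qed

lemma cube_proj_cancel:
  assumes "is_functor (opposite box) C P"
    and "u \<in> Hom C (chain_ob (normalized C P) n) D" "v \<in> Hom C (chain_ob (normalized C P) n) D"
    and "u \<cdot> cube_proj C P n = v \<cdot> cube_proj C P n"
  shows "u = v"
  using cokernel_cancel[OF is_cokernel_cube_proj[OF assms(1), of n]] assms(2-4)
  by (simp add: normalized_def)

text \<open>\<open>cube_proj\<close> is epic, so the square of the boundary is computed before
  passing to the quotient.\<close>

lemma is_complex_normalized:
  assumes "is_functor (opposite box) C P"
  shows "is_complex C (normalized C P)"
  unfolding is_complex_def
proof (intro conjI allI)
  fix n
  let ?K = "normalized C P"
  note b = normalized_bdry_in_Hom[OF assms] and bq = normalized_bdry_Comp_proj[OF assms]
  note q = cube_proj_in_Hom[OF assms]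
  show "bdry ?K n \<in> Hom C (chain_ob ?K (Suc n)) (chain_ob ?K n)" by (rule b)
  have d: "cube_diff C P (Suc k) \<in> Hom C (obmap P (Suc k)) (obmap P k)" for k
    using cube_diff_in_Hom[OF assms, of "Suc k"] by simp
  show "bdry ?K n \<cdot> bdry ?K (Suc n) = Zero C (chain_ob ?K (Suc (Suc n))) (chain_ob ?K n)"
  proof (rule cube_proj_cancel[OF assms Comp_in_Hom[OF b b]])
    show "Zero C (chain_ob ?K (Suc (Suc n))) (chain_ob ?K n)
        \<in> Hom C (chain_ob ?K (Suc (Suc n))) (chain_ob ?K n)"
      using Zero_in_Hom Hom_Ob[OF q] by blast
    have "(bdry ?K n \<cdot> bdry ?K (Suc n)) \<cdot> cube_proj C P (Suc (Suc n))
        = (bdry ?K n \<cdot> cube_proj C P (Suc n)) \<cdot> cube_diff C P (Suc (Suc n))"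
      using Comp_assoc[OF q b b] Comp_assoc[OF d q b] bq by simp
    also have "\<dots> = cube_proj C P n \<cdot> Zero C (obmap P (Suc (Suc n))) (obmap P n)"
      using Comp_assoc[OF d d q, symmetric] bq cube_diff_cube_diff[OF assms, of "Suc n"] by simp
    also have "\<dots> = Zero C (chain_ob ?K (Suc (Suc n))) (chain_ob ?K n) \<cdot> cube_proj C P (Suc (Suc n))"
      using Comp_Zero[OF q] Zero_Comp[OF q] Hom_Ob[OF q] cubical_objectD(1)[OF assms] by simp
    finally show "(bdry ?K n \<cdot> bdry ?K (Suc n)) \<cdot> cube_proj C P (Suc (Suc n))
        = Zero C (chain_ob ?K (Suc (Suc n))) (chain_ob ?K n) \<cdot> cube_proj C P (Suc (Suc n))" .
  qed
qed

section \<open>Functoriality of the normalized complex\<close>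

lemma normalized_map_descends:
  assumes "nat_trans (opposite box) C P Q m"
  shows normalized_map_in_Hom: "normalized_map C P Q m n
      \<in> Hom C (chain_ob (normalized C P) n) (chain_ob (normalized C Q) n)"
    and normalized_map_Comp_proj:
      "normalized_map C P Q m n \<cdot> cube_proj C P n = cube_proj C Q n \<cdot> m n"
proof -
  note P = cubical_nat_transD(1)[OF assms] and Q = cubical_nat_transD(2)[OF assms]
  note m = cubical_nat_transD(3)[OF assms] and q = cube_proj_in_Hom[OF Q]
  note S = HomD[OF cube_degen_sum_in_Hom[OF P, of n]]
  have "(cube_proj C Q n \<cdot> m n) \<cdot> arrmap P (degen n j)
      = Zero C (obmap P (n - 1)) (chain_ob (normalized C Q) n)" if "1 \<le> j" "j \<le> n" for j
  proof -
    note s = arrmap_degen_in_Hom[OF P that] arrmap_degen_in_Hom[OF Q that]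
    \<comment> \<open>Naturality of \<open>m\<close> turns a degeneracy of \<open>P\<close> into one
      of \<open>Q\<close>, which the projection of \<open>Q\<close> kills.\<close>
    have "(cube_proj C Q n \<cdot> m n) \<cdot> arrmap P (degen n j)
        = (cube_proj C Q n \<cdot> arrmap Q (degen n j)) \<cdot> m (n - 1)"
      using Comp_assoc[OF s(1) m q] Comp_assoc[OF m s(2) q]
        cubical_nat_transD(4)[OF assms degen_in_Hom[OF that]] by simp
    thus ?thesis
      using cube_proj_Comp_degen[OF Q that] Zero_Comp[OF m] Hom_Ob[OF q] by simp
  qed
  from Comp_cube_degen_sum_eq_Zero[OF P Comp_in_Hom[OF m q] this]
    descend_epi_cokernel[OF is_cokernel_cube_proj[OF P, of n], of "cube_proj C Q n \<cdot> m n"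
      "chain_ob (normalized C Q) n"]
  show "normalized_map C P Q m n
      \<in> Hom C (chain_ob (normalized C P) n) (chain_ob (normalized C Q) n)"
    "normalized_map C P Q m n \<cdot> cube_proj C P n = cube_proj C Q n \<cdot> m n"
    using S Comp_in_Hom[OF m q, of n] by (simp_all add: normalized_map_def normalized_def)
qed

lemma is_chain_map_normalized_map:
  assumes "nat_trans (opposite box) C P Q m"
  shows "is_chain_map C (normalized C P) (normalized C Q) (normalized_map C P Q m)"
  unfolding is_chain_map_def
proof (intro conjI allI)
  fix n
  let ?K = "normalized C P" and ?L = "normalized C Q" and ?\<phi> = "normalized_map C P Q m"
  note P = cubical_nat_transD(1)[OF assms] and Q = cubical_nat_transD(2)[OF assms]
  note m = cubical_nat_transD(3)[OF assms] and q = cube_proj_in_Hom[OF P] cube_proj_in_Hom[OF Q]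
  note b = normalized_bdry_in_Hom[OF P] normalized_bdry_in_Hom[OF Q]
  note \<phi> = normalized_map_in_Hom[OF assms] and \<phi>q = normalized_map_Comp_proj[OF assms]
  have d: "cube_diff C P (Suc n) \<in> Hom C (obmap P (Suc n)) (obmap P n)"
      "cube_diff C Q (Suc n) \<in> Hom C (obmap Q (Suc n)) (obmap Q n)"
    using cube_diff_in_Hom[OF P, of "Suc n"] cube_diff_in_Hom[OF Q, of "Suc n"] by simp_all
  show "?\<phi> n \<in> Hom C (chain_ob ?K n) (chain_ob ?L n)" by (rule \<phi>)
  show "?\<phi> n \<cdot> bdry ?K n = bdry ?L n \<cdot> ?\<phi> (Suc n)"
  proof (rule cube_proj_cancel[OF P Comp_in_Hom[OF b(1) \<phi>] Comp_in_Hom[OF \<phi> b(2)]])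
    have "(?\<phi> n \<cdot> bdry ?K n) \<cdot> cube_proj C P (Suc n)
        = cube_proj C Q n \<cdot> (m n \<cdot> cube_diff C P (Suc n))"
      using Comp_assoc[OF q(1) b(1) \<phi>] Comp_assoc[OF d(1) q(1) \<phi>] Comp_assoc[OF d(1) m q(2)]
        normalized_bdry_Comp_proj[OF P] \<phi>q by simp
    also have "m n \<cdot> cube_diff C P (Suc n) = cube_diff C Q (Suc n) \<cdot> m (Suc n)"
      using cube_diff_natural[OF assms, of "Suc n"] by simp
    also have "cube_proj C Q n \<cdot> \<dots> = (bdry ?L n \<cdot> ?\<phi> (Suc n)) \<cdot> cube_proj C P (Suc n)"
      using Comp_assoc[OF q(1) \<phi> b(2)] Comp_assoc[OF m d(2) q(2)] Comp_assoc[OF m q(2) b(2)]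
        normalized_bdry_Comp_proj[OF Q] \<phi>q by simp
    finally show "(?\<phi> n \<cdot> bdry ?K n) \<cdot> cube_proj C P (Suc n)
        = (bdry ?L n \<cdot> ?\<phi> (Suc n)) \<cdot> cube_proj C P (Suc n)" .
  qed
qed

lemma nat_trans_Comp:
  assumes "nat_trans (opposite box) C P Q l" "nat_trans (opposite box) C Q R m"
  shows "nat_trans (opposite box) C P R (\<lambda>n. m n \<cdot> l n)"
proof -
  interpret L: nat_trans "opposite box" C P Q l by fact
  interpret M: nat_trans "opposite box" C Q R m by fact
  show ?thesis
  proof
    fix n k \<alpha>
    note l = cubical_nat_transD(3)[OF assms(1)] and m = cubical_nat_transD(3)[OF assms(2)]
    show "m n \<cdot> l n \<in> Hom C (obmap P n) (obmap R n)" using Comp_in_Hom[OF l m] .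
    assume \<alpha>: "\<alpha> \<in> Hom (opposite box) n k"
    note p = L.source_functor.arrmap_in_Hom[OF \<alpha>] L.target_functor.arrmap_in_Hom[OF \<alpha>]
      M.target_functor.arrmap_in_Hom[OF \<alpha>]
    show "(m k \<cdot> l k) \<cdot> arrmap P \<alpha> = arrmap R \<alpha> \<cdot> (m n \<cdot> l n)"
      using Comp_assoc[OF p(1) l m] Comp_assoc[OF l p(2) m] Comp_assoc[OF l m p(3)]
        L.naturality[OF \<alpha>] M.naturality[OF \<alpha>] by simp
  qed
qed

lemma normalized_map_Comp:
  assumes "nat_trans (opposite box) C P Q l" "nat_trans (opposite box) C Q R m"
  shows "normalized_map C Q R m n \<cdot> normalized_map C P Q l n
    = normalized_map C P R (\<lambda>n. m n \<cdot> l n) n"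
proof (rule cube_proj_cancel[OF cubical_nat_transD(1)[OF assms(1)]
      Comp_in_Hom[OF normalized_map_in_Hom[OF assms(1)] normalized_map_in_Hom[OF assms(2)]]
      normalized_map_in_Hom[OF nat_trans_Comp[OF assms]]])
  note q = cube_proj_in_Hom[OF cubical_nat_transD(1)[OF assms(1)], of n]
    cube_proj_in_Hom[OF cubical_nat_transD(1)[OF assms(2)], of n]
    cube_proj_in_Hom[OF cubical_nat_transD(2)[OF assms(2)], of n]
  note l = cubical_nat_transD(3)[OF assms(1), of n] and m = cubical_nat_transD(3)[OF assms(2), of n]
  note \<phi> = normalized_map_in_Hom[OF assms(1), of n] normalized_map_in_Hom[OF assms(2), of n]
  show "(normalized_map C Q R m n \<cdot> normalized_map C P Q l n) \<cdot> cube_proj C P n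
      = normalized_map C P R (\<lambda>n. m n \<cdot> l n) n \<cdot> cube_proj C P n"
    using Comp_assoc[OF q(1) \<phi>] Comp_assoc[OF l q(2) \<phi>(2)] Comp_assoc[OF l m q(3)]
      normalized_map_Comp_proj[OF assms(1)] normalized_map_Comp_proj[OF assms(2)]
      normalized_map_Comp_proj[OF nat_trans_Comp[OF assms]] by simp
qed

text \<open>The transformation \<open>k\<close> is arbitrary apart from its component in degree n;
  in this form the lemma applies directly to the composite of two transformations that cancel in
  that degree.\<close>

lemma normalized_map_Ide:
  assumes "nat_trans (opposite box) C P P k" "k n = Ide C (obmap P n)"
  shows "normalized_map C P P k n = Ide C (chain_ob (normalized C P) n)"
proof -
  note P = cubical_nat_transD(1)[OF assms(1)]
  note q = cube_proj_in_Hom[OF P, of n]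
  have "Ide C (chain_ob (normalized C P) n)
      \<in> Hom C (chain_ob (normalized C P) n) (chain_ob (normalized C P) n)"
    using Ide_in_Hom Hom_Ob[OF q] by blast
  from cube_proj_cancel[OF P normalized_map_in_Hom[OF assms(1)] this]
  show ?thesis
    using normalized_map_Comp_proj[OF assms(1), of n] assms(2) Comp_Ide[OF q] Ide_Comp[OF q] by simp
qed

lemma normalized_map_inverse:
  assumes "nat_trans (opposite box) C P Q l" "nat_trans (opposite box) C Q P m"
    and "m n \<cdot> l n = Ide C (obmap P n)"
  shows "normalized_map C Q P m n \<cdot> normalized_map C P Q l n = Ide C (chain_ob (normalized C P) n)"
  using normalized_map_Comp[OF assms(1,2)] normalized_map_Ide[OF nat_trans_Comp[OF assms(1,2)]]
    assms(3) by simp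

end

section \<open>Chains as a cubical object\<close>

text \<open>Arrows of \<open>small_sets\<close> are extensional, so the functor equations turn into
  equations between values on cells.\<close>

lemma cubical_setD:
  assumes "cubical_set X"
  shows "\<lbrakk>\<alpha> \<in> Hom box k n; x \<in> cells X n\<rbrakk> \<Longrightarrow> act X \<alpha> x \<in> cells X k"
    and "x \<in> cells X n \<Longrightarrow> act X (Ide box n) x = x"
    and "\<lbrakk>\<alpha> \<in> Hom box k l; \<beta> \<in> Hom box l n; x \<in> cells X n\<rbrakk>
      \<Longrightarrow> act X (\<beta> \<cdot>\<^bsub>box\<^esub> \<alpha>) x = act X \<alpha> (act X \<beta> x)"
proof -
  interpret is_functor "opposite box" small_sets X
    using assms by (simp add: cubical_set_def)
  have arr: "arrmap X \<alpha> \<in> Hom small_sets (cells X n) (cells X k)" if "\<alpha> \<in> Hom box k n" for \<alpha> k n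
    using arrmap_in_Hom[of \<alpha> n k] that by simp
  show "\<lbrakk>\<alpha> \<in> Hom box k n; x \<in> cells X n\<rbrakk> \<Longrightarrow> act X \<alpha> x \<in> cells X k"
    using arr[of \<alpha> k n] by (auto simp: small_sets_def Hom_def act_def fun_of_def)
  show "x \<in> cells X n \<Longrightarrow> act X (Ide box n) x = x"
    using arrmap_Ide[of n] by (simp add: box_simps(1) small_sets_def act_def fun_of_def)
  show "\<lbrakk>\<alpha> \<in> Hom box k l; \<beta> \<in> Hom box l n; x \<in> cells X n\<rbrakk>
      \<Longrightarrow> act X (\<beta> \<cdot>\<^bsub>box\<^esub> \<alpha>) x = act X \<alpha> (act X \<beta> x)"
    using arrmap_Comp[of \<beta> n l \<alpha> k] arr[of \<beta> l n]
    by (auto simp: small_sets_def Hom_def act_def fun_of_def compose_def)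
qed

lemma cubical_mapD:
  assumes "cubical_map X Y f"
  shows "x \<in> cells X n \<Longrightarrow> fun_of (f n) x \<in> cells Y n"
    and "\<lbrakk>\<alpha> \<in> Hom box k n; x \<in> cells X n\<rbrakk>
      \<Longrightarrow> fun_of (f k) (act X \<alpha> x) = act Y \<alpha> (fun_of (f n) x)"
proof -
  interpret nat_trans "opposite box" small_sets X Y f
    using assms by (simp add: cubical_map_def)
  have f: "f n \<in> Hom small_sets (cells X n) (cells Y n)" for n
    using component[of n] by (simp add: box_simps(1))
  show "x \<in> cells X n \<Longrightarrow> fun_of (f n) x \<in> cells Y n"
    using f[of n] by (auto simp: small_sets_def Hom_def fun_of_def)
  have arr: "arrmap X \<alpha> \<in> Hom small_sets (cells X n) (cells X k)" if "\<alpha> \<in> Hom box k n" for \<alpha> k n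
    using source_functor.arrmap_in_Hom[of \<alpha> n k] that by simp
  show "\<lbrakk>\<alpha> \<in> Hom box k n; x \<in> cells X n\<rbrakk>
      \<Longrightarrow> fun_of (f k) (act X \<alpha> x) = act Y \<alpha> (fun_of (f n) x)"
    using naturality[of \<alpha> n k] arr[of \<alpha> k n] f[of n]
    by (auto simp: small_sets_def Hom_def act_def fun_of_def compose_def dest: fun_cong[of _ _ x])
qed

text \<open>The functor laws on the opposite of the category of elements, read cell by cell. Besides
  being what a functor provides, this is the form in which the direct image is verified.\<close>

locale coefficient_system =
  fixes A :: "('o, 'a, 'z) preadditive_data_scheme"
    and X :: "'u cubical"
    and F :: "('u, 'o, 'a) coeff"
  assumes coeff_ob: "x \<in> cells X n \<Longrightarrow> obmap F (n, x) \<in> Ob A"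
    and coeff_arr: "\<lbrakk>\<alpha> \<in> Hom box k n; x \<in> cells X n\<rbrakk>
      \<Longrightarrow> arrmap F (\<alpha>, x) \<in> Hom A (obmap F (n, x)) (obmap F (k, act X \<alpha> x))"
    and coeff_ide: "x \<in> cells X n \<Longrightarrow> arrmap F (Ide box n, x) = Ide A (obmap F (n, x))"
    and coeff_comp: "\<lbrakk>\<alpha> \<in> Hom box k l; \<beta> \<in> Hom box l n; x \<in> cells X n\<rbrakk>
      \<Longrightarrow> arrmap F (\<beta> \<cdot>\<^bsub>box\<^esub> \<alpha>, x) = arrmap F (\<alpha>, act X \<beta> x) \<cdot>\<^bsub>A\<^esub> arrmap F (\<beta>, x)"

locale coefficient_map = source: coefficient_system A X F + target: coefficient_system A X G
  for A :: "('o, 'a, 'z) preadditive_data_scheme"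
    and X :: "'u cubical"
    and F G :: "('u, 'o, 'a) coeff" +
  fixes \<eta> :: "nat \<times> 'u \<Rightarrow> 'a"
  assumes coeff_component: "x \<in> cells X n \<Longrightarrow> \<eta> (n, x) \<in> Hom A (obmap F (n, x)) (obmap G (n, x))"
    and coeff_natural: "\<lbrakk>\<alpha> \<in> Hom box k n; x \<in> cells X n\<rbrakk>
      \<Longrightarrow> \<eta> (k, act X \<alpha> x) \<cdot>\<^bsub>A\<^esub> arrmap F (\<alpha>, x) = arrmap G (\<alpha>, x) \<cdot>\<^bsub>A\<^esub> \<eta> (n, x)"

lemma elements_simps:
  "(n, x) \<in> Ob (elements X) \<longleftrightarrow> x \<in> cells X n"
  "Ide (elements X) (n, x) = (Ide box n, x)"
  "(\<beta>, y) \<cdot>\<^bsub>elements X\<^esub> (\<alpha>, x) = (\<beta> \<cdot>\<^bsub>box\<^esub> \<alpha>, y)"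
  "(\<alpha>, x) \<in> Hom (elements X) (k, y) (n, z) \<longleftrightarrow> \<alpha> \<in> Hom box k n \<and> x \<in> cells X n \<and> y = act X \<alpha> x \<and> z = x"
  by (auto simp: elements_def Hom_def)

lemma coefficient_system_functor:
  assumes "cubical_set X" "is_functor (opposite (elements X)) A F"
  shows "coefficient_system A X F"
proof -
  interpret is_functor "opposite (elements X)" A F by fact
  show ?thesis
  proof
    fix n x assume x: "x \<in> cells X n"
    show "obmap F (n, x) \<in> Ob A"
      using obmap_in_Ob[of "(n, x)"] x by (simp add: elements_simps)
    show "arrmap F (Ide box n, x) = Ide A (obmap F (n, x))"
      using arrmap_Ide[of "(n, x)"] x by (simp add: elements_simps)
    show "arrmap F (\<alpha>, x) \<in> Hom A (obmap F (n, x)) (obmap F (k, act X \<alpha> x))"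
      if "\<alpha> \<in> Hom box k n" for \<alpha> k
      using arrmap_in_Hom[of "(\<alpha>, x)" "(n, x)" "(k, act X \<alpha> x)"] x that by (simp add: elements_simps)
    show "arrmap F (\<beta> \<cdot>\<^bsub>box\<^esub> \<alpha>, x) = arrmap F (\<alpha>, act X \<beta> x) \<cdot>\<^bsub>A\<^esub> arrmap F (\<beta>, x)"
      if "\<alpha> \<in> Hom box k l" "\<beta> \<in> Hom box l n" for \<alpha> \<beta> k l
      using arrmap_Comp[of "(\<beta>, x)" "(n, x)" "(l, act X \<beta> x)" "(\<alpha>, act X \<beta> x)"
          "(k, act X \<alpha> (act X \<beta> x))"] x that cubical_setD(1)[OF assms(1)]
      by (simp add: elements_simps)
  qed
qed

lemma coefficient_map_nat_trans:
  assumes "cubical_set X" "nat_trans (opposite (elements X)) A F G \<eta>"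
  shows "coefficient_map A X F G \<eta>"
proof -
  interpret nat_trans "opposite (elements X)" A F G \<eta> by fact
  interpret source: coefficient_system A X F
    by (rule coefficient_system_functor[OF assms(1)]) unfold_locales
  interpret target: coefficient_system A X G
    by (rule coefficient_system_functor[OF assms(1)]) unfold_locales
  show ?thesis
  proof
    fix n x assume x: "x \<in> cells X n"
    show "\<eta> (n, x) \<in> Hom A (obmap F (n, x)) (obmap G (n, x))"
      using component[of "(n, x)"] x by (simp add: elements_simps)
    show "\<eta> (k, act X \<alpha> x) \<cdot>\<^bsub>A\<^esub> arrmap F (\<alpha>, x) = arrmap G (\<alpha>, x) \<cdot>\<^bsub>A\<^esub> \<eta> (n, x)"
      if "\<alpha> \<in> Hom box k n" for \<alpha> k
      using naturality[of "(\<alpha>, x)" "(n, x)" "(k, act X \<alpha> x)"] x that by (simp add: elements_simps)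
  qed
qed

text \<open>Contravariance puts \<open>Cod box \<alpha>\<close> at the source of the induced arrow
  of chains.\<close>

definition chain_functor ::
  "('o, 'a, 'z) preadditive_data_scheme \<Rightarrow> 'u cubical \<Rightarrow> ('u, 'o, 'a) coeff
    \<Rightarrow> (nat, box_arrow, 'o, 'a) functor_data" where
  "chain_functor A X F =
     \<lparr>obmap = chains A X F,
      arrmap = (\<lambda>\<alpha>. reindex_map A
        (cells X (Cod box \<alpha>)) (\<lambda>x. obmap F (Cod box \<alpha>, x))
        (cells X (Dom box \<alpha>)) (\<lambda>x. obmap F (Dom box \<alpha>, x))
        (act X \<alpha>) (\<lambda>x. arrmap F (\<alpha>, x)))\<rparr>"

definition chain_map ::
  "('o, 'a, 'z) preadditive_data_scheme \<Rightarrow> 'u cubical \<Rightarrow> ('u, 'o, 'a) coeff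
    \<Rightarrow> ('u, 'o, 'a) coeff \<Rightarrow> (nat \<times> 'u \<Rightarrow> 'a) \<Rightarrow> nat \<Rightarrow> 'a" where
  "chain_map A X F G \<eta> n =
     coprod_map A (cells X n) (\<lambda>x. obmap F (n, x)) (\<lambda>x. obmap G (n, x)) (\<lambda>x. \<eta> (n, x))"

lemma arrmap_chain_functor:
  "\<alpha> \<in> Hom box k n \<Longrightarrow> arrmap (chain_functor A X F) \<alpha> = reindex_map A
    (cells X n) (\<lambda>x. obmap F (n, x)) (cells X k) (\<lambda>x. obmap F (k, x)) (act X \<alpha>) (\<lambda>x. arrmap F (\<alpha>, x))"
  by (auto simp: chain_functor_def Hom_def)

lemma obmap_chain_functor:
  "obmap (chain_functor A X F) n = coprod_ob A (cells X n) (\<lambda>x. obmap F (n, x))"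
  by (simp add: chain_functor_def chains_def)

section \<open>Agreement with the definitions of the homology\<close>

lemma face_op_eq_arrmap: "face_op A X F n i \<epsilon> = arrmap (chain_functor A X F) (face n i \<epsilon>)"
proof -
  have "fst (face n i \<epsilon>) = n - 1" "snd (snd (face n i \<epsilon>)) = n" by (simp_all add: face_def)
  thus ?thesis by (simp add: face_op_def chain_functor_def reindex_map_def chains_def box_simps)
qed

lemma degen_op_eq_arrmap: "degen_op A X F n i = arrmap (chain_functor A X F) (degen n i)"
proof -
  have "fst (degen n i) = n" "snd (snd (degen n i)) = n - 1" by (simp_all add: degen_def)
  thus ?thesis by (simp add: degen_op_def chain_functor_def reindex_map_def chains_def box_simps)
qed

lemma normal_proj_eq_cube_proj: "normal_proj A X F n = cube_proj A (chain_functor A X F) n"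
  by (simp add: normal_proj_def cube_proj_def degen_sum_def cube_degen_sum_def
      degen_op_eq_arrmap[abs_def] chains_def obmap_chain_functor)

lemma chain_diff_eq_cube_diff: "chain_diff A X F n = cube_diff A (chain_functor A X F) n"
  by (simp add: chain_diff_def cube_diff_def face_difference_def Let_def face_op_eq_arrmap
      chains_def obmap_chain_functor)

text \<open>The two constructions coincide literally, choices included, since faces and degeneracies
  of chains are values of \<open>chain_functor\<close>; results about \<open>normalized\<close> thus
  transfer by rewriting.\<close>

lemma normal_chains_eq_normalized: "normal_chains A X F = normalized A (chain_functor A X F)"
  by (simp add: normal_chains_def normalized_def normal_proj_eq_cube_proj chain_diff_eq_cube_diff)

lemma normal_chains_map_eq_normalized_map:
  "normal_chains_map A X F G \<eta>
    = normalized_map A (chain_functor A X F) (chain_functor A X G) (chain_map A X F G \<eta>)"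
  by (rule ext) (simp add: normal_chains_map_def normalized_map_def normal_proj_eq_cube_proj
      chain_map_def)

text \<open>The index type is fixed by a type token, as in \<open>AB4_category\<close>; sets of
  cells and fibres are sets over this type, so the coproducts over them exist.\<close>

locale category_with_coproducts = abelian_category C
  for C :: "('o, 'a, 'z) preadditive_data_scheme" (structure) +
  fixes small :: "'u itself"
  assumes small_coproducts: "\<forall>i\<in>I. B i \<in> Ob C \<Longrightarrow> has_coproduct C (I :: 'u set) B"
begin

text \<open>The subset \<open>I\<close> is the whole set of n-cells for chains and a fibre for the
  direct image.\<close>

lemma has_coproduct_cells:
  assumes "coefficient_system C (X :: 'u cubical) F" "I \<subseteq> cells X n"
  shows "has_coproduct C I (\<lambda>x. obmap F (n, x))"
  by (rule small_coproducts) (use coefficient_system.coeff_ob[OF assms(1)] assms(2) in auto)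

lemma is_functor_chain_functor:
  fixes X :: "'u cubical"
  assumes "cubical_set X" "coefficient_system C X F"
  shows "is_functor (opposite box) C (chain_functor C X F)"
proof -
  interpret X: is_functor "opposite box" small_sets X
    using assms(1) by (simp add: cubical_set_def)
  interpret F: coefficient_system C X F by fact
  note cop = has_coproduct_cells[OF assms(2) subset_refl]
  note X = cubical_setD[OF assms(1)]
  show ?thesis
  proof
    fix n k l \<alpha> \<beta>
    show "obmap (chain_functor C X F) n \<in> Ob C"
      using coprod_ob_in_Ob[OF cop] by (simp add: obmap_chain_functor)
    show "arrmap (chain_functor C X F) (Ide (opposite box) n) = Ide C (obmap (chain_functor C X F) n)"
    proof -
      have "Ide box n \<in> Hom box n n"
        using X.source.Ide_in_Hom[of n] by (simp add: box_simps(1))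
      thus ?thesis
        unfolding opposite_simps obmap_chain_functor arrmap_chain_functor[OF \<open>Ide box n \<in> Hom box n n\<close>]
        by (intro reindex_map_Ide[OF cop]) (use X(2) F.coeff_ide in auto)
    qed
    show "arrmap (chain_functor C X F) \<alpha>
        \<in> Hom C (obmap (chain_functor C X F) n) (obmap (chain_functor C X F) k)"
      if "\<alpha> \<in> Hom (opposite box) n k"
    proof -
      have \<alpha>: "\<alpha> \<in> Hom box k n" using that by simp
      show ?thesis
        unfolding arrmap_chain_functor[OF \<alpha>] obmap_chain_functor
        by (rule reindex_map_in_Hom[OF cop cop]) (use X(1)[OF \<alpha>] F.coeff_arr[OF \<alpha>] in auto)
    qed
    show "arrmap (chain_functor C X F) (\<alpha> \<cdot>\<^bsub>opposite box\<^esub> \<beta>)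
        = arrmap (chain_functor C X F) \<alpha> \<cdot> arrmap (chain_functor C X F) \<beta>"
      if "\<beta> \<in> Hom (opposite box) n l" "\<alpha> \<in> Hom (opposite box) l k"
    proof -
      have b: "\<alpha> \<in> Hom box k l" "\<beta> \<in> Hom box l n" using that by simp_all
      have c: "\<beta> \<cdot>\<^bsub>box\<^esub> \<alpha> \<in> Hom box k n"
        using X.source.Comp_in_Hom[OF that] by simp
      show ?thesis
        unfolding opposite_simps arrmap_chain_functor[OF b(1)] arrmap_chain_functor[OF b(2)]
          arrmap_chain_functor[OF c]
        by (rule reindex_map_Comp[symmetric, OF cop cop cop])
          (use X(1)[OF b(1)] X(1)[OF b(2)] X(3)[OF b] F.coeff_arr[OF b(1)] F.coeff_arr[OF b(2)]
            F.coeff_comp[OF b] in auto)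
    qed
  qed
qed

lemma nat_trans_chain_map:
  fixes X :: "'u cubical"
  assumes "cubical_set X" "coefficient_map C X F G \<eta>"
  shows "nat_trans (opposite box) C (chain_functor C X F) (chain_functor C X G) (chain_map C X F G \<eta>)"
proof -
  interpret coefficient_map C X F G \<eta> by fact
  have FG: "coefficient_system C X F" "coefficient_system C X G" by unfold_locales
  interpret P: is_functor "opposite box" C "chain_functor C X F"
    by (rule is_functor_chain_functor[OF assms(1) FG(1)])
  interpret Q: is_functor "opposite box" C "chain_functor C X G"
    by (rule is_functor_chain_functor[OF assms(1) FG(2)])
  note cop = has_coproduct_cells[OF FG(1) subset_refl] has_coproduct_cells[OF FG(2) subset_refl]
  note X = cubical_setD[OF assms(1)]
  show ?thesis
  proof
    fix n k \<alpha>
    show "chain_map C X F G \<eta> n \<in> Hom C (obmap (chain_functor C X F) n) (obmap (chain_functor C X G) n)"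
      unfolding chain_map_def coprod_map_eq_reindex_map obmap_chain_functor
      using cop coeff_component by (intro reindex_map_in_Hom) auto
    assume "\<alpha> \<in> Hom (opposite box) n k"
    hence \<alpha>: "\<alpha> \<in> Hom box k n" by simp
    \<comment> \<open>Common value of the two composites: the index map is the action of
      \<open>\<alpha>\<close>, and on each summand stands one side of the naturality of
      \<open>\<eta>\<close>.\<close>
    let ?r = "reindex_map C (cells X n) (\<lambda>x. obmap F (n, x)) (cells X k) (\<lambda>x. obmap G (k, x))
        (act X \<alpha>) (\<lambda>x. arrmap G (\<alpha>, x) \<cdot> \<eta> (n, x))"
    have "chain_map C X F G \<eta> k \<cdot> arrmap (chain_functor C X F) \<alpha> = ?r"
      unfolding chain_map_def coprod_map_eq_reindex_map arrmap_chain_functor[OF \<alpha>]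
      by (rule reindex_map_Comp[OF cop(1) cop(1) cop(2)])
        (use X(1)[OF \<alpha>] source.coeff_arr[OF \<alpha>] coeff_component coeff_natural[OF \<alpha>] in auto)
    moreover have "arrmap (chain_functor C X G) \<alpha> \<cdot> chain_map C X F G \<eta> n = ?r"
      unfolding chain_map_def coprod_map_eq_reindex_map arrmap_chain_functor[OF \<alpha>]
      by (rule reindex_map_Comp[OF cop(1) cop(2) cop(2)])
        (use X(1)[OF \<alpha>] target.coeff_arr[OF \<alpha>] coeff_component in auto)
    ultimately show "chain_map C X F G \<eta> k \<cdot> arrmap (chain_functor C X F) \<alpha>
        = arrmap (chain_functor C X G) \<alpha> \<cdot> chain_map C X F G \<eta> n" by simp
  qed
qed

end

section \<open>Comparison with the direct image\<close>

text \<open>Written as a \<open>reindex_map\<close> so that naturality, both in the cube arrow and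
  in the coefficients, follows from the composition law.\<close>

definition compare_chains ::
  "('o, 'a, 'z) preadditive_data_scheme \<Rightarrow> 'u cubical \<Rightarrow> 'u cubical \<Rightarrow> (nat \<Rightarrow> 'u set_arrow)
    \<Rightarrow> ('u, 'o, 'a) coeff \<Rightarrow> nat \<Rightarrow> 'a" where
  "compare_chains A X Y f F n =
     reindex_map A (cells X n) (\<lambda>x. obmap F (n, x))
       (cells Y n) (\<lambda>y. obmap (direct_image A X Y f F) (n, y)) (fun_of (f n))
       (\<lambda>x. coprod_in A (fibre X f n (fun_of (f n) x)) (\<lambda>x. obmap F (n, x)) x)"

text \<open>An arrow out of a coproduct of coproducts, hence an iterated \<open>copair\<close>. Each
  inner arrow spreads over many summands of the chains, so this is not presented as a
  \<open>reindex_map\<close>.\<close>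

definition compare_chains_inv ::
  "('o, 'a, 'z) preadditive_data_scheme \<Rightarrow> 'u cubical \<Rightarrow> 'u cubical \<Rightarrow> (nat \<Rightarrow> 'u set_arrow)
    \<Rightarrow> ('u, 'o, 'a) coeff \<Rightarrow> nat \<Rightarrow> 'a" where
  "compare_chains_inv A X Y f F n =
     copair A (cells Y n) (\<lambda>y. obmap (direct_image A X Y f F) (n, y)) (chains A X F n)
       (\<lambda>y. copair A (fibre X f n y) (\<lambda>x. obmap F (n, x)) (chains A X F n) (chains_in A X F n))"

lemma obmap_direct_image:
  "obmap (direct_image A X Y f F) (n, y) = coprod_ob A (fibre X f n y) (\<lambda>x. obmap F (n, x))"
  by (simp add: direct_image_def Let_def)

text \<open>For a genuine cube arrow the source and target in \<open>elements Y\<close> become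
  explicit, and the arrow of the direct image takes the shape to which the composition law
  applies.\<close>

lemma arrmap_direct_image:
  "\<alpha> \<in> Hom box k n \<Longrightarrow> arrmap (direct_image A X Y f F) (\<alpha>, y) = reindex_map A
    (fibre X f n y) (\<lambda>x. obmap F (n, x)) (fibre X f k (act Y \<alpha> y)) (\<lambda>x. obmap F (k, x))
    (act X \<alpha>) (\<lambda>x. arrmap F (\<alpha>, x))"
  by (auto simp: direct_image_def Let_def reindex_map_def elements_def Hom_def)

lemma fibre_subset: "fibre X f n y \<subseteq> cells X n"
  by (auto simp: fibre_def)

lemma act_in_fibre:
  assumes "cubical_set X" "cubical_map X Y f" "\<alpha> \<in> Hom box k n" "x \<in> fibre X f n y"
  shows "act X \<alpha> x \<in> fibre X f k (act Y \<alpha> y)"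
  using assms(4) cubical_setD(1)[OF assms(1,3)] cubical_mapD(2)[OF assms(2,3)]
  by (auto simp: fibre_def)

context category_with_coproducts
begin

lemma has_coproduct_fibre:
  "coefficient_system C (X :: 'u cubical) F \<Longrightarrow> has_coproduct C (fibre X f n y) (\<lambda>x. obmap F (n, x))"
  by (rule has_coproduct_cells[OF _ fibre_subset])

lemma coefficient_system_direct_image:
  fixes X Y :: "'u cubical"
  assumes "cubical_set X" "cubical_set Y" "cubical_map X Y f" "coefficient_system C X F"
  shows "coefficient_system C Y (direct_image C X Y f F)"
proof -
  interpret X: is_functor "opposite box" small_sets X
    using assms(1) by (simp add: cubical_set_def)
  interpret F: coefficient_system C X F by fact
  note cop = has_coproduct_fibre[OF assms(4)]
  note X = cubical_setD[OF assms(1)] and fib = act_in_fibre[OF assms(1,3)]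
  have cell: "x \<in> cells X n" if "x \<in> fibre X f n y" for n x y
    using that fibre_subset by fast
  show ?thesis
  proof
    fix n y assume y: "y \<in> cells Y n"
    show "obmap (direct_image C X Y f F) (n, y) \<in> Ob C"
      unfolding obmap_direct_image by (rule coprod_ob_in_Ob[OF cop])
    show "arrmap (direct_image C X Y f F) (\<alpha>, y)
        \<in> Hom C (obmap (direct_image C X Y f F) (n, y)) (obmap (direct_image C X Y f F) (k, act Y \<alpha> y))"
      if "\<alpha> \<in> Hom box k n" for \<alpha> k
      unfolding obmap_direct_image arrmap_direct_image[OF that]
      by (rule reindex_map_in_Hom[OF cop cop]) (use fib[OF that] F.coeff_arr[OF that cell] in auto)
    show "arrmap (direct_image C X Y f F) (Ide box n, y) = Ide C (obmap (direct_image C X Y f F) (n, y))"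
    proof -
      have "Ide box n \<in> Hom box n n"
        using X.source.Ide_in_Hom[of n] by (simp add: box_simps(1))
      \<comment> \<open>The target is indexed by the fibre over \<open>act Y (Ide box n) y\<close>;
        the identity law of \<open>Y\<close> turns this into the fibre over y, so that source and
        target are the same chosen coproduct.\<close>
      thus ?thesis
        unfolding obmap_direct_image arrmap_direct_image[OF \<open>Ide box n \<in> Hom box n n\<close>]
          cubical_setD(2)[OF assms(2) y]
        by (intro reindex_map_Ide[OF cop]) (use X(2)[OF cell] F.coeff_ide[OF cell] in auto)
    qed
    show "arrmap (direct_image C X Y f F) (\<beta> \<cdot>\<^bsub>box\<^esub> \<alpha>, y)
        = arrmap (direct_image C X Y f F) (\<alpha>, act Y \<beta> y) \<cdot> arrmap (direct_image C X Y f F) (\<beta>, y)"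
      if b: "\<alpha> \<in> Hom box k l" "\<beta> \<in> Hom box l n" for \<alpha> \<beta> k l
    proof -
      have c: "\<beta> \<cdot>\<^bsub>box\<^esub> \<alpha> \<in> Hom box k n"
        using X.source.Comp_in_Hom[of \<beta> n l \<alpha> k] b by simp
      show ?thesis
        unfolding arrmap_direct_image[OF b(1)] arrmap_direct_image[OF b(2)] arrmap_direct_image[OF c]
          cubical_setD(3)[OF assms(2) b y]
        by (rule reindex_map_Comp[symmetric, OF cop cop cop])
          (use X(3)[OF b cell] fib[OF b(1)] fib[OF b(2)] F.coeff_arr[OF b(1) cell]
            F.coeff_arr[OF b(2) cell] F.coeff_comp[OF b cell] in auto)
    qed
  qed
qed

lemma coefficient_map_direct_image:
  fixes X Y :: "'u cubical"
  assumes "cubical_set X" "cubical_set Y" "cubical_map X Y f" "coefficient_map C X F G \<eta>"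
  shows "coefficient_map C Y (direct_image C X Y f F) (direct_image C X Y f G)
    (direct_image_map C X f F G \<eta>)"
proof -
  interpret coefficient_map C X F G \<eta> by fact
  have FG: "coefficient_system C X F" "coefficient_system C X G" by unfold_locales
  interpret F': coefficient_system C Y "direct_image C X Y f F"
    by (rule coefficient_system_direct_image[OF assms(1-3) FG(1)])
  interpret G': coefficient_system C Y "direct_image C X Y f G"
    by (rule coefficient_system_direct_image[OF assms(1-3) FG(2)])
  note cop = has_coproduct_fibre[OF FG(1)] has_coproduct_fibre[OF FG(2)]
  note fib = act_in_fibre[OF assms(1,3)]
  have cell: "x \<in> cells X n" if "x \<in> fibre X f n y" for n x y
    using that fibre_subset by fast
  show ?thesis
  proof
    fix n y assume y: "y \<in> cells Y n"
    show "direct_image_map C X f F G \<eta> (n, y)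
        \<in> Hom C (obmap (direct_image C X Y f F) (n, y)) (obmap (direct_image C X Y f G) (n, y))"
      unfolding direct_image_map_def obmap_direct_image coprod_map_eq_reindex_map split_conv
      by (rule reindex_map_in_Hom[OF cop]) (use coeff_component[OF cell] in auto)
    fix \<alpha> k assume \<alpha>: "\<alpha> \<in> Hom box k n"
    let ?r = "reindex_map C (fibre X f n y) (\<lambda>x. obmap F (n, x))
        (fibre X f k (act Y \<alpha> y)) (\<lambda>x. obmap G (k, x)) (act X \<alpha>) (\<lambda>x. arrmap G (\<alpha>, x) \<cdot> \<eta> (n, x))"
    have "direct_image_map C X f F G \<eta> (k, act Y \<alpha> y) \<cdot> arrmap (direct_image C X Y f F) (\<alpha>, y) = ?r"
      unfolding direct_image_map_def coprod_map_eq_reindex_map arrmap_direct_image[OF \<alpha>] split_conv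
      by (rule reindex_map_Comp[OF cop(1) cop(1) cop(2)])
        (use fib[OF \<alpha>] source.coeff_arr[OF \<alpha> cell] coeff_component[OF cell]
          coeff_natural[OF \<alpha> cell] in auto)
    moreover have "arrmap (direct_image C X Y f G) (\<alpha>, y) \<cdot> direct_image_map C X f F G \<eta> (n, y) = ?r"
      unfolding direct_image_map_def coprod_map_eq_reindex_map arrmap_direct_image[OF \<alpha>] split_conv
      by (rule reindex_map_Comp[OF cop(1) cop(2) cop(2)])
        (use fib[OF \<alpha>] target.coeff_arr[OF \<alpha> cell] coeff_component[OF cell] in auto)
    ultimately show "direct_image_map C X f F G \<eta> (k, act Y \<alpha> y) \<cdot> arrmap (direct_image C X Y f F) (\<alpha>, y)
        = arrmap (direct_image C X Y f G) (\<alpha>, y) \<cdot> direct_image_map C X f F G \<eta> (n, y)" by simp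
  qed
qed

section \<open>The comparison of chains and its inverse\<close>

lemma compare_chains:
  fixes X Y :: "'u cubical"
  assumes "cubical_map X Y f" "coefficient_system C X F"
    and "coefficient_system C Y (direct_image C X Y f F)"
  shows compare_chains_in_Hom: "compare_chains C X Y f F n
      \<in> Hom C (chains C X F n) (chains C Y (direct_image C X Y f F) n)"
    and compare_chains_Comp_in: "x \<in> cells X n \<Longrightarrow>
      compare_chains C X Y f F n \<cdot> chains_in C X F n x
      = chains_in C Y (direct_image C X Y f F) n (fun_of (f n) x) \<cdot>
          coprod_in C (fibre X f n (fun_of (f n) x)) (\<lambda>x. obmap F (n, x)) x"
proof -
  have j: "coprod_in C (fibre X f n (fun_of (f n) x)) (\<lambda>x. obmap F (n, x)) x
      \<in> Hom C (obmap F (n, x)) (obmap (direct_image C X Y f F) (n, fun_of (f n) x))"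
    if "x \<in> cells X n" for x
    unfolding obmap_direct_image
    using coprod_in_in_Hom[OF has_coproduct_fibre[OF assms(2)]] that by (simp add: fibre_def)
  note R = reindex_map_in[OF has_coproduct_cells[OF assms(2) subset_refl]
      has_coproduct_cells[OF assms(3) subset_refl] cubical_mapD(1)[OF assms(1)] j]
  show "compare_chains C X Y f F n \<in> Hom C (chains C X F n) (chains C Y (direct_image C X Y f F) n)"
    unfolding compare_chains_def chains_def using R(1) by blast
  show "compare_chains C X Y f F n \<cdot> chains_in C X F n x
      = chains_in C Y (direct_image C X Y f F) n (fun_of (f n) x) \<cdot>
          coprod_in C (fibre X f n (fun_of (f n) x)) (\<lambda>x. obmap F (n, x)) x"
    if "x \<in> cells X n"
    unfolding compare_chains_def using R(2) that by blast
qed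

lemma compare_chains_inv:
  fixes X Y :: "'u cubical"
  assumes "coefficient_system C X F" "coefficient_system C Y (direct_image C X Y f F)"
  shows compare_chains_inv_in_Hom: "compare_chains_inv C X Y f F n
      \<in> Hom C (chains C Y (direct_image C X Y f F) n) (chains C X F n)"
    and compare_chains_inv_Comp_in: "\<lbrakk>y \<in> cells Y n; x \<in> fibre X f n y\<rbrakk> \<Longrightarrow>
      (compare_chains_inv C X Y f F n \<cdot> chains_in C Y (direct_image C X Y f F) n y) \<cdot>
        coprod_in C (fibre X f n y) (\<lambda>x. obmap F (n, x)) x = chains_in C X F n x"
proof -
  note cX = has_coproduct_cells[OF assms(1) subset_refl, of n]
    and cY = has_coproduct_cells[OF assms(2) subset_refl, of n]
    and cf = has_coproduct_fibre[OF assms(1), of f n]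
  have ob: "chains C X F n \<in> Ob C" unfolding chains_def by (rule coprod_ob_in_Ob[OF cX])
  have i: "chains_in C X F n x \<in> Hom C (obmap F (n, x)) (chains C X F n)" if "x \<in> fibre X f n y" for x y
    unfolding chains_def using coprod_in_in_Hom[OF cX] that by (simp add: fibre_def)
  let ?g = "\<lambda>y. copair C (fibre X f n y) (\<lambda>x. obmap F (n, x)) (chains C X F n) (chains_in C X F n)"
  have g: "?g y \<in> Hom C (obmap (direct_image C X Y f F) (n, y)) (chains C X F n)" for y
    unfolding obmap_direct_image by (rule copair_in_Hom[OF cf ob i])
  show "compare_chains_inv C X Y f F n
      \<in> Hom C (chains C Y (direct_image C X Y f F) n) (chains C X F n)"
    using copair_in_Hom[OF cY ob g] unfolding compare_chains_inv_def chains_def .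
  show "(compare_chains_inv C X Y f F n \<cdot> chains_in C Y (direct_image C X Y f F) n y) \<cdot>
      coprod_in C (fibre X f n y) (\<lambda>x. obmap F (n, x)) x = chains_in C X F n x"
    if "y \<in> cells Y n" "x \<in> fibre X f n y"
    using copair_Comp_coprod_in[OF cY ob g that(1)] copair_Comp_coprod_in[OF cf ob i that(2)]
    unfolding compare_chains_inv_def by simp
qed

text \<open>Fibres partition the cells. One composite uses that x lies in the fibre over its image,
  the other that every member of the fibre over y is mapped to y.\<close>

lemma compare_chains_inverse:
  fixes X Y :: "'u cubical"
  assumes "cubical_map X Y f" "coefficient_system C X F"
    and "coefficient_system C Y (direct_image C X Y f F)"
  shows "compare_chains_inv C X Y f F n \<cdot> compare_chains C X Y f F n = Ide C (chains C X F n)"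
    and "compare_chains C X Y f F n \<cdot> compare_chains_inv C X Y f F n
      = Ide C (chains C Y (direct_image C X Y f F) n)"
proof -
  let ?F' = "direct_image C X Y f F"
  let ?\<phi> = "compare_chains C X Y f F n" and ?\<psi> = "compare_chains_inv C X Y f F n"
  let ?j = "\<lambda>y. coprod_in C (fibre X f n y) (\<lambda>x. obmap F (n, x))"
  note cX = has_coproduct_cells[OF assms(2) subset_refl, of n]
    and cY = has_coproduct_cells[OF assms(3) subset_refl, of n]
    and cf = has_coproduct_fibre[OF assms(2), of f n]
  note \<phi> = compare_chains_in_Hom[OF assms, of n] and \<psi> = compare_chains_inv_in_Hom[OF assms(2,3), of n]
  have iX: "chains_in C X F n x \<in> Hom C (obmap F (n, x)) (chains C X F n)" if "x \<in> cells X n" for x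
    unfolding chains_def using coprod_in_in_Hom[OF cX that] .
  have iY: "chains_in C Y ?F' n y \<in> Hom C (obmap ?F' (n, y)) (chains C Y ?F' n)" if "y \<in> cells Y n" for y
    unfolding chains_def using coprod_in_in_Hom[OF cY that] .
  have j: "?j y x \<in> Hom C (obmap F (n, x)) (obmap ?F' (n, y))" if "x \<in> fibre X f n y" for x y
    unfolding obmap_direct_image using coprod_in_in_Hom[OF cf that] .
  show "?\<psi> \<cdot> ?\<phi> = Ide C (chains C X F n)"
  proof (rule coprod_cancel[OF cX Comp_in_Hom[OF \<phi> \<psi>, unfolded chains_def[of C X F]]])
    show "Ide C (chains C X F n) \<in> Hom C (coprod_ob C (cells X n) (\<lambda>x. obmap F (n, x))) (coprod_ob C (cells X n) (\<lambda>x. obmap F (n, x)))"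
      using Ide_in_Hom Hom_Ob[OF \<phi>] unfolding chains_def by blast
    fix x assume x: "x \<in> cells X n"
    let ?y = "fun_of (f n) x"
    have y: "?y \<in> cells Y n" "x \<in> fibre X f n ?y"
      using cubical_mapD(1)[OF assms(1) x] x by (simp_all add: fibre_def)
    have "(?\<psi> \<cdot> ?\<phi>) \<cdot> chains_in C X F n x = (?\<psi> \<cdot> chains_in C Y ?F' n ?y) \<cdot> ?j ?y x"
      using Comp_assoc[OF iX[OF x] \<phi> \<psi>] Comp_assoc[OF j[OF y(2)] iY[OF y(1)] \<psi>]
        compare_chains_Comp_in[OF assms x] by simp
    thus "(?\<psi> \<cdot> ?\<phi>) \<cdot> chains_in C X F n x = Ide C (chains C X F n) \<cdot> chains_in C X F n x"
      using compare_chains_inv_Comp_in[OF assms(2,3) y] Ide_Comp[OF iX[OF x]] by simp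
  qed
  show "?\<phi> \<cdot> ?\<psi> = Ide C (chains C Y ?F' n)"
  proof (rule coprod_cancel[OF cY Comp_in_Hom[OF \<psi> \<phi>, unfolded chains_def[of C Y]]])
    have I: "Ide C (chains C Y ?F' n) \<in> Hom C (chains C Y ?F' n) (chains C Y ?F' n)"
      using Ide_in_Hom Hom_Ob[OF \<phi>] by blast
    thus "Ide C (chains C Y ?F' n) \<in> Hom C (coprod_ob C (cells Y n) (\<lambda>y. obmap ?F' (n, y)))
        (coprod_ob C (cells Y n) (\<lambda>y. obmap ?F' (n, y)))"
      unfolding chains_def .
    fix y assume y: "y \<in> cells Y n"
    \<comment> \<open>The summands of the chains of \<open>Y\<close> are coproducts over fibres, so
      a second cancellation tests the equation on each x in the fibre over y.\<close>
    show "(?\<phi> \<cdot> ?\<psi>) \<cdot> chains_in C Y ?F' n y = Ide C (chains C Y ?F' n) \<cdot> chains_in C Y ?F' n y"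
    proof (rule coprod_cancel[OF cf[of y]])
      show "(?\<phi> \<cdot> ?\<psi>) \<cdot> chains_in C Y ?F' n y
          \<in> Hom C (coprod_ob C (fibre X f n y) (\<lambda>x. obmap F (n, x))) (chains C Y ?F' n)"
        unfolding obmap_direct_image[of C X Y f F n y, symmetric]
        by (rule Comp_in_Hom[OF iY[OF y] Comp_in_Hom[OF \<psi> \<phi>]])
      show "Ide C (chains C Y ?F' n) \<cdot> chains_in C Y ?F' n y
          \<in> Hom C (coprod_ob C (fibre X f n y) (\<lambda>x. obmap F (n, x))) (chains C Y ?F' n)"
        unfolding obmap_direct_image[of C X Y f F n y, symmetric]
        by (rule Comp_in_Hom[OF iY[OF y] I])
      fix x assume x: "x \<in> fibre X f n y"
      hence x': "x \<in> cells X n" "fun_of (f n) x = y" by (simp_all add: fibre_def)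
      have "((?\<phi> \<cdot> ?\<psi>) \<cdot> chains_in C Y ?F' n y) \<cdot> ?j y x = ?\<phi> \<cdot> chains_in C X F n x"
        using Comp_assoc[OF iY[OF y] \<psi> \<phi>] Comp_assoc[OF j[OF x] Comp_in_Hom[OF iY[OF y] \<psi>] \<phi>]
          compare_chains_inv_Comp_in[OF assms(2,3) y x] by simp
      also have "\<dots> = chains_in C Y ?F' n y \<cdot> ?j y x"
        using compare_chains_Comp_in[OF assms x'(1)] x'(2) by simp
      finally show "((?\<phi> \<cdot> ?\<psi>) \<cdot> chains_in C Y ?F' n y) \<cdot> ?j y x
          = (Ide C (chains C Y ?F' n) \<cdot> chains_in C Y ?F' n y) \<cdot> ?j y x"
        using Ide_Comp[OF iY[OF y]] by simp
    qed
  qed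
qed

lemma nat_trans_compare_chains:
  fixes X Y :: "'u cubical"
  assumes "cubical_set X" "cubical_set Y" "cubical_map X Y f" "coefficient_system C X F"
  shows "nat_trans (opposite box) C (chain_functor C X F) (chain_functor C Y (direct_image C X Y f F))
    (compare_chains C X Y f F)"
proof -
  let ?F' = "direct_image C X Y f F"
  let ?j = "\<lambda>n y. coprod_in C (fibre X f n y) (\<lambda>x. obmap F (n, x))"
  have F': "coefficient_system C Y ?F'"
    by (rule coefficient_system_direct_image[OF assms])
  interpret P: is_functor "opposite box" C "chain_functor C X F"
    by (rule is_functor_chain_functor[OF assms(1,4)])
  interpret Q: is_functor "opposite box" C "chain_functor C Y ?F'"
    by (rule is_functor_chain_functor[OF assms(2) F'])
  interpret F: coefficient_system C X F by fact
  interpret F': coefficient_system C Y ?F' by fact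
  note cX = has_coproduct_cells[OF assms(4) subset_refl]
    and cY = has_coproduct_cells[OF F' subset_refl]
    and cf = has_coproduct_fibre[OF assms(4), of f]
  note X = cubical_setD[OF assms(1)] and Y = cubical_setD[OF assms(2)] and f = cubical_mapD[OF assms(3)]
  have j: "?j n (fun_of (f n) x) x \<in> Hom C (obmap F (n, x)) (obmap ?F' (n, fun_of (f n) x))"
    if "x \<in> cells X n" for n x
    unfolding obmap_direct_image using coprod_in_in_Hom[OF cf] that by (simp add: fibre_def)
  show ?thesis
  proof
    fix n k \<alpha>
    show "compare_chains C X Y f F n \<in> Hom C (obmap (chain_functor C X F) n) (obmap (chain_functor C Y ?F') n)"
      using compare_chains_in_Hom[OF assms(3,4) F'] by (simp add: chain_functor_def)
    assume "\<alpha> \<in> Hom (opposite box) n k"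
    hence \<alpha>: "\<alpha> \<in> Hom box k n" by simp
    let ?r = "reindex_map C (cells X n) (\<lambda>x. obmap F (n, x)) (cells Y k) (\<lambda>y. obmap ?F' (k, y))
        (\<lambda>x. fun_of (f k) (act X \<alpha> x))
        (\<lambda>x. ?j k (fun_of (f k) (act X \<alpha> x)) (act X \<alpha> x) \<cdot> arrmap F (\<alpha>, x))"
    have "compare_chains C X Y f F k \<cdot> arrmap (chain_functor C X F) \<alpha> = ?r"
      unfolding compare_chains_def arrmap_chain_functor[OF \<alpha>]
      by (rule reindex_map_Comp[OF cX cX cY]) (use X(1)[OF \<alpha>] F.coeff_arr[OF \<alpha>] f(1) j in auto)
    moreover have "arrmap (chain_functor C Y ?F') \<alpha> \<cdot> compare_chains C X Y f F n = ?r"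
      unfolding compare_chains_def arrmap_chain_functor[OF \<alpha>]
    proof (rule reindex_map_Comp[OF cX cY cY])
      fix x assume x: "x \<in> cells X n"
      have fib: "x \<in> fibre X f n (fun_of (f n) x)" using x by (simp add: fibre_def)
      \<comment> \<open>The arrow of the direct image is evaluated on the injection of x. Its index
        map \<open>act X \<alpha>\<close> respects fibres because \<open>f\<close> commutes with the
        action of \<open>\<alpha>\<close>; the same fact then identifies the fibre over the image of
        \<open>act X \<alpha> x\<close>.\<close>
      have "arrmap ?F' (\<alpha>, fun_of (f n) x) \<cdot> ?j n (fun_of (f n) x) x
          = ?j k (act Y \<alpha> (fun_of (f n) x)) (act X \<alpha> x) \<cdot> arrmap F (\<alpha>, x)"
        unfolding arrmap_direct_image[OF \<alpha>]
        by (rule reindex_map_Comp_in[OF cf cf])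
          (use act_in_fibre[OF assms(1,3) \<alpha>] fib F.coeff_arr[OF \<alpha>] in \<open>auto simp: fibre_def\<close>)
      thus "?j k (fun_of (f k) (act X \<alpha> x)) (act X \<alpha> x) \<cdot> arrmap F (\<alpha>, x)
          = arrmap ?F' (\<alpha>, fun_of (f n) x) \<cdot> ?j n (fun_of (f n) x) x"
        using f(2)[OF \<alpha> x] by simp
    qed (use Y(1)[OF \<alpha>] F'.coeff_arr[OF \<alpha>] f(1) f(2)[OF \<alpha>] j in auto)
    ultimately show "compare_chains C X Y f F k \<cdot> arrmap (chain_functor C X F) \<alpha>
        = arrmap (chain_functor C Y ?F') \<alpha> \<cdot> compare_chains C X Y f F n" by simp
  qed
qed

text \<open>Componentwise inverses of a natural transformation are natural, which avoids a
  computation with the iterated \<open>copair\<close>.\<close>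

lemma nat_trans_compare_chains_inv:
  fixes X Y :: "'u cubical"
  assumes "cubical_set X" "cubical_set Y" "cubical_map X Y f" "coefficient_system C X F"
  shows "nat_trans (opposite box) C (chain_functor C Y (direct_image C X Y f F)) (chain_functor C X F)
    (compare_chains_inv C X Y f F)"
proof -
  let ?F' = "direct_image C X Y f F"
  let ?P = "chain_functor C X F" and ?Q = "chain_functor C Y ?F'"
  let ?\<phi> = "compare_chains C X Y f F" and ?\<psi> = "compare_chains_inv C X Y f F"
  have F': "coefficient_system C Y ?F'"
    by (rule coefficient_system_direct_image[OF assms])
  note n = nat_trans_compare_chains[OF assms]
  interpret P: is_functor "opposite box" C ?P by (rule cubical_nat_transD(1)[OF n])
  interpret Q: is_functor "opposite box" C ?Q by (rule cubical_nat_transD(2)[OF n])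
  have ob: "obmap (chain_functor C Z G) n = chains C Z G n" for Z :: "'u cubical" and G n
    by (simp add: chain_functor_def)
  note \<phi> = compare_chains_in_Hom[OF assms(3,4) F'] and \<psi> = compare_chains_inv_in_Hom[OF assms(4) F']
    and inv = compare_chains_inverse[OF assms(3,4) F']
  show ?thesis
  proof
    fix n k \<alpha>
    show "?\<psi> n \<in> Hom C (obmap ?Q n) (obmap ?P n)" unfolding ob by (rule \<psi>)
    assume "\<alpha> \<in> Hom (opposite box) n k"
    hence \<alpha>: "\<alpha> \<in> Hom box k n" by simp
    note p = P.arrmap_in_Hom[of \<alpha> n k, simplified Hom_opposite ob, OF \<alpha>]
    note q = Q.arrmap_in_Hom[of \<alpha> n k, simplified Hom_opposite ob, OF \<alpha>]
    \<comment> \<open>Inserting the identity \<open>?\<phi> n \<cdot> ?\<psi> n\<close> exposes the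
      naturality square of \<open>?\<phi>\<close>; afterwards
      \<open>?\<psi> k \<cdot> ?\<phi> k\<close> cancels on the other side.\<close>
    have "?\<psi> k \<cdot> arrmap ?Q \<alpha> = (?\<psi> k \<cdot> arrmap ?Q \<alpha>) \<cdot> (?\<phi> n \<cdot> ?\<psi> n)"
      using Comp_Ide[OF Comp_in_Hom[OF q \<psi>]] inv by simp
    also have "\<dots> = (?\<psi> k \<cdot> (arrmap ?Q \<alpha> \<cdot> ?\<phi> n)) \<cdot> ?\<psi> n"
      using Comp_assoc[OF \<psi> \<phi> Comp_in_Hom[OF q \<psi>]] Comp_assoc[OF \<phi> q \<psi>] by simp
    also have "\<dots> = (?\<psi> k \<cdot> (?\<phi> k \<cdot> arrmap ?P \<alpha>)) \<cdot> ?\<psi> n"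
      using cubical_nat_transD(4)[OF n \<alpha>] by simp
    also have "\<dots> = arrmap ?P \<alpha> \<cdot> ?\<psi> n"
      using Comp_assoc[OF p \<phi> \<psi>] inv Ide_Comp[OF p] by simp
    finally show "?\<psi> k \<cdot> arrmap ?Q \<alpha> = arrmap ?P \<alpha> \<cdot> ?\<psi> n" .
  qed
qed

text \<open>Both composites apply \<open>\<eta> (n, x)\<close> on the summand of x and then inject
  into the fibre of x and into the chains of \<open>Y\<close>; the square thus commutes before
  homology is taken.\<close>

lemma compare_chains_natural:
  fixes X Y :: "'u cubical"
  assumes "cubical_set X" "cubical_set Y" "cubical_map X Y f" "coefficient_map C X F G \<eta>"
  shows "compare_chains C X Y f G n \<cdot> chain_map C X F G \<eta> n
    = chain_map C Y (direct_image C X Y f F) (direct_image C X Y f G) (direct_image_map C X f F G \<eta>) n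
      \<cdot> compare_chains C X Y f F n"
proof -
  let ?F' = "direct_image C X Y f F" and ?G' = "direct_image C X Y f G"
  let ?\<eta>' = "direct_image_map C X f F G \<eta>"
  interpret coefficient_map C X F G \<eta> by fact
  have FG: "coefficient_system C X F" "coefficient_system C X G" by unfold_locales
  interpret \<eta>': coefficient_map C Y ?F' ?G' ?\<eta>'
    by (rule coefficient_map_direct_image[OF assms])
  have FG': "coefficient_system C Y ?F'" "coefficient_system C Y ?G'" by unfold_locales
  note cF = has_coproduct_cells[OF FG(1) subset_refl] and cG = has_coproduct_cells[OF FG(2) subset_refl]
    and cF' = has_coproduct_cells[OF FG'(1) subset_refl] and cG' = has_coproduct_cells[OF FG'(2) subset_refl]
    and ff = has_coproduct_fibre[OF FG(1), of f n] and fg = has_coproduct_fibre[OF FG(2), of f n]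
  note f = cubical_mapD(1)[OF assms(3)]
  have fib: "x \<in> fibre X f n (fun_of (f n) x)" if "x \<in> cells X n" for x
    using that by (simp add: fibre_def)
  have jF: "coprod_in C (fibre X f n (fun_of (f n) x)) (\<lambda>x. obmap F (n, x)) x
      \<in> Hom C (obmap F (n, x)) (obmap ?F' (n, fun_of (f n) x))" if "x \<in> cells X n" for x
    unfolding obmap_direct_image using coprod_in_in_Hom[OF ff fib[OF that]] .
  have jG: "coprod_in C (fibre X f n (fun_of (f n) x)) (\<lambda>x. obmap G (n, x)) x
      \<in> Hom C (obmap G (n, x)) (obmap ?G' (n, fun_of (f n) x))" if "x \<in> cells X n" for x
    unfolding obmap_direct_image using coprod_in_in_Hom[OF fg fib[OF that]] .
  let ?r = "reindex_map C (cells X n) (\<lambda>x. obmap F (n, x)) (cells Y n) (\<lambda>y. obmap ?G' (n, y)) (fun_of (f n))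
      (\<lambda>x. coprod_in C (fibre X f n (fun_of (f n) x)) (\<lambda>x. obmap G (n, x)) x \<cdot> \<eta> (n, x))"
  have "compare_chains C X Y f G n \<cdot> chain_map C X F G \<eta> n = ?r"
    unfolding compare_chains_def chain_map_def coprod_map_eq_reindex_map
    by (rule reindex_map_Comp[OF cF cG cG']) (use f jG coeff_component in auto)
  moreover have "chain_map C Y ?F' ?G' ?\<eta>' n \<cdot> compare_chains C X Y f F n = ?r"
    unfolding compare_chains_def chain_map_def coprod_map_eq_reindex_map
  proof (rule reindex_map_Comp[OF cF cF' cG'])
    fix x assume x: "x \<in> cells X n"
    show "coprod_in C (fibre X f n (fun_of (f n) x)) (\<lambda>x. obmap G (n, x)) x \<cdot> \<eta> (n, x)
        = ?\<eta>' (n, fun_of (f n) x) \<cdot> coprod_in C (fibre X f n (fun_of (f n) x)) (\<lambda>x. obmap F (n, x)) x"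
      unfolding direct_image_map_def split_conv coprod_map_eq_reindex_map
      by (rule reindex_map_Comp_in[symmetric, OF ff fg])
        (use fib[OF x] coeff_component in \<open>auto simp: fibre_def\<close>)
  qed (use f jF \<eta>'.coeff_component in auto)
  ultimately show ?thesis by simp
qed

end

theorem corollary5p3:
  fixes A :: "('o, 'a, 'z) preadditive_data_scheme"
    and X Y :: "'u cubical"
    and f :: "nat \<Rightarrow> 'u set_arrow"
  assumes "AB4_category TYPE('u) A"
    and "cubical_set X"
    and "cubical_set Y"
    and "cubical_map X Y f"
  shows "\<forall>n. \<exists>\<theta> :: ('u, 'o, 'a) coeff \<Rightarrow> 'a.
     (\<forall>F. is_functor (opposite (elements X)) A F \<longrightarrow>
        \<theta> F \<in> Hom A (cubical_homology A n X F) (cubical_homology A n Y (direct_image A X Y f F))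
        \<and> is_iso A (\<theta> F)) \<and>
     (\<forall>F G \<eta>. nat_trans (opposite (elements X)) A F G \<eta> \<longrightarrow>
        \<theta> G \<cdot>\<^bsub>A\<^esub> cubical_homology_map A n X F G \<eta>
        = cubical_homology_map A n Y (direct_image A X Y f F) (direct_image A X Y f G)
             (direct_image_map A X f F G \<eta>) \<cdot>\<^bsub>A\<^esub> \<theta> F)"
proof (intro allI exI conjI impI)
  fix n
  let ?D = "direct_image A X Y f"
  let ?P = "chain_functor A X" and ?Q = "\<lambda>F. chain_functor A Y (?D F)"
  let ?\<phi> = "\<lambda>F. normalized_map A (?P F) (?Q F) (compare_chains A X Y f F)"
  \<comment> \<open>The family that the existential quantifier asks for, given by one formula in
    \<open>F\<close>; the schematic variable left by \<open>exI\<close> is bound to it at the first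
    \<open>show\<close>.\<close>
  let ?\<theta> = "\<lambda>F. homology_map A (normalized A (?P F)) (normalized A (?Q F)) (?\<phi> F) n"
  interpret category_with_coproducts A "TYPE('u)"
    using assms(1) by (simp add: AB4_category_def category_with_coproducts_def
        category_with_coproducts_axioms_def)
  note nat = nat_trans_compare_chains[OF assms(2-4)] nat_trans_compare_chains_inv[OF assms(2-4)]
  note fct = cubical_nat_transD(1)[OF nat(1)] cubical_nat_transD(2)[OF nat(1)]
  note cpx = is_complex_normalized[OF fct(1)] is_complex_normalized[OF fct(2)]
  note cm = is_chain_map_normalized_map[OF nat(1)] is_chain_map_normalized_map[OF nat(2)]
  have ob: "obmap (chain_functor A Z G) m = chains A Z G m" for Z :: "'u cubical" and G m
    by (simp add: chain_functor_def)
  {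
    fix F assume "is_functor (opposite (elements X)) A F"
    hence F: "coefficient_system A X F" by (rule coefficient_system_functor[OF assms(2)])
    have F': "coefficient_system A Y (?D F)"
      by (rule coefficient_system_direct_image[OF assms(2-4) F])
    show "?\<theta> F \<in> Hom A (cubical_homology A n X F) (cubical_homology A n Y (?D F))"
      using homology_map_in_Hom[OF cpx cm(1)] F
      by (simp add: cubical_homology_def normal_chains_eq_normalized)
    note inv = compare_chains_inverse[OF assms(4) F F', folded ob]
    show "is_iso A (?\<theta> F)"
      using is_iso_homology_map[OF cpx cm] normalized_map_inverse[OF nat inv(1)]
        normalized_map_inverse[OF nat(2,1) inv(2)] F by blast
  }
  fix F G \<eta> assume "nat_trans (opposite (elements X)) A F G \<eta>"
  hence \<eta>: "coefficient_map A X F G \<eta>" by (rule coefficient_map_nat_trans[OF assms(2)])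
  interpret coefficient_map A X F G \<eta> by fact
  have FG: "coefficient_system A X F" "coefficient_system A X G" by unfold_locales
  let ?\<eta>' = "direct_image_map A X f F G \<eta>"
  note nX = nat_trans_chain_map[OF assms(2) \<eta>]
  note nY = nat_trans_chain_map[OF assms(3) coefficient_map_direct_image[OF assms(2-4) \<eta>]]
  note c = is_chain_map_normalized_map[OF nX] is_chain_map_normalized_map[OF nY]
  \<comment> \<open>The square is needed in every degree m: \<open>homology_map_Comp\<close> turns
    both sides into \<open>homology_map\<close> of a family of composites, and these families have
    to coincide.\<close>
  have "normalized_map A (?P G) (?Q G) (compare_chains A X Y f G) m \<cdot>\<^bsub>A\<^esub>
        normalized_map A (?P F) (?P G) (chain_map A X F G \<eta>) m
      = normalized_map A (?Q F) (?Q G) (chain_map A Y (?D F) (?D G) ?\<eta>') m \<cdot>\<^bsub>A\<^esub>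
        normalized_map A (?P F) (?Q F) (compare_chains A X Y f F) m" for m
    unfolding normalized_map_Comp[OF nX nat(1)[OF FG(2)]] normalized_map_Comp[OF nat(1)[OF FG(1)] nY]
      compare_chains_natural[OF assms(2-4) \<eta>] ..
  thus "?\<theta> G \<cdot>\<^bsub>A\<^esub> cubical_homology_map A n X F G \<eta>
        = cubical_homology_map A n Y (?D F) (?D G) ?\<eta>' \<cdot>\<^bsub>A\<^esub> ?\<theta> F"
    unfolding cubical_homology_map_def normal_chains_eq_normalized normal_chains_map_eq_normalized_map
      homology_map_Comp[OF cpx(1)[OF FG(1)] cpx(1)[OF FG(2)] cpx(2)[OF FG(2)] c(1) cm(1)[OF FG(2)]]
      homology_map_Comp[OF cpx(1)[OF FG(1)] cpx(2)[OF FG(1)] cpx(2)[OF FG(2)] cm(1)[OF FG(1)] c(2)]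
    by simp
qed

end
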